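(* Assume (A1), (A2) and (A3). For each $\varepsilon>0$ let $u^\varepsilon$ be the viscosity solution of $$\partial_t^\alpha u^\varepsilon + H\left(\tfrac{x}{\varepsilon}, Du^\varepsilon\right)=0 \ \text{ in } \mathbb{R}^N\times(0,T),\qquad u^\varepsilon(\cdot,0)=u_0 \ \text{ on } \mathbb{R}^N.$$ Then, as $\varepsilon\to 0$, $u^\varepsilon$ converges locally uniformly in $\mathbb{R}^N\times[0,T]$ to the function $\overline{u}\in C(\mathbb{R}^N\times[0,T])$, where $\overline{u}$ is the unique viscosity solution of $$\partial_t^\alpha \overline{u} + \overline{H}(D\overline{u})=0 \ \text{ in } \mathbb{R}^N\times(0,T),\qquad \overline{u}(\cdot,0)=u_0 \ \text{ on } \mathbb{R}^N,$$ and $\overline{H}$ is the effective Hamiltonian of $H$.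
   Context: $T>0$ and $\alpha\in(0,1)$ are fixed constants, and $\varepsilon>0$ is a parameter. $H:\mathbb{R}^N\times\mathbb{R}^N\to\mathbb{R}$, $(y,p)\mapsto H(y,p)$, and $u_0:\mathbb{R}^N\to\mathbb{R}$ are continuous. The assumptions are: (A1) $\lim_{r\to\infty}\inf\{H(y,p): y\in\mathbb{R}^N, |p|\ge r\}=\infty$. (A2) $H(y+k,p)=H(y,p)$ for all $y,p\in\mathbb{R}^N$, $k\in\mathbb{Z}^N$. (A3) $u_0\in \mathrm{Lip}(\mathbb{R}^N)\cap \mathrm{BUC}(\mathbb{R}^N)$ ($u_0$ is Lipschitz, bounded and uniformly continuous). Caputo derivative: $\partial_t^\alpha u(x,t)=\frac{1}{\Gamma(1-\alpha)}\int_0^t (t-s)^{-\alpha}\partial_s u(x,s)\,ds$. For a function $f$ of $(x,t)$, $t\in(0,T]$ and $0\le a<b\le t$ put $$J[f](x,t)=\frac{f(x,t)-f(x,0)}{t^\alpha\,\Gamma(1-\alpha)},\qquad K_{(a,b)}[f](x,t)=\frac{\alpha}{\Gamma(1-\alpha)}\int_a^b\frac{f(x,t)-f(x,t-\tau)}{\tau^{\alpha+1}}\,d\tau .$$ Viscosity solutions: for a continuous $F:\mathbb{R}^N\times\mathbb{R}^N\to\mathbb{R}$, an upper semicontinuous $u:\mathbb{R}^N\times[0,T]\to\mathbb{R}$ is a viscosity subsolution of $\partial_t^\alpha u+F(x,Du)=0$, $u(\cdot,0)=u_0$, if $u(\cdot,0)\le u_0$ and, for every $\varphi\in C^1(\mathbb{R}^N\times(0,T])\cap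 C(\mathbb{R}^N\times[0,T])$, whenever $u-\varphi$ attains a maximum over $\mathbb{R}^N\times[0,T]$ at $(\hat x,\hat t)\in\mathbb{R}^N\times(0,T]$, $$J[\varphi](\hat x,\hat t)+K_{(0,\hat t)}[\varphi](\hat x,\hat t)+F(\hat x,D\varphi(\hat x,\hat t))\le 0 .$$ A lower semicontinuous $u$ is a viscosity supersolution if $u(\cdot,0)\ge u_0$ and the reverse inequality ($\ge 0$) holds whenever $u-\varphi$ attains a minimum over $\mathbb{R}^N\times[0,T]$ at $(\hat x,\hat t)\in\mathbb{R}^N\times(0,T]$. A continuous function is a viscosity solution if it is both. Here $D$ is the gradient in $x$. The problem for $u^\varepsilon$ corresponds to $F(x,p)=H(x/\varepsilon,p)$, and the problem for $\overline u$ to $F(x,p)=\overline H(p)$. "The viscosity solution" means the unique viscosity solution in $\mathrm{BUC}(\mathbb{R}^N\times[0,T])$. Effective Hamiltonian: for each $p\in\mathbb{R}^N$, $\overline H(p)\in\mathbb{R}$ is the unique constant for which the cell problem $H(y,p+Dv(y))=\overline H(p)$ in $\mathbb{T}^N=\mathbb{R}^N/\mathbb{Z}^N$ has a continuous viscosity solution $v$. *)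

theory Defs
  imports "HOL-Analysis.Analysis"
begin

definition space_time :: "real \<Rightarrow> ((real ^ 'n) \<times> real) set" where
  "space_time T = UNIV \<times> {0..T}"

definition J_op :: "real \<Rightarrow> ((real ^ 'n) \<times> real \<Rightarrow> real) \<Rightarrow> real ^ 'n \<Rightarrow> real \<Rightarrow> real" where
  "J_op \<alpha> f x t = (f (x, t) - f (x, 0)) / (t powr \<alpha> * Gamma (1 - \<alpha>))"

definition K_op ::
  "real \<Rightarrow> real \<Rightarrow> real \<Rightarrow> ((real ^ 'n) \<times> real \<Rightarrow> real) \<Rightarrow> real ^ 'n \<Rightarrow> real \<Rightarrow> real" where
  "K_op \<alpha> a b f x t =
     \<alpha> / Gamma (1 - \<alpha>) *
     (LINT \<tau>:{a<..<b}|lborel. (f (x, t) - f (x, t - \<tau>)) / \<tau> powr (\<alpha> + 1))"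

text \<open>
  \<open>f\<close> is continuously differentiable on \<open>S\<close> with gradient \<open>G\<close>. The derivative is taken within \<open>S\<close>,
  so that on \<open>UNIV \<times> {0<..T}\<close> it is one-sided in time at \<open>t = T\<close>.
\<close>

definition has_C1_gradient_on :: "('a::real_inner \<Rightarrow> real) \<Rightarrow> ('a \<Rightarrow> 'a) \<Rightarrow> 'a set \<Rightarrow> bool" where
  "has_C1_gradient_on f G S \<longleftrightarrow>
     continuous_on S G \<and> (\<forall>z\<in>S. (f has_derivative (\<lambda>h. G z \<bullet> h)) (at z within S))"

text \<open>
  Space-time gradients live in \<open>(real ^ 'n) \<times> real\<close>; the gradient in \<open>x\<close> is the first component.
\<close>

definition test_function ::
  "real \<Rightarrow> ((real ^ 'n) \<times> real \<Rightarrow> real) \<Rightarrow> ((real ^ 'n) \<times> real \<Rightarrow> (real ^ 'n) \<times> real) \<Rightarrow> bool" where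
  "test_function T \<phi> G \<longleftrightarrow>
     continuous_on (space_time T) \<phi> \<and> has_C1_gradient_on \<phi> G (UNIV \<times> {0<..T})"

definition usc_on :: "'a::topological_space set \<Rightarrow> ('a \<Rightarrow> real) \<Rightarrow> bool" where
  "usc_on S f \<longleftrightarrow> (\<forall>c. openin (top_of_set S) {z \<in> S. f z < c})"

definition lsc_on :: "'a::topological_space set \<Rightarrow> ('a \<Rightarrow> real) \<Rightarrow> bool" where
  "lsc_on S f \<longleftrightarrow> (\<forall>c. openin (top_of_set S) {z \<in> S. c < f z})"

definition viscosity_subsolution ::
  "real \<Rightarrow> real \<Rightarrow> (real ^ 'n \<Rightarrow> real ^ 'n \<Rightarrow> real) \<Rightarrow> (real ^ 'n \<Rightarrow> real) \<Rightarrow>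
   ((real ^ 'n) \<times> real \<Rightarrow> real) \<Rightarrow> bool" where
  "viscosity_subsolution T \<alpha> F u0 u \<longleftrightarrow>
     usc_on (space_time T) u \<and>
     (\<forall>x. u (x, 0) \<le> u0 x) \<and>
     (\<forall>\<phi> G x t. test_function T \<phi> G \<and> t \<in> {0<..T} \<and>
        (\<forall>z\<in>space_time T. u z - \<phi> z \<le> u (x, t) - \<phi> (x, t)) \<longrightarrow>
        J_op \<alpha> \<phi> x t + K_op \<alpha> 0 t \<phi> x t + F x (fst (G (x, t))) \<le> 0)"

definition viscosity_supersolution ::
  "real \<Rightarrow> real \<Rightarrow> (real ^ 'n \<Rightarrow> real ^ 'n \<Rightarrow> real) \<Rightarrow> (real ^ 'n \<Rightarrow> real) \<Rightarrow>
   ((real ^ 'n) \<times> real \<Rightarrow> real) \<Rightarrow> bool" where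
  "viscosity_supersolution T \<alpha> F u0 u \<longleftrightarrow>
     lsc_on (space_time T) u \<and>
     (\<forall>x. u (x, 0) \<ge> u0 x) \<and>
     (\<forall>\<phi> G x t. test_function T \<phi> G \<and> t \<in> {0<..T} \<and>
        (\<forall>z\<in>space_time T. u z - \<phi> z \<ge> u (x, t) - \<phi> (x, t)) \<longrightarrow>
        J_op \<alpha> \<phi> x t + K_op \<alpha> 0 t \<phi> x t + F x (fst (G (x, t))) \<ge> 0)"

definition viscosity_solution ::
  "real \<Rightarrow> real \<Rightarrow> (real ^ 'n \<Rightarrow> real ^ 'n \<Rightarrow> real) \<Rightarrow> (real ^ 'n \<Rightarrow> real) \<Rightarrow>
   ((real ^ 'n) \<times> real \<Rightarrow> real) \<Rightarrow> bool" where
  "viscosity_solution T \<alpha> F u0 u \<longleftrightarrow>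
     continuous_on (space_time T) u \<and>
     viscosity_subsolution T \<alpha> F u0 u \<and> viscosity_supersolution T \<alpha> F u0 u"

definition BUC_on :: "'a::metric_space set \<Rightarrow> ('a \<Rightarrow> real) \<Rightarrow> bool" where
  "BUC_on S f \<longleftrightarrow> bounded (f ` S) \<and> uniformly_continuous_on S f"

definition integer_periodic :: "(real ^ 'n \<Rightarrow> 'b) \<Rightarrow> bool" where
  "integer_periodic f \<longleftrightarrow> (\<forall>y k. (\<forall>i. k $ i \<in> \<int>) \<longrightarrow> f (y + k) = f y)"

text \<open>
  Functions on the torus are represented by their periodic lifts to \<open>real ^ 'n\<close>; being a viscosity
  solution is a local property there, tested at local extrema of \<open>v - \<phi>\<close> with \<open>\<phi>\<close> of class \<open>C\<^sup>1\<close>.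
\<close>

definition cell_solution ::
  "(real ^ 'n \<Rightarrow> real ^ 'n \<Rightarrow> real) \<Rightarrow> real ^ 'n \<Rightarrow> real \<Rightarrow> (real ^ 'n \<Rightarrow> real) \<Rightarrow> bool" where
  "cell_solution H p c v \<longleftrightarrow>
     continuous_on UNIV v \<and> integer_periodic v \<and>
     (\<forall>\<phi> G y. has_C1_gradient_on \<phi> G UNIV \<and>
        (\<forall>\<^sub>F z in nhds y. v z - \<phi> z \<le> v y - \<phi> y) \<longrightarrow> H y (p + G y) \<le> c) \<and>
     (\<forall>\<phi> G y. has_C1_gradient_on \<phi> G UNIV \<and>
        (\<forall>\<^sub>F z in nhds y. v z - \<phi> z \<ge> v y - \<phi> y) \<longrightarrow> H y (p + G y) \<ge> c)"

definition effective_Hamiltonian ::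
  "(real ^ 'n \<Rightarrow> real ^ 'n \<Rightarrow> real) \<Rightarrow> (real ^ 'n \<Rightarrow> real) \<Rightarrow> bool" where
  "effective_Hamiltonian H Hbar \<longleftrightarrow> (\<forall>p c. (\<exists>v. cell_solution H p c v) \<longleftrightarrow> c = Hbar p)"

end

theory Submission
  imports Defs
begin

text \<open>
  The proof compares the relaxed upper limit \<open>u\<^sup>*\<close> and the relaxed lower limit \<open>u\<^sub>*\<close> of the family
  \<open>u \<epsilon>\<close>. If \<open>u\<^sup>*\<close> is a subsolution and \<open>u\<^sub>*\<close> a supersolution of the effective problem, then comparison
  gives \<open>u\<^sup>* \<le> u\<^sub>*\<close>. Since \<open>u\<^sub>* \<le> u\<^sup>*\<close> always holds, the two limits coincide, and equality of the relaxed
  limits is locally uniform convergence. Existence of a solution of the effective problem is a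
  by-product, and its uniqueness is comparison again.

  Throughout, the Caputo derivative is used in its Marchaud form: with \<open>f\<close> extended by \<open>f (x, 0)\<close> to
  negative times, \<open>J + K\<close> is a multiple of the integral of \<open>f (x, t) - f (x, t - \<tau>)\<close> against
  \<open>1 / \<tau> powr (\<alpha> + 1)\<close> over all \<open>\<tau> > 0\<close>. The domain of integration no longer depends on \<open>t\<close>, so that
  limits in \<open>t\<close> are dominated convergence and two different times can be compared under one integral.
  Since \<open>-u\<close> is a subsolution for \<open>- F x (- p)\<close> whenever \<open>u\<close> is a supersolution for \<open>F\<close>, every argument
  is carried out for subsolutions only.

  Four arguments carry the proof.

  Barriers (\<open>subsolution_barrier\<close>). The function \<open>u0 y + L * sqrt (\<delta> + (norm (x - y))\<^sup>2) + C * t powr \<alpha>\<close>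
  has gradient at most \<open>L\<close>, and its Caputo derivative is at least \<open>C / Gamma (1 - \<alpha>)\<close>. For large \<open>C\<close> it lies
  above every bounded subsolution, and letting \<open>\<delta>\<close> tend to \<open>0\<close> gives \<open>\<bar>u \<epsilon> (x, t) - u0 x\<bar> \<le> C * t powr \<alpha>\<close>
  with \<open>C\<close> independent of \<open>\<epsilon>\<close>. The relaxed limits are therefore bounded and attain the initial data.

  Comparison (\<open>comparison_with_moduli\<close>). Doubling space and time gives a maximum of
  \<open>u (x, t) - v (y, s)\<close> minus penalties. Going back in time from both points does not increase the
  doubled function, so the difference of the two Marchaud integrals is nonnegative up to the
  contribution of small \<open>\<tau>\<close>; for \<open>\<tau> \<ge> T\<close> both points have reached the initial time, and the definite gain
  there contradicts the two viscosity inequalities. For this the history of \<open>u\<close>, not that of a test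
  function, must enter the viscosity inequality (\<open>subsolution_with_history\<close>). As the effective
  Hamiltonian does not depend on \<open>x\<close>, the penalties may be centred at a shift in space and time, and the
  same argument yields a modulus of continuity of the limit.

  Perturbed test functions (\<open>perturbed_test_function\<close>). If \<open>u\<^sup>* - \<phi>\<close> has a maximum at \<open>(x0, t0)\<close> and \<open>v\<close> is a
  corrector for the gradient of \<open>\<phi>\<close> there, then \<open>u \<epsilon> - \<phi>\<close> is compared with \<open>\<epsilon> * v (x /\<^sub>R \<epsilon>)\<close>. The corrector
  is merely continuous, so this takes a further doubling of \<open>x\<close> with penalty
  \<open>(norm (x - y))\<^sup>2 / \<epsilon> ^ 3\<close>; the cell equation at \<open>y\<close> brings in the effective Hamiltonian.

  Continuity of the effective Hamiltonian (\<open>effective_Hamiltonian_continuous\<close>), used in comparison,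
  follows by doubling correctors for neighbouring gradients; coercivity confines the gradients that
  occur to a compact set.
\<close>

section \<open>The Caputo derivative in Marchaud form\<close>

text \<open>
  For \<open>d \<tau> = f t - f (t - \<tau>)\<close> this is the Marchaud fractional derivative of \<open>f\<close> at \<open>t\<close>, up to the
  factor \<open>\<alpha> / Gamma (1 - \<alpha>)\<close>. It is a functional of the increments, because increments of different
  functions at different times have to be added.
\<close>
definition marchaud :: "real \<Rightarrow> (real \<Rightarrow> real) \<Rightarrow> real" where
  "marchaud \<alpha> d = (LINT \<tau>:{0<..}|lborel. d \<tau> / \<tau> powr (\<alpha> + 1))"

text \<open>
  The time reached by going back from \<open>t\<close> by \<open>\<tau>\<close>, stopped at the initial time. The absolute value keeps
  \<open>lag t \<tau>\<close> between \<open>0\<close> and \<open>t\<close> for every real \<open>\<tau>\<close>, so that a function on \<open>{0..T}\<close> composed with it is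
  measurable on the whole line.
\<close>
definition lag :: "real \<Rightarrow> real \<Rightarrow> real" where
  "lag t \<tau> = max 0 (t - \<bar>\<tau>\<bar>)"

lemma kernel_tail:
  fixes \<alpha> a :: real
  assumes "0 < \<alpha>" "0 < a"
  shows "set_integrable lborel {a..} (\<lambda>\<tau>. 1 / \<tau> powr (\<alpha> + 1))"
    and "(LINT \<tau>:{a..}|lborel. 1 / \<tau> powr (\<alpha> + 1)) = 1 / (\<alpha> * a powr \<alpha>)"
proof -
  have e: "1 / \<tau> powr (\<alpha> + 1) = \<tau> powr (- \<alpha> - 1)" for \<tau> :: real
    using powr_minus_divide[of \<tau> "\<alpha> + 1"] by simp
  have hi: "((\<lambda>\<tau>. 1 / \<tau> powr (\<alpha> + 1)) has_integral 1 / (\<alpha> * a powr \<alpha>)) {a..}"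
    using has_integral_powr_to_inf[of "- \<alpha> - 1" a] assms
    by (simp only: e) (simp add: powr_minus_divide mult.commute)
  have ab: "(\<lambda>\<tau>. 1 / \<tau> powr (\<alpha> + 1)) absolutely_integrable_on {a..}"
    by (rule nonnegative_absolutely_integrable_1) (use hi in auto)
  have m: "set_borel_measurable borel {a..} (\<lambda>\<tau>. 1 / \<tau> powr (\<alpha> + 1))"
    unfolding set_borel_measurable_def by measurable
  show si: "set_integrable lborel {a..} (\<lambda>\<tau>. 1 / \<tau> powr (\<alpha> + 1))"
    using ab m unfolding set_integrable_def set_borel_measurable_def 
    by (simp add: integrable_completion)
  show "(LINT \<tau>:{a..}|lborel. 1 / \<tau> powr (\<alpha> + 1)) = 1 / (\<alpha> * a powr \<alpha>)"
    using set_borel_integral_eq_integral(2)[OF si] hi by (simp add: integral_unique)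
qed

lemma kernel_integrable_near_zero:
  fixes \<alpha> :: real
  assumes "0 < \<alpha>" "\<alpha> < 1"
  shows "set_integrable lborel {0<..1} (\<lambda>\<tau>. \<tau> / \<tau> powr (\<alpha> + 1))"
proof -
  have e: "\<tau> / \<tau> powr (\<alpha> + 1) = \<tau> powr (- \<alpha>)" if "\<tau> > 0" for \<tau> :: real
    using that by (simp add: powr_add powr_minus_divide)
  have "(\<lambda>\<tau>. \<tau> powr (- \<alpha>)) integrable_on {0..1}"
    using integrable_on_powr_from_0[of "-\<alpha>" 1] assms by simp
  then have "(\<lambda>\<tau>. \<tau> powr (- \<alpha>)) integrable_on {0<..1}"
  proof (rule integrable_spike_set)
    show "negligible {x \<in> {0..1} - {0<..1}. x powr (- \<alpha>) \<noteq> 0}"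
      by (rule negligible_subset[of "{0}"]) auto
    have "{0<..1::real} - {0..1} = {}" by auto
    then show "negligible {x \<in> {0<..1} - {0..1}. x powr (- \<alpha>) \<noteq> 0}"
      by (metis (no_types, lifting) Collect_empty_eq empty_iff negligible_empty)
  qed
  then have "(\<lambda>\<tau>. \<tau> / \<tau> powr (\<alpha> + 1)) integrable_on {0<..1}"
    by (rule integrable_eq) (use e in auto)
  then have "(\<lambda>\<tau>. \<tau> / \<tau> powr (\<alpha> + 1)) absolutely_integrable_on {0<..1}"
    by (rule nonnegative_absolutely_integrable_1) auto
  moreover have m: "set_borel_measurable borel {0<..1} (\<lambda>\<tau>. \<tau> / \<tau> powr (\<alpha> + 1))"
    unfolding set_borel_measurable_def by measurable
  ultimately show ?thesis
    unfolding set_integrable_def set_borel_measurable_def 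
    by (simp add: integrable_completion)
qed

lemma kernel_integrable_majorant:
  fixes \<alpha> :: real
  assumes "0 < \<alpha>" "\<alpha> < 1"
  shows "set_integrable lborel {0<..} (\<lambda>\<tau>. (B * min \<tau> 1) / \<tau> powr (\<alpha> + 1))"
proof -
  have 1: "set_integrable lborel {0<..1} (\<lambda>\<tau>. min \<tau> 1 / \<tau> powr (\<alpha> + 1))"
    using kernel_integrable_near_zero[OF assms]
    by (subst set_integrable_cong[where f' = "\<lambda>\<tau>. \<tau> / \<tau> powr (\<alpha> + 1)" and A' = "{0<..1}"]) auto
  have 2: "set_integrable lborel {1..} (\<lambda>\<tau>. min \<tau> 1 / \<tau> powr (\<alpha> + 1))"
    using kernel_tail(1)[OF assms(1), of 1]
    by (subst set_integrable_cong[where f' = "\<lambda>\<tau>. 1 / \<tau> powr (\<alpha> + 1)" and A' = "{1..}"]) auto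
  have "set_integrable lborel ({0<..1} \<union> {1..}) (\<lambda>\<tau>. min \<tau> 1 / \<tau> powr (\<alpha> + 1))"
    by (rule set_integrable_Un[OF 1 2]) auto
  moreover have "{0<..1} \<union> {1..} = {0::real<..}" by auto
  ultimately show ?thesis
    using set_integrable_mult_right[of B lborel "{0<..}" "\<lambda>\<tau>. min \<tau> 1 / \<tau> powr (\<alpha> + 1)"] by simp
qed

abbreviation incr :: "('a \<times> real \<Rightarrow> real) \<Rightarrow> 'a \<Rightarrow> real \<Rightarrow> real \<Rightarrow> real" where
  "incr f x t \<equiv> \<lambda>\<tau>. f (x, t) - f (x, lag t \<tau>)"

text \<open>
  Increments of a function that is Lipschitz near the current time and bounded: the bound is linear at
  \<open>0\<close>, which tames the kernel there, and constant at infinity, where the kernel itself is integrable.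
\<close>
definition small_incr :: "real \<Rightarrow> (real \<Rightarrow> real) \<Rightarrow> bool" where
  "small_incr B d \<longleftrightarrow> d \<in> borel_measurable borel \<and> (\<forall>\<tau>>0. \<bar>d \<tau>\<bar> \<le> B * min \<tau> 1)"

lemma small_incr_integrable:
  fixes \<alpha> :: real
  assumes "0 < \<alpha>" "\<alpha> < 1" "small_incr B d"
  shows "set_integrable lborel {0<..} (\<lambda>\<tau>. d \<tau> / \<tau> powr (\<alpha> + 1))"
proof (rule set_integrable_bound[OF kernel_integrable_majorant[OF assms(1,2), of B]])
  have [measurable]: "d \<in> borel_measurable borel" using assms(3) by (simp add: small_incr_def)
  show "set_borel_measurable lborel {0<..} (\<lambda>\<tau>. d \<tau> / \<tau> powr (\<alpha> + 1))"
    unfolding set_borel_measurable_def by measurable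
  show "AE x in lborel. x \<in> {0<..} \<longrightarrow>
         norm (d x / x powr (\<alpha> + 1)) \<le> norm (B * min x 1 / x powr (\<alpha> + 1))"
  proof (intro always_eventually allI impI)
    fix x :: real assume "x \<in> {0<..}"
    then have "\<bar>d x\<bar> \<le> \<bar>B * min x 1\<bar>" using assms(3) unfolding small_incr_def by fastforce
    then show "norm (d x / x powr (\<alpha> + 1)) \<le> norm (B * min x 1 / x powr (\<alpha> + 1))"
      by (simp add: abs_divide divide_right_mono)
  qed
qed

lemma marchaud_mono:
  fixes \<alpha> :: real
  assumes "0 < \<alpha>" "\<alpha> < 1" "small_incr B d" "small_incr B' e" "\<And>\<tau>. \<tau> > 0 \<Longrightarrow> d \<tau> \<le> e \<tau>"
  shows "marchaud \<alpha> d \<le> marchaud \<alpha> e"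
  unfolding marchaud_def
  by (rule set_integral_mono[OF small_incr_integrable[OF assms(1-3)] small_incr_integrable[OF assms(1,2,4)]])
     (use assms(5) in \<open>auto intro!: divide_right_mono\<close>)

lemma marchaud_add:
  fixes \<alpha> :: real
  assumes "0 < \<alpha>" "\<alpha> < 1" "small_incr B d" "small_incr B' e"
  shows "marchaud \<alpha> (\<lambda>\<tau>. d \<tau> + e \<tau>) = marchaud \<alpha> d + marchaud \<alpha> e"
  unfolding marchaud_def add_divide_distrib
  by (rule set_integral_add(2)[OF small_incr_integrable[OF assms(1-3)] small_incr_integrable[OF assms(1,2,4)]])

lemma marchaud_cmult: "marchaud \<alpha> (\<lambda>\<tau>. a * d \<tau>) = a * marchaud \<alpha> d"
  unfolding marchaud_def times_divide_eq_right[symmetric] by (rule set_integral_mult_right)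

lemma marchaud_cong:
  assumes "\<And>\<tau>. \<tau> > 0 \<Longrightarrow> d \<tau> = e \<tau>"
  shows "marchaud \<alpha> d = marchaud \<alpha> e"
  unfolding marchaud_def by (rule set_lebesgue_integral_cong) (use assms in auto)

lemma small_incr_add:
  assumes "small_incr B d" "small_incr B' e"
  shows "small_incr (B + B') (\<lambda>\<tau>. d \<tau> + e \<tau>)"
  unfolding small_incr_def
proof (intro conjI allI impI)
  show "(\<lambda>\<tau>. d \<tau> + e \<tau>) \<in> borel_measurable borel"
    using assms by (auto simp: small_incr_def)
  fix \<tau> :: real assume "\<tau> > 0"
  then have "\<bar>d \<tau>\<bar> \<le> B * min \<tau> 1" "\<bar>e \<tau>\<bar> \<le> B' * min \<tau> 1"
    using assms by (simp_all add: small_incr_def)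
  then show "\<bar>d \<tau> + e \<tau>\<bar> \<le> (B + B') * min \<tau> 1"
    unfolding distrib_right by linarith
qed

lemma small_incr_cmult:
  assumes "small_incr B d"
  shows "small_incr (\<bar>a\<bar> * B) (\<lambda>\<tau>. a * d \<tau>)"
  using assms unfolding small_incr_def by (auto simp: abs_mult mult.assoc intro!: mult_left_mono)

lemma marchaud_tendsto:
  fixes \<alpha> :: real
  assumes "0 < \<alpha>" "\<alpha> < 1" "\<And>n. small_incr B (d n)"
    and lim: "\<And>\<tau>. (\<lambda>n. d n \<tau>) \<longlonglongrightarrow> e \<tau>"
  shows "small_incr B e" "(\<lambda>n. marchaud \<alpha> (d n)) \<longlonglongrightarrow> marchaud \<alpha> e"
proof -
  have dm[measurable]: "d n \<in> borel_measurable borel" for n using assms(3)[of n] by (simp add: small_incr_def)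
  have em[measurable]: "e \<in> borel_measurable borel"
    by (rule borel_measurable_LIMSEQ_real[OF lim]) auto
  have bd: "\<bar>e \<tau>\<bar> \<le> B * min \<tau> 1" if "\<tau> > 0" for \<tau>
    by (rule tendsto_upperbound[OF tendsto_rabs[OF lim]])
       (use assms(3) that in \<open>auto simp: small_incr_def\<close>)
  show "small_incr B e" using em bd by (simp add: small_incr_def)
  show "(\<lambda>n. marchaud \<alpha> (d n)) \<longlonglongrightarrow> marchaud \<alpha> e"
    unfolding marchaud_def set_lebesgue_integral_def
  proof (rule integral_dominated_convergence)
    show "integrable lborel (\<lambda>\<tau>. indicat_real {0<..} \<tau> *\<^sub>R ((B * min \<tau> 1) / \<tau> powr (\<alpha> + 1)))"
      using kernel_integrable_majorant[OF assms(1,2), of B] unfolding set_integrable_def .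
    show "AE x in lborel. (\<lambda>i. indicat_real {0<..} x *\<^sub>R (d i x / x powr (\<alpha> + 1)))
         \<longlonglongrightarrow> indicat_real {0<..} x *\<^sub>R (e x / x powr (\<alpha> + 1))"
      unfolding divide_inverse
      by (intro always_eventually allI tendsto_scaleR tendsto_mult tendsto_const lim)
    show "AE x in lborel. norm (indicat_real {0<..} x *\<^sub>R (d i x / x powr (\<alpha> + 1)))
         \<le> indicat_real {0<..} x *\<^sub>R (B * min x 1 / x powr (\<alpha> + 1))" for i
      by (intro always_eventually allI)
         (use assms(3)[of i] in \<open>auto simp: small_incr_def indicator_def abs_divide intro!: divide_right_mono\<close>)
  qed measurable
qed

text \<open>
  For \<open>\<tau> \<ge> t\<close> the increment is the constant \<open>f (x, t) - f (x, 0)\<close>, and the kernel has the integral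
  \<open>1 / (\<alpha> * t powr \<alpha>)\<close> over \<open>{t..}\<close>: this tail is exactly the term \<open>J\<close>.
\<close>
lemma caputo_eq_marchaud:
  fixes f :: "(real ^ 'n) \<times> real \<Rightarrow> real"
  assumes "0 < \<alpha>" "\<alpha> < 1" "0 < t"
    and si: "small_incr B (incr f x t)"
  shows "J_op \<alpha> f x t + K_op \<alpha> 0 t f x t =
    \<alpha> / Gamma (1 - \<alpha>) * marchaud \<alpha> (incr f x t)"
proof -
  let ?g = "\<lambda>\<tau>. (f (x, t) - f (x, lag t \<tau>)) / \<tau> powr (\<alpha> + 1)"
  have int: "set_integrable lborel {0<..} ?g"
    by (rule small_incr_integrable[OF assms(1,2) si])
  have s: "{0<..} = {0<..<t} \<union> {t..}" using assms(3) by auto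
  have "marchaud \<alpha> (incr f x t) =
      (LINT \<tau>:{0<..<t}|lborel. ?g \<tau>) + (LINT \<tau>:{t..}|lborel. ?g \<tau>)"
    unfolding marchaud_def s
    by (rule set_integral_Un) (auto intro: set_integrable_subset[OF int] simp: assms(3) less_le_trans[OF assms(3)])
  also have "(LINT \<tau>:{0<..<t}|lborel. ?g \<tau>) =
      (LINT \<tau>:{0<..<t}|lborel. (f (x, t) - f (x, t - \<tau>)) / \<tau> powr (\<alpha> + 1))"
    by (rule set_lebesgue_integral_cong) (auto simp: lag_def)
  also have "(LINT \<tau>:{t..}|lborel. ?g \<tau>) =
      (LINT \<tau>:{t..}|lborel. (f (x, t) - f (x, 0)) * (1 / \<tau> powr (\<alpha> + 1)))"
    using assms(3) by (intro set_lebesgue_integral_cong) (auto simp: lag_def max_def)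
  also have "\<dots> = (f (x, t) - f (x, 0)) * (1 / (\<alpha> * t powr \<alpha>))"
    using kernel_tail(2)[OF assms(1,3)] by (simp only: set_integral_mult_right)
  finally have "\<alpha> / Gamma (1 - \<alpha>) * marchaud \<alpha> (incr f x t) =
      \<alpha> / Gamma (1 - \<alpha>) * (LINT \<tau>:{0<..<t}|lborel. (f (x, t) - f (x, t - \<tau>)) / \<tau> powr (\<alpha> + 1)) +
      \<alpha> / Gamma (1 - \<alpha>) * ((f (x, t) - f (x, 0)) * (1 / (\<alpha> * t powr \<alpha>)))"
    by (simp only: distrib_left)
  moreover have "\<alpha> / Gamma (1 - \<alpha>) * ((f (x, t) - f (x, 0)) * (1 / (\<alpha> * t powr \<alpha>))) = J_op \<alpha> f x t"
    using assms(1) by (simp add: J_op_def mult.commute)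
  ultimately show ?thesis
    by (simp add: K_op_def)
qed

lemma marchaud_indicator_tail:
  fixes \<alpha> :: real
  assumes "0 < \<alpha>" "0 < a"
  shows "marchaud \<alpha> (indicator {a..}) = 1 / (\<alpha> * a powr \<alpha>)"
proof -
  have "marchaud \<alpha> (indicator {a..}) = (LINT \<tau>:{a..}|lborel. 1 / \<tau> powr (\<alpha> + 1))"
    unfolding marchaud_def set_lebesgue_integral_def
    by (rule Bochner_Integration.integral_cong) (use assms in \<open>auto simp: indicator_def\<close>)
  then show ?thesis using kernel_tail(2)[OF assms] by simp
qed

lemma small_incr_indicator_tail:
  assumes "0 < a"
  shows "small_incr (1 + 1 / a) (indicator {a..})"
  unfolding small_incr_def
proof (intro conjI allI impI)
  fix \<tau> :: real assume t: "\<tau> > 0"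
  show "\<bar>indicat_real {a..} \<tau>\<bar> \<le> (1 + 1 / a) * min \<tau> 1"
  proof (cases "a \<le> \<tau>")
    case True
    then have "1 \<le> \<tau> / a" using assms by simp
    moreover have "(1 + 1/a) * \<tau> = \<tau> + \<tau> / a" by (simp add: distrib_right)
    ultimately have "1 \<le> (1 + 1/a) * \<tau>" "1 \<le> (1 + 1/a) * 1" using assms t
      by (linarith, simp)
    then show ?thesis using True by (auto simp: min_def)
  qed (use assms t in auto)
qed measurable

section \<open>Upper semicontinuous functions\<close>

text \<open>
  The sequential form of upper semicontinuity, which passes to sums and compositions directly and
  matches the compactness arguments below.
\<close>
definition seq_usc_on :: "'a::topological_space set \<Rightarrow> ('a \<Rightarrow> real) \<Rightarrow> bool" where
  "seq_usc_on S f \<longleftrightarrow> (\<forall>X z c. (\<forall>n. X n \<in> S) \<longrightarrow> z \<in> S \<longrightarrow> X \<longlonglongrightarrow> z \<longrightarrow> f z < c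
      \<longrightarrow> (\<forall>\<^sub>F n in sequentially. f (X n) < c))"

lemma seq_usc_onD:
  assumes "seq_usc_on S f" "\<And>n. X n \<in> S" "z \<in> S" "X \<longlonglongrightarrow> z" "f z < c"
  shows "\<forall>\<^sub>F n in sequentially. f (X n) < c"
  using assms unfolding seq_usc_on_def by blast

lemma usc_on_imp_seq_usc_on:
  fixes f :: "'a::topological_space \<Rightarrow> real"
  assumes "usc_on S f"
  shows "seq_usc_on S f"
  unfolding seq_usc_on_def
proof (intro allI impI)
  fix X z c assume X: "\<forall>n. X n \<in> S" "z \<in> S" "X \<longlonglongrightarrow> z" "f z < c"
  obtain U where U: "open U" "{z \<in> S. f z < c} = S \<inter> U"
    using assms unfolding usc_on_def openin_open by meson
  then have "z \<in> U" using X by auto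
  then have "\<forall>\<^sub>F n in sequentially. X n \<in> U" using X(3) U(1) by (simp add: topological_tendstoD)
  then show "\<forall>\<^sub>F n in sequentially. f (X n) < c"
    by (rule eventually_mono) (use U(2) X(1) in blast)
qed

lemma continuous_on_imp_seq_usc_on:
  fixes f :: "'a::t2_space \<Rightarrow> real"
  assumes "continuous_on S f"
  shows "seq_usc_on S f"
  unfolding seq_usc_on_def
proof (intro allI impI)
  fix X z c assume X: "\<forall>n. X n \<in> S" "z \<in> S" "X \<longlonglongrightarrow> z" "f z < c"
  have "(\<lambda>n. f (X n)) \<longlonglongrightarrow> f z"
    by (rule continuous_on_tendsto_compose[OF assms X(3,2)]) (use X(1) in auto)
  then show "\<forall>\<^sub>F n in sequentially. f (X n) < c" by (rule order_tendstoD) (rule X(4))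
qed

lemma seq_usc_on_add:
  assumes "seq_usc_on S f" "seq_usc_on S g"
  shows "seq_usc_on S (\<lambda>z. f z + g z)"
  unfolding seq_usc_on_def
proof (intro allI impI)
  fix X z c assume X: "\<forall>n. X n \<in> S" "z \<in> S" "X \<longlonglongrightarrow> z" "f z + g z < c"
  define e where "e = (c - (f z + g z)) / 2"
  have "e > 0" using X(4) by (simp add: e_def)
  then have "\<forall>\<^sub>F n in sequentially. f (X n) < f z + e" "\<forall>\<^sub>F n in sequentially. g (X n) < g z + e"
    using assms X(1-3) by (auto intro!: seq_usc_onD[of S])
  then show "\<forall>\<^sub>F n in sequentially. f (X n) + g (X n) < c"
    by eventually_elim (simp add: e_def field_simps)
qed

lemma seq_usc_on_compose:
  fixes g :: "'a::t2_space \<Rightarrow> 'b::topological_space"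
  assumes "seq_usc_on S f" "continuous_on R g" "g ` R \<subseteq> S"
  shows "seq_usc_on R (\<lambda>z. f (g z))"
  unfolding seq_usc_on_def
proof (intro allI impI)
  fix X z c assume X: "\<forall>n. X n \<in> R" "z \<in> R" "X \<longlonglongrightarrow> z" "f (g z) < c"
  have "(\<lambda>n. g (X n)) \<longlonglongrightarrow> g z"
    by (rule continuous_on_tendsto_compose[OF assms(2) X(3,2)]) (use X(1) in auto)
  then show "\<forall>\<^sub>F n in sequentially. f (g (X n)) < c"
    by (intro seq_usc_onD[OF assms(1), of "\<lambda>n. g (X n)" "g z"]) (use X assms(3) in auto)
qed

lemma seq_usc_on_diff_continuous:
  fixes f :: "'a::t2_space \<Rightarrow> real"
  assumes "seq_usc_on S f" "continuous_on S g"
  shows "seq_usc_on S (\<lambda>z. f z - g z)"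
  using seq_usc_on_add[OF assms(1) continuous_on_imp_seq_usc_on[of S "\<lambda>z. - g z"]] assms(2)
  by (simp add: continuous_on_minus)

lemma usc_attains_sup_compact:
  fixes f :: "'a::metric_space \<Rightarrow> real"
  assumes K: "compact K" "K \<noteq> {}" and f: "seq_usc_on K f"
  shows "\<exists>z\<in>K. \<forall>w\<in>K. f w \<le> f z"
proof -
  have bdd: "bdd_above (f ` K)"
  proof (rule ccontr)
    assume "\<not> bdd_above (f ` K)"
    then have "\<forall>n::nat. \<exists>z\<in>K. f z > real n" unfolding bdd_above_def by (force simp: not_le)
    then obtain X where X: "\<And>n. X n \<in> K" "\<And>n::nat. f (X n) > real n" by metis
    obtain z r where z: "z \<in> K" "strict_mono (r :: nat \<Rightarrow> nat)" "(X \<circ> r) \<longlonglongrightarrow> z"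
      using K(1) X(1) unfolding compact_def by blast
    have "\<forall>\<^sub>F n in sequentially. f ((X \<circ> r) n) < f z + 1"
      by (rule seq_usc_onD[OF f _ z(1,3)]) (use X in auto)
    moreover have "\<forall>\<^sub>F n in sequentially. real n > f z + 1"
      using filterlim_real_sequentially by (rule filterlim_at_top_dense[THEN iffD1, rule_format])
    ultimately have "\<forall>\<^sub>F n::nat in sequentially. False"
    proof eventually_elim
      case (elim n)
      have "real n \<le> real (r n)" using seq_suble[OF z(2)] by simp
      then show ?case using elim X(2)[of "r n"] by simp
    qed
    then show False by simp
  qed
  define s where "s = Sup (f ` K)"
  have le: "f w \<le> s" if "w \<in> K" for w
    unfolding s_def using bdd that by (intro cSup_upper) auto
  have "\<exists>z\<in>K. f z > s - 1 / real (Suc n)" for n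
  proof -
    have "s - 1 / real (Suc n) < Sup (f ` K)" by (simp add: s_def)
    then show ?thesis using less_cSup_iff[OF _ bdd, of "s - 1 / real (Suc n)"] K(2) by auto
  qed
  then obtain X where X: "\<And>n. X n \<in> K" "\<And>n::nat. f (X n) > s - 1 / real (Suc n)" by metis
  obtain z r where z: "z \<in> K" "strict_mono (r :: nat \<Rightarrow> nat)" "(X \<circ> r) \<longlonglongrightarrow> z"
    using K(1) X(1) unfolding compact_def by blast
  have "s \<le> f z"
  proof (rule ccontr)
    assume "\<not> s \<le> f z"
    then obtain c where c: "f z < c" "c < s" using dense not_le by blast
    have "\<forall>\<^sub>F n in sequentially. f ((X \<circ> r) n) < c"
      by (rule seq_usc_onD[OF f _ z(1,3) c(1)]) (use X in auto)
    moreover have "(\<lambda>n. s - 1 / real (Suc n)) \<longlonglongrightarrow> s - 0"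
      by (intro tendsto_intros LIMSEQ_inverse_real_of_nat[unfolded inverse_eq_divide])
    then have "\<forall>\<^sub>F n in sequentially. c < s - 1 / real (Suc n)"
      using c(2) by (intro order_tendstoD) auto
    ultimately have "\<forall>\<^sub>F n::nat in sequentially. False"
    proof eventually_elim
      case (elim n)
      have "real (Suc n) \<le> real (Suc (r n))" using seq_suble[OF z(2), of n] by simp
      then have "1 / real (Suc (r n)) \<le> 1 / real (Suc n)" by (intro divide_left_mono) auto
      then show ?case using elim X(2)[of "r n"] by simp
    qed
    then show False by simp
  qed
  then show ?thesis using z(1) le by (meson order_trans)
qed

lemma usc_coercive_attains_sup:
  fixes f :: "'a::{real_normed_vector, heine_borel} \<Rightarrow> real"
  assumes S: "closed S" "z0 \<in> S" and f: "seq_usc_on S f"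
    and bd: "\<And>z. z \<in> S \<Longrightarrow> f z \<ge> f z0 \<Longrightarrow> norm z \<le> R"
  shows "\<exists>z\<in>S. \<forall>w\<in>S. f w \<le> f z"
proof -
  let ?K = "S \<inter> cball 0 R"
  have "z0 \<in> ?K" using S(2) bd[of z0] by simp
  moreover have "compact ?K" using S(1) by (simp add: closed_Int_compact)
  moreover have "seq_usc_on ?K f" using f unfolding seq_usc_on_def by blast
  ultimately obtain z where z: "z \<in> ?K" "\<And>w. w \<in> ?K \<Longrightarrow> f w \<le> f z"
    using usc_attains_sup_compact[of ?K f] by blast
  have "f w \<le> f z" if "w \<in> S" for w
  proof (cases "f w \<ge> f z0")
    case True
    then show ?thesis using z(2) bd that by simp
  next
    case False
    then show ?thesis using z(2)[OF \<open>z0 \<in> ?K\<close>] by simp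
  qed
  then show ?thesis using z(1) by blast
qed

text \<open>
  A bounded upper semicontinuous function is the decreasing limit of its Lipschitz sup-convolutions
  \<open>SUP s. h s - n * \<bar>t - s\<bar>\<close>. Raising them by \<open>2 / (n + 1)\<close> and approximating within \<open>1 / (n + 1)\<close> by
  polynomials keeps the approximations strictly above \<open>h\<close>; polynomials are smooth and may be used in
  test functions.
\<close>
lemma usc_approx_polynomial:
  fixes h :: "real \<Rightarrow> real"
  assumes T: "0 \<le> T" and h: "seq_usc_on {0..T} h" and B: "\<And>t. t \<in> {0..T} \<Longrightarrow> \<bar>h t\<bar> \<le> B"
  shows "\<exists>p :: nat \<Rightarrow> real \<Rightarrow> real. (\<forall>n. real_polynomial_function (p n)) \<and>
     (\<forall>n. \<forall>t\<in>{0..T}. h t < p n t \<and> \<bar>p n t\<bar> \<le> B + 3) \<and>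
     (\<forall>t\<in>{0..T}. (\<lambda>n. p n t) \<longlonglongrightarrow> h t)"
proof -
  let ?I = "{0..T}"
  define S where "S n t = (SUP s\<in>?I. h s - real n * \<bar>t - s\<bar>)" for n t
  have ne: "?I \<noteq> {}" using T by simp
  have bdd: "bdd_above ((\<lambda>s. h s - real n * \<bar>t - s\<bar>) ` ?I)" for n t
  proof (rule bdd_aboveI2)
    fix s assume "s \<in> ?I"
    then show "h s - real n * \<bar>t - s\<bar> \<le> B" using B[of s] by (smt (verit) mult_nonneg_nonneg of_nat_0_le_iff abs_ge_zero)
  qed
  have up: "h s - real n * \<bar>t - s\<bar> \<le> S n t" if "s \<in> ?I" for n t s
    unfolding S_def using bdd that by (rule cSUP_upper2) auto
  have lower: "h t \<le> S n t" if "t \<in> ?I" for n t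
    using up[OF that, of n t] by simp
  have upper: "S n t \<le> c" if "\<And>s. s \<in> ?I \<Longrightarrow> h s - real n * \<bar>t - s\<bar> \<le> c" for n t c
    unfolding S_def using ne that by (rule cSUP_least)
  have SB: "\<bar>S n t\<bar> \<le> B" if "t \<in> ?I" for n t
  proof -
    have "S n t \<le> B"
      by (rule upper) (smt (verit) B mult_nonneg_nonneg of_nat_0_le_iff abs_ge_zero)
    then show ?thesis using lower[OF that, of n] B[OF that] by linarith
  qed
  have lip: "S n t \<le> S n t' + real n * \<bar>t - t'\<bar>" for n t t'
  proof (rule upper)
    fix s assume s: "s \<in> ?I"
    have "real n * \<bar>t' - s\<bar> \<le> real n * (\<bar>t - s\<bar> + \<bar>t - t'\<bar>)" by (rule mult_left_mono) auto
    then show "h s - real n * \<bar>t - s\<bar> \<le> S n t' + real n * \<bar>t - t'\<bar>"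
      using up[OF s, of n t'] by (simp add: distrib_left)
  qed
  have "continuous_on ?I (S n)" for n
  proof (rule lipschitz_on_continuous_on)
    show "(real n)-lipschitz_on ?I (S n)"
    proof (rule lipschitz_onI)
      fix t t'
      show "dist (S n t) (S n t') \<le> real n * dist t t'"
        using lip[of n t t'] lip[of n t' t] by (simp add: dist_real_def abs_minus_commute abs_le_iff)
    qed simp
  qed
  then have c2: "continuous_on ?I (\<lambda>t. S n t + 2 / real (Suc n))" for n by (intro continuous_intros)
  have "\<exists>p. real_polynomial_function p \<and> (\<forall>t\<in>?I. \<bar>S n t + 2 / real (Suc n) - p t\<bar> < 1 / real (Suc n))" for n
  proof -
    have "0 < 1 / real (Suc n)" by simp
    with compact_Icc c2[of n] obtain g where "real_polynomial_function g"
      "\<And>t. t \<in> ?I \<Longrightarrow> \<bar>S n t + 2 / real (Suc n) - g t\<bar> < 1 / real (Suc n)"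
      by (rule Stone_Weierstrass_real_polynomial_function) blast
    then show ?thesis by blast
  qed
  then obtain p where p: "\<And>n. real_polynomial_function (p n)"
    "\<And>n t. t \<in> ?I \<Longrightarrow> \<bar>S n t + 2 / real (Suc n) - p n t\<bar> < 1 / real (Suc n)" by metis
  have one: "0 < 1 / real (Suc n)" "1 / real (Suc n) \<le> 1" "2 / real (Suc n) = 2 * (1 / real (Suc n))" for n by auto
  have S_lim: "(\<lambda>n. S n t) \<longlonglongrightarrow> h t" if t: "t \<in> ?I" for t
  proof (rule order_tendstoI)
    fix a assume "a < h t"
    then show "\<forall>\<^sub>F n in sequentially. a < S n t"
      using lower[OF t] by (intro always_eventually allI) (rule less_le_trans)
  next
    fix c assume c: "h t < c"
    obtain c' where c': "h t < c'" "c' < c" using dense[OF c] by blast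
    \<comment> \<open>Near \<open>t\<close> semicontinuity bounds \<open>h\<close>; at distance \<open>d\<close> the penalty \<open>n * d\<close> wins over the bound \<open>B\<close>.\<close>
    have "\<exists>d>0. \<forall>s\<in>?I. \<bar>t - s\<bar> < d \<longrightarrow> h s < c'"
    proof (rule ccontr)
      assume "\<not> ?thesis"
      then have "\<forall>n::nat. \<exists>s\<in>?I. \<bar>t - s\<bar> < 1 / real (Suc n) \<and> \<not> h s < c'" using one(1) by blast
      then obtain X where X: "\<And>n. X n \<in> ?I" "\<And>n::nat. \<bar>t - X n\<bar> < 1 / real (Suc n)" "\<And>n. \<not> h (X n) < c'" by metis
      have "(\<lambda>n. t - X n) \<longlonglongrightarrow> 0"
        by (rule Lim_null_comparison[OF _ LIMSEQ_inverse_real_of_nat])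
           (use X(2) in \<open>auto intro!: always_eventually simp: inverse_eq_divide less_imp_le simp del: of_nat_Suc\<close>)
      from tendsto_diff[OF tendsto_const[of t] this] have "X \<longlonglongrightarrow> t" by simp
      then have "\<forall>\<^sub>F n in sequentially. h (X n) < c'" by (rule seq_usc_onD[OF h X(1) t _ c'(1)])
      then show False using X(3) by (simp add: eventually_sequentially)
    qed
    then obtain d where d: "d > 0" "\<And>s. s \<in> ?I \<Longrightarrow> \<bar>t - s\<bar> < d \<Longrightarrow> h s < c'" by blast
    have "\<forall>\<^sub>F n in sequentially. real n > (B - c') / d"
      using filterlim_real_sequentially by (rule filterlim_at_top_dense[THEN iffD1, rule_format])
    then show "\<forall>\<^sub>F n in sequentially. S n t < c"
    proof eventually_elim
      case (elim n)
      have "S n t \<le> c'"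
      proof (rule upper)
        fix s assume s: "s \<in> ?I"
        show "h s - real n * \<bar>t - s\<bar> \<le> c'"
        proof (cases "\<bar>t - s\<bar> < d")
          case True
          then show ?thesis using d(2)[OF s] by (smt (verit) mult_nonneg_nonneg of_nat_0_le_iff abs_ge_zero)
        next
          case False
          then have "real n * d \<le> real n * \<bar>t - s\<bar>" by (intro mult_left_mono) auto
          moreover have "B - c' < real n * d" using elim d(1) by (simp add: divide_less_eq)
          ultimately show ?thesis using B[OF s] by linarith
        qed
      qed
      then show ?case using c' by simp
    qed
  qed
  have "h t < p n t \<and> \<bar>p n t\<bar> \<le> B + 3" if "t \<in> ?I" for n t
    using p(2)[OF that, of n] one[of n] lower[OF that, of n] SB[OF that, of n] by linarith
  moreover have "(\<lambda>n. p n t) \<longlonglongrightarrow> h t" if t: "t \<in> ?I" for t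
  proof -
    have z: "(\<lambda>n. 1 / real (Suc n)) \<longlonglongrightarrow> 0"
      using LIMSEQ_inverse_real_of_nat by (simp add: inverse_eq_divide)
    have "(\<lambda>n. p n t - S n t) \<longlonglongrightarrow> 0"
    proof (rule Lim_null_comparison)
      show "\<forall>\<^sub>F n in sequentially. norm (p n t - S n t) \<le> 3 * (1 / real (Suc n))"
      proof (intro always_eventually allI)
        fix n show "norm (p n t - S n t) \<le> 3 * (1 / real (Suc n))"
          using p(2)[OF t, of n] one[of n] unfolding real_norm_def by linarith
      qed
      show "(\<lambda>n. 3 * (1 / real (Suc n))) \<longlonglongrightarrow> 0" using tendsto_mult_right_zero[OF z] by simp
    qed
    from tendsto_add[OF this S_lim[OF t]] show ?thesis by simp
  qed
  ultimately show ?thesis using p(1) by blast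
qed

section \<open>Test functions\<close>

lemma mem_space_time [simp]: "(x, t) \<in> space_time T \<longleftrightarrow> 0 \<le> t \<and> t \<le> T"
  by (auto simp: space_time_def)

lemma snd_space_time: "z \<in> space_time T \<longleftrightarrow> snd z \<in> {0..T}"
  by (cases z) simp

lemma closed_space_time: "closed (space_time T)"
  unfolding space_time_def by (intro closed_Times closed_UNIV closed_atLeastAtMost)

lemma lag_in: "0 \<le> t \<Longrightarrow> t \<le> T \<Longrightarrow> lag t \<tau> \<in> {0..T}"
  by (auto simp: lag_def)

lemma continuous_on_lag [continuous_intros]: "continuous_on A (lag t)"
  unfolding lag_def by (intro continuous_intros)

lemma has_C1_gradient_on_add:
  assumes "has_C1_gradient_on f F S" "has_C1_gradient_on g G S"
  shows "has_C1_gradient_on (\<lambda>z. f z + g z) (\<lambda>z. F z + G z) S"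
  unfolding has_C1_gradient_on_def inner_add_left
  using assms by (auto intro!: continuous_on_add has_derivative_add simp: has_C1_gradient_on_def)

lemma has_C1_gradient_on_cmult:
  assumes "has_C1_gradient_on f F S"
  shows "has_C1_gradient_on (\<lambda>z. a * f z) (\<lambda>z. a *\<^sub>R F z) S"
  unfolding has_C1_gradient_on_def inner_scaleR_left
  using assms by (auto intro!: continuous_on_scaleR has_derivative_mult_right continuous_on_const
      simp: has_C1_gradient_on_def)

lemma test_function_add:
  assumes "test_function T f F" "test_function T g G"
  shows "test_function T (\<lambda>z. f z + g z) (\<lambda>z. F z + G z)"
  using assms unfolding test_function_def by (auto intro: has_C1_gradient_on_add continuous_on_add)

lemma test_function_cmult:
  assumes "test_function T f F"
  shows "test_function T (\<lambda>z. a * f z) (\<lambda>z. a *\<^sub>R F z)"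
  using assms unfolding test_function_def
  by (auto intro: has_C1_gradient_on_cmult intro!: continuous_on_mult_left)

lemma test_function_uminus:
  assumes "test_function T f F"
  shows "test_function T (\<lambda>z. - f z) (\<lambda>z. - F z)"
  using test_function_cmult[OF assms, of "-1"] by simp

lemma test_function_space:
  fixes g :: "real ^ 'n \<Rightarrow> real"
  assumes "has_C1_gradient_on g D UNIV"
  shows "test_function T (\<lambda>z. g (fst z)) (\<lambda>z. (D (fst z), 0))"
proof -
  have d: "(g has_derivative (\<lambda>h. D x \<bullet> h)) (at x)" for x
    using assms by (auto simp: has_C1_gradient_on_def)
  have gc: "continuous_on UNIV g"
    by (meson continuous_at_imp_continuous_on d has_derivative_continuous)
  have Dc: "continuous_on UNIV D" using assms by (auto simp: has_C1_gradient_on_def)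
  have "((\<lambda>z. g (fst z)) has_derivative (\<lambda>h. (D (fst z), 0) \<bullet> h)) (at z within S)"
    for z :: "(real ^ 'n) \<times> real" and S
  proof -
    have "((\<lambda>z. g (fst z)) has_derivative (\<lambda>h. D (fst z) \<bullet> fst h)) (at z within S)"
      by (rule has_derivative_compose[OF _ d]) (intro derivative_intros has_derivative_ident)
    then show ?thesis by (simp add: inner_prod_def)
  qed
  then show ?thesis
    unfolding test_function_def has_C1_gradient_on_def
    by (auto intro!: continuous_on_compose2[OF gc] continuous_on_compose2[OF Dc] continuous_intros)
qed

lemma test_function_time:
  fixes w :: "real \<Rightarrow> real"
  assumes c: "continuous_on {0..T} w"
    and d: "\<And>t. 0 < t \<Longrightarrow> (w has_real_derivative w' t) (at t)"
    and c': "continuous_on {0<..} w'"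
  shows "test_function T (\<lambda>z. w (snd z)) (\<lambda>z. (0 :: real ^ 'n, w' (snd z)))"
proof -
  have "((\<lambda>z. w (snd z)) has_derivative (\<lambda>h. (0, w' (snd z)) \<bullet> h)) (at z within S)"
    if "0 < snd z" for z :: "(real ^ 'n) \<times> real" and S
  proof -
    have dd: "(w has_derivative (\<lambda>h. w' (snd z) * h)) (at (snd z))"
      using d[OF that] by (simp add: has_field_derivative_def)
    have "((\<lambda>z. w (snd z)) has_derivative (\<lambda>h. w' (snd z) * snd h)) (at z within S)"
      by (rule has_derivative_compose[where f = snd and g = w and g' = "\<lambda>h. w' (snd z) * h", OF _ dd])
        (intro derivative_intros has_derivative_ident)
    then show ?thesis by (simp add: inner_prod_def)
  qed
  then show ?thesis
    unfolding test_function_def has_C1_gradient_on_def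
    by (auto intro!: continuous_on_compose2[OF c] continuous_on_compose2[OF c'] continuous_intros
        simp: space_time_def)
qed

lemma C1_square_distance:
  fixes a :: "'a::real_inner"
  shows "has_C1_gradient_on (\<lambda>x. (norm (x - a))\<^sup>2) (\<lambda>x. 2 *\<^sub>R (x - a)) UNIV"
proof -
  have "((\<lambda>x. (x - a) \<bullet> (x - a)) has_derivative (\<lambda>h. (2 *\<^sub>R (x - a)) \<bullet> h)) (at x)" for x
    by (auto intro!: derivative_eq_intros simp: inner_commute fun_eq_iff)
  moreover have "continuous_on UNIV (\<lambda>x. 2 *\<^sub>R (x - a))" by (intro continuous_intros)
  ultimately show ?thesis
    unfolding has_C1_gradient_on_def power2_norm_eq_inner by blast
qed

text \<open>
  A smooth substitute for the distance to \<open>a\<close>: it lies above the distance, exceeds it by at most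
  \<open>sqrt \<delta>\<close>, and its gradient has norm less than \<open>1\<close>.
\<close>
lemma C1_smoothed_distance:
  fixes a :: "'a::real_inner"
  assumes "0 < \<delta>"
  shows "has_C1_gradient_on (\<lambda>x. sqrt (\<delta> + (norm (x - a))\<^sup>2))
    (\<lambda>x. (1 / sqrt (\<delta> + (norm (x - a))\<^sup>2)) *\<^sub>R (x - a)) UNIV"
proof -
  have pos: "0 < \<delta> + (x - a) \<bullet> (x - a)" for x using assms by (simp add: add_pos_nonneg)
  have "((\<lambda>x. sqrt (\<delta> + (x - a) \<bullet> (x - a))) has_derivative
      (\<lambda>h. ((1 / sqrt (\<delta> + (x - a) \<bullet> (x - a))) *\<^sub>R (x - a)) \<bullet> h)) (at x)" for x
  proof -
    have "((\<lambda>x. \<delta> + (x - a) \<bullet> (x - a)) has_derivative (\<lambda>h. 2 * ((x - a) \<bullet> h))) (at x)"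
      by (auto intro!: derivative_eq_intros simp: inner_commute)
    from has_derivative_real_sqrt[OF pos this] show ?thesis
      by (simp add: inverse_eq_divide)
  qed
  moreover have "continuous_on UNIV (\<lambda>x. (1 / sqrt (\<delta> + (x - a) \<bullet> (x - a))) *\<^sub>R (x - a))"
    using pos by (auto intro!: continuous_intros simp: less_imp_neq[symmetric])
  ultimately show ?thesis
    unfolding has_C1_gradient_on_def power2_norm_eq_inner by blast
qed

text \<open>
  A test function is \<open>C\<^sup>1\<close> only for positive times and merely continuous at time \<open>0\<close>. Near \<open>t0 > 0\<close>,
  going back by less than \<open>t0 / 2\<close> stays in the region where the gradient is bounded, and for larger
  \<open>\<tau>\<close> boundedness suffices. The bound is uniform near \<open>(x0, t0)\<close>, as dominated convergence along
  converging base points requires.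
\<close>
lemma test_function_small_incr:
  fixes \<phi> :: "(real ^ 'n) \<times> real \<Rightarrow> real"
  assumes tf: "test_function T \<phi> G" and t0: "0 < t0" "t0 \<le> T"
  shows "\<exists>B r. 0 < r \<and> r < t0 \<and> (\<forall>x t. dist x x0 \<le> r \<longrightarrow> \<bar>t - t0\<bar> \<le> r \<longrightarrow> t \<le> T \<longrightarrow>
     small_incr B (incr \<phi> x t))"
proof -
  define r where "r = t0 / 4"
  let ?K = "cball x0 r \<times> {r..T}" and ?K2 = "cball x0 r \<times> {0..T}"
  have r: "0 < r" "r < t0" using t0 by (auto simp: r_def)
  have \<phi>c: "continuous_on (space_time T) \<phi>" and Gc: "continuous_on (UNIV \<times> {0<..T}) G"
    and d: "\<And>z. z \<in> UNIV \<times> {0<..T} \<Longrightarrow> (\<phi> has_derivative (\<lambda>h. G z \<bullet> h)) (at z within UNIV \<times> {0<..T})"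
    using tf by (auto simp: test_function_def has_C1_gradient_on_def)
  have sub: "?K \<subseteq> UNIV \<times> {0<..T}" using r by auto
  have "compact ?K" "compact ?K2" by (auto intro!: compact_Times)
  have "bounded (G ` ?K)"
    by (rule compact_imp_bounded, rule compact_continuous_image[OF continuous_on_subset[OF Gc sub]]) fact
  then obtain B1 where B1: "\<And>z. z \<in> ?K \<Longrightarrow> norm (G z) \<le> B1" unfolding bounded_iff by blast
  have "bounded (\<phi> ` ?K2)"
    by (rule compact_imp_bounded, rule compact_continuous_image[OF continuous_on_subset[OF \<phi>c]])
       (auto simp: space_time_def intro!: compact_Times)
  then obtain B2 where B2: "\<And>z. z \<in> ?K2 \<Longrightarrow> \<bar>\<phi> z\<bar> \<le> B2" unfolding bounded_iff by auto
  have B1p: "0 \<le> B1" by (rule order_trans[OF norm_ge_zero B1[of "(x0, T)"]]) (use t0 r in auto)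
  have B2p: "0 \<le> B2" by (rule order_trans[OF abs_ge_zero B2[of "(x0, T)"]]) (use t0 r in auto)
  define B where "B = 2 * B2 + B1 + 2 * B2 / (2 * r)"
  have "small_incr B (incr \<phi> x t)"
    if xt: "dist x x0 \<le> r" "\<bar>t - t0\<bar> \<le> r" "t \<le> T" for x t
    unfolding small_incr_def
  proof (intro conjI allI impI)
    have t: "3 * r \<le> t" using xt(2) unfolding r_def by linarith
    have xb: "x \<in> cball x0 r" using xt(1) by (simp add: dist_commute)
    have "continuous_on UNIV (\<lambda>\<tau>. \<phi> (x, lag t \<tau>))"
      by (rule continuous_on_compose2[OF \<phi>c])
         (use lag_in[of t T] t r xt(3) in \<open>auto intro!: continuous_intros simp: space_time_def\<close>)
    then show "(incr \<phi> x t) \<in> borel_measurable borel"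
      by (intro borel_measurable_continuous_onI continuous_on_diff continuous_on_const)
    fix \<tau> :: real assume \<tau>: "\<tau> > 0"
    have two: "\<bar>\<phi> (x, t) - \<phi> (x, lag t \<tau>)\<bar> \<le> 2 * B2"
      using B2[of "(x, t)"] B2[of "(x, lag t \<tau>)"] lag_in[of t T \<tau>] t r xt(3) xb by auto
    show "\<bar>\<phi> (x, t) - \<phi> (x, lag t \<tau>)\<bar> \<le> B * min \<tau> 1"
    proof (cases "\<tau> \<le> 2 * r")
      case True
      then have l: "lag t \<tau> = t - \<tau>" "r \<le> t - \<tau>" using t \<tau> r by (auto simp: lag_def)
      have "norm (\<phi> (x, t) - \<phi> (x, t - \<tau>)) \<le> B1 * norm ((x, t) - (x, t - \<tau>))"
      proof (rule differentiable_bound[where S = ?K])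
        show "convex ?K" by (intro convex_Times convex_cball convex_real_interval)
        show "(\<phi> has_derivative (\<lambda>h. G z \<bullet> h)) (at z within ?K)" if "z \<in> ?K" for z
          by (rule has_derivative_subset[OF d sub]) (use that sub in blast)
        show "onorm (\<lambda>h. G z \<bullet> h) \<le> B1" if "z \<in> ?K" for z
        proof (rule onorm_le)
          fix h show "norm (G z \<bullet> h) \<le> B1 * norm h"
            using Cauchy_Schwarz_ineq2[of "G z" h] mult_right_mono[OF B1[OF that] norm_ge_zero[of h]] by simp
        qed
      qed (use l t r \<tau> xb xt(3) in auto)
      then have one: "\<bar>\<phi> (x, t) - \<phi> (x, lag t \<tau>)\<bar> \<le> B1 * \<tau>" using \<tau> l(1) by (simp add: norm_Pair)
      have "B1 * \<tau> \<le> B * \<tau>" using \<tau> B2p r by (intro mult_right_mono) (auto simp: B_def)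
      moreover have "2 * B2 \<le> B" using B1p B2p r by (simp add: B_def)
      ultimately show ?thesis using one two by (auto simp: min_def)
    next
      case False
      then have "2 * B2 / (2 * r) * (2 * r) \<le> 2 * B2 / (2 * r) * \<tau>"
        using B2p r by (intro mult_left_mono) auto
      then have "2 * B2 \<le> 2 * B2 / (2 * r) * \<tau>" using r by simp
      also have "\<dots> \<le> B * \<tau>" using \<tau> B2p B1p r by (intro mult_right_mono) (auto simp: B_def)
      finally have "2 * B2 \<le> B * \<tau>" .
      moreover have "2 * B2 \<le> B" using B1p B2p r by (simp add: B_def)
      ultimately show ?thesis using two by (auto simp: min_def)
    qed
  qed
  then show ?thesis using r by blast
qed

lemma caputo_test_function:
  fixes \<phi> :: "(real ^ 'n) \<times> real \<Rightarrow> real"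
  assumes "0 < \<alpha>" "\<alpha> < 1" "test_function T \<phi> G" "0 < t" "t \<le> T"
  shows "J_op \<alpha> \<phi> x t + K_op \<alpha> 0 t \<phi> x t =
    \<alpha> / Gamma (1 - \<alpha>) * marchaud \<alpha> (incr \<phi> x t)"
proof -
  obtain B r where "0 < r" "\<forall>x' t'. dist x' x \<le> r \<longrightarrow> \<bar>t' - t\<bar> \<le> r \<longrightarrow> t' \<le> T \<longrightarrow>
     small_incr B (incr \<phi> x' t')"
    using test_function_small_incr[OF assms(3-5), of x] by blast
  then have "small_incr B (incr \<phi> x t)" using assms by simp
  then show ?thesis by (rule caputo_eq_marchaud[OF assms(1,2,4)])
qed

lemma subsolution_test:
  fixes u :: "(real ^ 'n) \<times> real \<Rightarrow> real"
  assumes "0 < \<alpha>" "\<alpha> < 1" and sub: "viscosity_subsolution T \<alpha> F u0 u"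
    and tf: "test_function T \<phi> G" and t: "0 < t" "t \<le> T"
    and mx: "\<And>z. z \<in> space_time T \<Longrightarrow> u z - \<phi> z \<le> u (x, t) - \<phi> (x, t)"
  shows "\<alpha> / Gamma (1 - \<alpha>) * marchaud \<alpha> (incr \<phi> x t) + F x (fst (G (x, t))) \<le> 0"
  using sub tf t mx unfolding viscosity_subsolution_def
  by (subst caputo_test_function[OF assms(1,2) tf t, symmetric]) auto

lemma J_op_uminus: "J_op \<alpha> (\<lambda>z. - f z) x t = - J_op \<alpha> f x t"
  by (simp add: J_op_def minus_divide_left)

lemma K_op_uminus: "K_op \<alpha> a b (\<lambda>z. - f z) x t = - K_op \<alpha> a b f x t"
proof -
  have e: "(- f (x, t) - - f (x, t - \<tau>)) / \<tau> powr (\<alpha> + 1) =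
      (-1) * ((f (x, t) - f (x, t - \<tau>)) / \<tau> powr (\<alpha> + 1))" for \<tau>
    by (simp add: minus_divide_left)
  show ?thesis unfolding K_op_def e set_integral_mult_right by simp
qed

text \<open>
  Changing the sign of the function turns minima into maxima and reflects the gradient of the test
  function; this reduces every statement on supersolutions to one on subsolutions.
\<close>
lemma supersolution_uminus:
  assumes "viscosity_supersolution T \<alpha> F u0 u"
  shows "viscosity_subsolution T \<alpha> (\<lambda>x p. - F x (- p)) (\<lambda>x. - u0 x) (\<lambda>z. - u z)"
  unfolding viscosity_subsolution_def
proof (intro conjI allI impI)
  have "{z \<in> space_time T. - u z < c} = {z \<in> space_time T. - c < u z}" for c by auto
  then show "usc_on (space_time T) (\<lambda>z. - u z)"
    using assms by (auto simp: viscosity_supersolution_def usc_on_def lsc_on_def)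
  show "- u (x, 0) \<le> - u0 x" for x using assms by (simp add: viscosity_supersolution_def)
  fix \<phi> G x t
  assume a: "test_function T \<phi> G \<and> t \<in> {0<..T} \<and>
       (\<forall>z\<in>space_time T. - u z - \<phi> z \<le> - u (x, t) - \<phi> (x, t))"
  have "J_op \<alpha> (\<lambda>z. - \<phi> z) x t + K_op \<alpha> 0 t (\<lambda>z. - \<phi> z) x t + F x (fst (- G (x, t))) \<ge> 0"
    using assms test_function_uminus[of T \<phi> G] a unfolding viscosity_supersolution_def
    by (elim conjE allE[where x = "\<lambda>z. - \<phi> z"] allE[where x = "\<lambda>z. - G z"] allE[where x = x] allE[where x = t])
       fastforce
  then show "J_op \<alpha> \<phi> x t + K_op \<alpha> 0 t \<phi> x t + - F x (- fst (G (x, t))) \<le> 0"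
    by (simp add: J_op_uminus K_op_uminus)
qed

lemma subsolution_uminus:
  assumes "viscosity_subsolution T \<alpha> F u0 u"
  shows "viscosity_supersolution T \<alpha> (\<lambda>x p. - F x (- p)) (\<lambda>x. - u0 x) (\<lambda>z. - u z)"
  unfolding viscosity_supersolution_def
proof (intro conjI allI impI)
  have "{z \<in> space_time T. c < - u z} = {z \<in> space_time T. u z < - c}" for c by auto
  then show "lsc_on (space_time T) (\<lambda>z. - u z)"
    using assms by (auto simp: viscosity_subsolution_def usc_on_def lsc_on_def)
  show "- u (x, 0) \<ge> - u0 x" for x using assms by (simp add: viscosity_subsolution_def)
  fix \<phi> G x t
  assume a: "test_function T \<phi> G \<and> t \<in> {0<..T} \<and>
       (\<forall>z\<in>space_time T. - u z - \<phi> z \<ge> - u (x, t) - \<phi> (x, t))"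
  have "J_op \<alpha> (\<lambda>z. - \<phi> z) x t + K_op \<alpha> 0 t (\<lambda>z. - \<phi> z) x t + F x (fst (- G (x, t))) \<le> 0"
    using assms test_function_uminus[of T \<phi> G] a unfolding viscosity_subsolution_def
    by (elim conjE allE[where x = "\<lambda>z. - \<phi> z"] allE[where x = "\<lambda>z. - G z"] allE[where x = x] allE[where x = t])
       fastforce
  then show "J_op \<alpha> \<phi> x t + K_op \<alpha> 0 t \<phi> x t + - F x (- fst (G (x, t))) \<ge> 0"
    by (simp add: J_op_uminus K_op_uminus)
qed

section \<open>Viscosity inequalities with the true history\<close>

text \<open>
  Adding \<open>(s - t)\<^sup>2 * p s\<close> to \<open>\<phi>\<close> lowers the test function at distant times almost down to \<open>u\<close> on the line
  above \<open>x\<close>, but possibly below \<open>u\<close> at other points of space. Since \<open>u\<close> is upper semicontinuous, it stays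
  below in a neighbourhood of the line, and a steep paraboloid in space takes care of the rest.
  The paraboloid is constant in time with vanishing gradient at \<open>x\<close>, so it does not change the viscosity
  inequality.
\<close>
lemma tilted_test_dominates:
  fixes u \<phi> :: "(real ^ 'n) \<times> real \<Rightarrow> real"
  assumes usc: "seq_usc_on (space_time T) u" and \<phi>c: "continuous_on (space_time T) \<phi>"
    and pc: "continuous_on {0..T} p" and t: "0 < t" "t \<le> T"
    and mx: "\<And>z. z \<in> space_time T \<Longrightarrow> u z - \<phi> z \<le> c0"
    and near: "\<And>s. s \<in> {0..T} \<Longrightarrow> \<bar>s - t\<bar> \<le> \<rho> \<Longrightarrow> 0 < p s" and \<rho>: "0 < \<rho>"
    and far: "\<And>s. s \<in> {0..T} \<Longrightarrow> \<bar>s - t\<bar> > \<rho> \<Longrightarrow> u (x, s) - \<phi> (x, s) - c0 < (s - t)\<^sup>2 * p s"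
  shows "\<exists>K\<ge>0. \<forall>z\<in>space_time T. u z - (\<phi> z + K * (norm (fst z - x))\<^sup>2 + (snd z - t)\<^sup>2 * p (snd z)) \<le> c0"
proof (rule ccontr)
  assume neg: "\<not> ?thesis"
  define g where "g z = u z - (\<phi> z + (snd z - t)\<^sup>2 * p (snd z))" for z
  have "\<exists>z\<in>space_time T. g z > c0 + real n * (norm (fst z - x))\<^sup>2" for n :: nat
  proof -
    have "0 \<le> real n" by simp
    with neg obtain z where "z \<in> space_time T"
      "\<not> u z - (\<phi> z + real n * (norm (fst z - x))\<^sup>2 + (snd z - t)\<^sup>2 * p (snd z)) \<le> c0" by blast
    then show ?thesis by (auto simp: g_def intro!: bexI[of _ z])
  qed
  then obtain X where X: "\<And>n. X n \<in> space_time T" "\<And>n. g (X n) > c0 + real n * (norm (fst (X n) - x))\<^sup>2" by metis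
  have X01: "snd (X n) \<in> {0..T}" for n using X(1) by (simp add: snd_space_time)
  have Xfar: "\<bar>snd (X n) - t\<bar> > \<rho>" for n
  proof (rule ccontr)
    assume "\<not> \<bar>snd (X n) - t\<bar> > \<rho>"
    then have "0 < p (snd (X n))" using near X01 by simp
    then have "0 \<le> (snd (X n) - t)\<^sup>2 * p (snd (X n))" by simp
    then have "g (X n) \<le> c0" using mx[OF X(1), of n] by (simp add: g_def)
    moreover have "0 \<le> real n * (norm (fst (X n) - x))\<^sup>2" by simp
    ultimately show False using X(2)[of n] by linarith
  qed
  have "bounded ((\<lambda>s. (s - t)\<^sup>2 * p s) ` {0..T})"
    by (intro compact_imp_bounded compact_continuous_image continuous_intros pc) auto
  then obtain D where D: "\<And>s. s \<in> {0..T} \<Longrightarrow> \<bar>(s - t)\<^sup>2 * p s\<bar> \<le> D" unfolding bounded_iff by (auto simp del: atLeastAtMost_iff)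
  have Dn: "real n * (norm (fst (X n) - x))\<^sup>2 \<le> D" for n
    using X(2)[of n] mx[OF X(1), of n] D[OF X01, of n] by (simp add: g_def abs_le_iff)
  have "(\<lambda>n. fst (X n) - x) \<longlonglongrightarrow> 0"
  proof -
    have "(\<lambda>n. (norm (fst (X n) - x))\<^sup>2) \<longlonglongrightarrow> 0"
    proof (rule Lim_null_comparison)
      show "\<forall>\<^sub>F n in sequentially. norm ((norm (fst (X n) - x))\<^sup>2) \<le> D * inverse (real n)"
        using eventually_gt_at_top[of 0]
      proof eventually_elim
        case (elim n)
        then show ?case using Dn[of n] by (simp add: field_simps)
      qed
      show "(\<lambda>n. D * inverse (real n)) \<longlonglongrightarrow> 0"
        using tendsto_mult_right_zero[OF lim_inverse_n, of D] by simp
    qed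
    from tendsto_real_sqrt[OF this] show ?thesis by (simp add: tendsto_norm_zero_iff)
  qed
  then have fX: "(\<lambda>n. fst (X n)) \<longlonglongrightarrow> x" by (rule LIM_zero_cancel)
  obtain s r where s: "s \<in> {0..T}" "strict_mono (r :: nat \<Rightarrow> nat)" "((\<lambda>n. snd (X n)) \<circ> r) \<longlonglongrightarrow> s"
    using compact_Icc[of 0 T, unfolded compact_def, rule_format, of "\<lambda>n. snd (X n)"] X01 by blast
  have "(\<lambda>n. (fst (X (r n)), snd (X (r n)))) \<longlonglongrightarrow> (x, s)"
    by (rule tendsto_Pair) (use LIMSEQ_subseq_LIMSEQ[OF fX s(2)] s(3) in \<open>auto simp: o_def\<close>)
  then have lim: "(\<lambda>n. X (r n)) \<longlonglongrightarrow> (x, s)" by simp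
  have sf: "\<rho> \<le> \<bar>s - t\<bar>"
    by (rule tendsto_lowerbound[OF tendsto_rabs[OF tendsto_diff[OF s(3) tendsto_const]]])
       (use Xfar in \<open>auto intro!: always_eventually simp: less_imp_le\<close>)
  have "g (x, s) < c0"
  proof (cases "\<rho> < \<bar>s - t\<bar>")
    case True
    then show ?thesis using far[OF s(1)] by (simp add: g_def)
  next
    case False
    then have "\<bar>s - t\<bar> = \<rho>" using sf by simp
    then have "0 < (s - t)\<^sup>2 * p s" using near[OF s(1)] \<rho> by auto
    then show ?thesis using mx[of "(x, s)"] s(1) by (simp add: g_def)
  qed
  moreover have "seq_usc_on (space_time T) g"
    unfolding g_def
    by (intro seq_usc_on_diff_continuous[OF usc] continuous_intros \<phi>c continuous_on_compose2[OF pc])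
       (auto simp: snd_space_time)
  ultimately have "\<forall>\<^sub>F n in sequentially. g (X (r n)) < c0"
    by (intro seq_usc_onD[of "space_time T" g "\<lambda>n. X (r n)" "(x, s)"]) (use X(1) lim s(1) in auto)
  then obtain n where "g (X (r n)) < c0" by (auto simp: eventually_sequentially)
  moreover have "0 \<le> real (r n) * (norm (fst (X (r n)) - x))\<^sup>2" by simp
  ultimately show False using X(2)[of "r n"] by linarith
qed

text \<open>
  In the viscosity inequality the increments of \<open>\<phi>\<close> may be replaced by those of \<open>u\<close> itself for
  \<open>\<tau> > \<rho>\<close>. To see this, the gap \<open>u - \<phi>\<close> at times farther than \<open>\<rho>\<close> from \<open>t\<close> is written as
  \<open>(s - t)\<^sup>2 * q s\<close> with \<open>q\<close> upper semicontinuous, and \<open>q\<close> is approximated from above by polynomials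
  \<open>p n\<close>; the factor \<open>(s - t)\<^sup>2\<close> keeps the increments of \<open>(s - t)\<^sup>2 * p n s\<close> integrable at \<open>\<tau> = 0\<close>. The test functions
  \<open>\<phi> z + K * (norm (fst z - x))\<^sup>2 + (snd z - t)\<^sup>2 * p n (snd z)\<close> are admissible for suitable \<open>K\<close>, and their
  inequalities converge to the claim.
\<close>
lemma subsolution_with_history:
  fixes u :: "(real ^ 'n) \<times> real \<Rightarrow> real"
  assumes alpha: "0 < \<alpha>" "\<alpha> < 1" and sub: "viscosity_subsolution T \<alpha> F u0 u"
    and bd: "\<And>z. z \<in> space_time T \<Longrightarrow> \<bar>u z\<bar> \<le> M"
    and tf: "test_function T \<phi> G" and t: "0 < t" "t \<le> T"
    and mx: "\<And>z. z \<in> space_time T \<Longrightarrow> u z - \<phi> z \<le> u (x, t) - \<phi> (x, t)"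
    and \<rho>: "0 < \<rho>" "\<rho> < t"
  defines "d \<equiv> \<lambda>\<tau>. if \<bar>\<tau>\<bar> \<le> \<rho> then \<phi> (x, t) - \<phi> (x, lag t \<tau>) else u (x, t) - u (x, lag t \<tau>)"
  shows "(\<exists>B. small_incr B d) \<and> \<alpha> / Gamma (1 - \<alpha>) * marchaud \<alpha> d + F x (fst (G (x, t))) \<le> 0"
proof -
  have usc: "seq_usc_on (space_time T) u"
    using sub by (simp add: viscosity_subsolution_def usc_on_imp_seq_usc_on)
  have \<phi>c: "continuous_on (space_time T) \<phi>" using tf by (simp add: test_function_def)
  define c0 where "c0 = u (x, t) - \<phi> (x, t)"
  define h where "h s = u (x, s) - \<phi> (x, s) - c0" for s
  \<comment> \<open>Semicontinuous across the threshold \<open>\<bar>s - t\<bar> = \<rho>\<close> because \<open>h\<close> is nonpositive: the values jump down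
    where the distance exceeds \<open>\<rho>\<close>, which is an open set.\<close>
  define q where "q s = (if \<bar>s - t\<bar> > \<rho> then h s / (s - t)\<^sup>2 else 0)" for s
  have h0: "h s \<le> 0" if "s \<in> {0..T}" for s using mx[of "(x, s)"] that by (simp add: h_def c0_def)
  have pc: "continuous_on {0..T} (\<lambda>s. (x, s))" by (intro continuous_intros)
  have pim: "(\<lambda>s. (x, s)) ` {0..T} \<subseteq> space_time T" by auto
  have \<phi>s: "continuous_on {0..T} (\<lambda>s. \<phi> (x, s))" by (rule continuous_on_compose2[OF \<phi>c pc pim])
  have "bounded ((\<lambda>s. \<phi> (x, s)) ` {0..T})"
    by (intro compact_imp_bounded compact_continuous_image \<phi>s) auto
  then obtain B0 where B0: "\<And>s. s \<in> {0..T} \<Longrightarrow> \<bar>\<phi> (x, s)\<bar> \<le> B0" unfolding bounded_iff by (auto simp del: atLeastAtMost_iff)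
  define Bh where "Bh = M + B0 + \<bar>c0\<bar>"
  have hB: "\<bar>h s\<bar> \<le> Bh" if "s \<in> {0..T}" for s
    using bd[of "(x, s)"] B0[OF that] that unfolding h_def Bh_def by auto
  have Bh0: "0 \<le> Bh" using hB[of t] t by force
  have qB: "\<bar>q s\<bar> \<le> Bh / \<rho>\<^sup>2" if "s \<in> {0..T}" for s
  proof (cases "\<bar>s - t\<bar> > \<rho>")
    case True
    then have "\<rho>\<^sup>2 \<le> (s - t)\<^sup>2" using \<rho>(1) by (metis abs_le_square_iff abs_of_pos less_imp_le)
    then have "\<bar>h s\<bar> / (s - t)\<^sup>2 \<le> Bh / \<rho>\<^sup>2" using hB[OF that] Bh0 \<rho>(1) by (intro frac_le) auto
    then show ?thesis using True by (simp add: q_def abs_divide)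
  qed (use Bh0 in \<open>simp add: q_def\<close>)
  have husc: "seq_usc_on {0..T} (\<lambda>s. h s - c * (s - t)\<^sup>2)" for c
  proof -
    have "seq_usc_on {0..T} (\<lambda>s. u (x, s))" by (rule seq_usc_on_compose[OF usc pc pim])
    from seq_usc_on_diff_continuous[OF this, of "\<lambda>s. \<phi> (x, s) + c0 + c * (s - t)\<^sup>2"] show ?thesis
      unfolding h_def by (simp add: algebra_simps \<phi>s continuous_intros)
  qed
  have qusc: "seq_usc_on {0..T} q"
    unfolding seq_usc_on_def
  proof (intro allI impI)
    fix X s c assume X: "\<forall>n. X n \<in> {0..T}" "s \<in> {0..T}" "X \<longlonglongrightarrow> s" "q s < c"
    show "\<forall>\<^sub>F n in sequentially. q (X n) < c"
    proof (cases "\<bar>s - t\<bar> > \<rho>")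
      case True
      have sq: "0 < (r - t)\<^sup>2" if "\<bar>r - t\<bar> > \<rho>" for r using that \<rho>(1) by auto
      have "h s - c * (s - t)\<^sup>2 < 0" using X(4) True sq[OF True] by (simp add: q_def divide_less_eq)
      then have "\<forall>\<^sub>F n in sequentially. h (X n) - c * (X n - t)\<^sup>2 < 0"
        using X(1-3) by (intro seq_usc_onD[OF husc, of X s]) auto
      moreover have "(\<lambda>n. \<bar>X n - t\<bar>) \<longlonglongrightarrow> \<bar>s - t\<bar>" by (intro tendsto_intros X(3))
      then have "\<forall>\<^sub>F n in sequentially. \<rho> < \<bar>X n - t\<bar>" using True by (rule order_tendstoD)
      ultimately show ?thesis
      proof eventually_elim
        case (elim n)
        then show ?case using sq[of "X n"] by (simp add: q_def divide_less_eq)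
      qed
    next
      case False
      have "q (X n) \<le> 0" for n using h0[of "X n"] X(1) by (simp add: q_def divide_nonpos_nonneg)
      moreover have "0 < c" using False X(4) by (simp add: q_def)
      ultimately show ?thesis by (intro always_eventually allI) (rule le_less_trans)
    qed
  qed
  have T0: "0 \<le> T" using t by simp
  obtain p where p: "\<And>n. real_polynomial_function (p n :: real \<Rightarrow> real)"
    "\<And>n s. s \<in> {0..T} \<Longrightarrow> q s < p n s" "\<And>n s. s \<in> {0..T} \<Longrightarrow> \<bar>p n s\<bar> \<le> Bh / \<rho>\<^sup>2 + 3"
    "\<And>s. s \<in> {0..T} \<Longrightarrow> (\<lambda>n. p n s) \<longlonglongrightarrow> q s"
    using usc_approx_polynomial[OF T0 qusc qB] by blast
  define Bp where "Bp = Bh / \<rho>\<^sup>2 + 3"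
  have Bp0: "0 \<le> Bp" using Bh0 \<rho> by (simp add: Bp_def)
  have pcont: "continuous_on A (p n)" for n A
    using p(1)[of n] by (simp add: continuous_on_polymonial_function real_polynomial_function_eq)
  define d' where "d' n \<tau> = \<phi> (x, t) - \<phi> (x, lag t \<tau>) + (- ((lag t \<tau> - t)\<^sup>2 * p n (lag t \<tau>)))" for n \<tau>
  have ineq: "\<alpha> / Gamma (1 - \<alpha>) * marchaud \<alpha> (d' n) + F x (fst (G (x, t))) \<le> 0" for n
  proof -
    have "\<exists>K\<ge>0. \<forall>z\<in>space_time T. u z - (\<phi> z + K * (norm (fst z - x))\<^sup>2 + (snd z - t)\<^sup>2 * p n (snd z)) \<le> c0"
    proof (rule tilted_test_dominates[OF usc \<phi>c pcont t _ _ \<rho>(1)])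
      show "u z - \<phi> z \<le> c0" if "z \<in> space_time T" for z using mx[OF that] by (simp add: c0_def)
      show "0 < p n s" if "s \<in> {0..T}" "\<bar>s - t\<bar> \<le> \<rho>" for s using p(2)[OF that(1), of n] that(2) by (simp add: q_def)
      show "u (x, s) - \<phi> (x, s) - c0 < (s - t)\<^sup>2 * p n s" if "s \<in> {0..T}" "\<rho> < \<bar>s - t\<bar>" for s
      proof -
        have "0 < (s - t)\<^sup>2" using that(2) \<rho>(1) by auto
        then show ?thesis using p(2)[OF that(1), of n] that(2) by (simp add: q_def h_def divide_less_eq mult.commute)
      qed
    qed
    then obtain K where K: "K \<ge> 0"
      "\<And>z. z \<in> space_time T \<Longrightarrow> u z - (\<phi> z + K * (norm (fst z - x))\<^sup>2 + (snd z - t)\<^sup>2 * p n (snd z)) \<le> c0" by blast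
    obtain p' where p': "real_polynomial_function p'" "\<And>s. (p n has_real_derivative p' s) (at s)"
      using has_real_derivative_polynomial_function[OF p(1)[of n]] by metis
    have p'c: "continuous_on A p'" for A
      using p'(1) by (simp add: continuous_on_polymonial_function real_polynomial_function_eq)
    let ?w = "\<lambda>s. (s - t)\<^sup>2 * p n s" and ?w' = "\<lambda>s. 2 * (s - t) * p n s + (s - t)\<^sup>2 * p' s"
    have tw: "test_function T (\<lambda>z. ?w (snd z)) (\<lambda>z. (0 :: real ^ 'n, ?w' (snd z)))"
      by (rule test_function_time)
         (auto intro!: continuous_intros pcont p'c derivative_eq_intros p'(2))
    have tK: "test_function T (\<lambda>z. K * (norm (fst z - x))\<^sup>2) (\<lambda>z. K *\<^sub>R (2 *\<^sub>R (fst z - x), 0))"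
      by (rule test_function_cmult[OF test_function_space[OF C1_square_distance]])
    have m: "u z - (\<phi> z + K * (norm (fst z - x))\<^sup>2 + ?w (snd z))
        \<le> u (x, t) - (\<phi> (x, t) + K * (norm (fst (x, t) - x))\<^sup>2 + ?w (snd (x, t)))"
      if "z \<in> space_time T" for z using K(2)[OF that] by (simp add: c0_def)
    from subsolution_test[OF alpha sub test_function_add[OF test_function_add[OF tf tK] tw] t m]
    show ?thesis unfolding d'_def[abs_def] by (simp add: diff_diff_eq)
  qed
  obtain B1 r where r: "0 < r" "\<forall>x' t'. dist x' x \<le> r \<longrightarrow> \<bar>t' - t\<bar> \<le> r \<longrightarrow> t' \<le> T \<longrightarrow>
     small_incr B1 (incr \<phi> x' t')"
    using test_function_small_incr[OF tf t, of x] by blast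
  then have si1: "small_incr B1 (incr \<phi> x t)" using t by simp
  have lagI: "lag t \<tau> \<in> {0..T}" for \<tau> using lag_in[of t T \<tau>] t by simp
  have si2: "small_incr ((T + T\<^sup>2) * Bp) (\<lambda>\<tau>. - ((lag t \<tau> - t)\<^sup>2 * p n (lag t \<tau>)))" for n
    unfolding small_incr_def
  proof (intro conjI allI impI)
    show "(\<lambda>\<tau>. - ((lag t \<tau> - t)\<^sup>2 * p n (lag t \<tau>))) \<in> borel_measurable borel"
      by (intro borel_measurable_continuous_onI continuous_intros
          continuous_on_compose2[OF pcont[of UNIV]]) auto
    fix \<tau> :: real assume \<tau>: "\<tau> > 0"
    have "(lag t \<tau> - t)\<^sup>2 \<le> (T + T\<^sup>2) * min \<tau> 1"
    proof -
      have e: "\<bar>lag t \<tau> - t\<bar> = min \<tau> t" using \<tau> t by (auto simp: lag_def)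
      have "(lag t \<tau> - t)\<^sup>2 = min \<tau> t * min \<tau> t" by (metis e power2_abs power2_eq_square)
      also have "\<dots> \<le> min \<tau> t * T" using \<tau> t by (intro mult_left_mono) auto
      also have "\<dots> \<le> (T + T\<^sup>2) * min \<tau> 1"
      proof (cases "\<tau> \<le> 1")
        case True
        have "min \<tau> t * T \<le> \<tau> * T" using t by (intro mult_right_mono) auto
        also have "\<dots> \<le> (T + T\<^sup>2) * \<tau>" using \<tau> by (simp add: algebra_simps)
        finally show ?thesis using True by simp
      next
        case False
        have "min \<tau> t * T \<le> T * T" using t by (intro mult_right_mono) auto
        moreover have "(T + T\<^sup>2) * min \<tau> 1 = T + T * T" using False by (simp add: power2_eq_square)
        ultimately show ?thesis using t by linarith
      qed
      finally show ?thesis .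
    qed
    then have "(lag t \<tau> - t)\<^sup>2 * \<bar>p n (lag t \<tau>)\<bar> \<le> ((T + T\<^sup>2) * min \<tau> 1) * Bp"
      using p(3)[OF lagI[of \<tau>], of n] by (intro mult_mono) (use \<tau> t in \<open>auto simp: Bp_def\<close>)
    then show "\<bar>- ((lag t \<tau> - t)\<^sup>2 * p n (lag t \<tau>))\<bar> \<le> ((T + T\<^sup>2) * Bp) * min \<tau> 1"
      by (simp add: abs_mult mult_ac)
  qed
  have si: "small_incr (B1 + (T + T\<^sup>2) * Bp) (d' n)" for n
    unfolding d'_def by (rule small_incr_add[OF si1 si2])
  have lim: "(\<lambda>n. d' n \<tau>) \<longlonglongrightarrow> d \<tau>" for \<tau>
  proof -
    have "(\<lambda>n. d' n \<tau>) \<longlonglongrightarrow> \<phi> (x, t) - \<phi> (x, lag t \<tau>) + (- ((lag t \<tau> - t)\<^sup>2 * q (lag t \<tau>)))"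
      unfolding d'_def by (intro tendsto_intros p(4) lagI)
    moreover have "\<phi> (x, t) - \<phi> (x, lag t \<tau>) + (- ((lag t \<tau> - t)\<^sup>2 * q (lag t \<tau>))) = d \<tau>"
    proof -
      have e: "\<bar>lag t \<tau> - t\<bar> = min \<bar>\<tau>\<bar> t" using t by (auto simp: lag_def)
      show ?thesis
      proof (cases "\<bar>\<tau>\<bar> \<le> \<rho>")
        case True
        then show ?thesis using e by (simp add: d_def q_def)
      next
        case False
        then have f: "\<bar>lag t \<tau> - t\<bar> > \<rho>" using e \<rho> by simp
        then have "(lag t \<tau> - t)\<^sup>2 * q (lag t \<tau>) = h (lag t \<tau>)" using \<rho>(1) by (simp add: q_def)
        then show ?thesis using False by (simp add: d_def h_def c0_def)
      qed
    qed
    ultimately show ?thesis by simp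
  qed
  note L = marchaud_tendsto[OF alpha si lim]
  have "(\<lambda>n. \<alpha> / Gamma (1 - \<alpha>) * marchaud \<alpha> (d' n) + F x (fst (G (x, t)))) \<longlonglongrightarrow>
     \<alpha> / Gamma (1 - \<alpha>) * marchaud \<alpha> d + F x (fst (G (x, t)))"
    by (intro tendsto_intros L(2))
  then have "\<alpha> / Gamma (1 - \<alpha>) * marchaud \<alpha> d + F x (fst (G (x, t))) \<le> 0"
    by (rule LIMSEQ_le_const2) (use ineq in auto)
  then show ?thesis using L(1) by blast
qed

section \<open>Barriers at the initial time\<close>

text \<open>
  The barrier \<open>u0 y + L * sqrt (\<delta> + (norm (x - y))\<^sup>2) + C * t powr \<alpha>\<close> lies above \<open>u0\<close> initially and is
  close to \<open>u0 y + C * t powr \<alpha>\<close> at \<open>x = y\<close>. At a positive time, \<open>J\<close> of it equals \<open>C / Gamma (1 - \<alpha>)\<close>, and \<open>K\<close> of it is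
  nonnegative by monotonicity in time. So \<open>u\<close> minus the barrier has its maximum, which exists because
  the barrier grows linearly in \<open>x\<close>, at the initial time.
\<close>
lemma subsolution_barrier:
  fixes u :: "(real ^ 'n) \<times> real \<Rightarrow> real"
  assumes alpha: "0 < \<alpha>" "\<alpha> < 1" and sub: "viscosity_subsolution T \<alpha> F u0 u"
    and bd: "\<And>z. z \<in> space_time T \<Longrightarrow> u z \<le> M"
    and L: "0 < L" "L-lipschitz_on UNIV u0" and C: "0 \<le> C"
    and F: "\<And>x p. norm p \<le> L \<Longrightarrow> - (C / Gamma (1 - \<alpha>)) < F x p"
    and t: "0 \<le> t" "t \<le> T"
  shows "u (y, t) \<le> u0 y + C * t powr \<alpha>"
proof -
  have usc: "seq_usc_on (space_time T) u"
    using sub by (simp add: viscosity_subsolution_def usc_on_imp_seq_usc_on)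
  have main: "u (y, t) \<le> u0 y + L * sqrt \<delta> + C * t powr \<alpha>" if \<delta>: "\<delta> > 0" for \<delta>
  proof -
    define g where "g x = sqrt (\<delta> + (norm (x - y))\<^sup>2)" for x
    define \<psi> where "\<psi> z = L * g (fst z) + C * snd z powr \<alpha>" for z :: "(real ^ 'n) \<times> real"
    define G where "G z = L *\<^sub>R ((1 / g (fst z)) *\<^sub>R (fst z - y), 0) + (0 :: real ^ 'n, C * (\<alpha> * snd z powr (\<alpha> - 1)))" for z
    have gpos: "g x > 0" and gge: "norm (x - y) \<le> g x" for x
      unfolding g_def using \<delta> by (auto simp: add_pos_nonneg intro!: real_le_rsqrt)
    have tf: "test_function T \<psi> G"
      unfolding \<psi>_def G_def g_def
    proof (intro test_function_add test_function_cmult test_function_space C1_smoothed_distance \<delta>)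
      show "test_function T (\<lambda>z. C * snd z powr \<alpha>) (\<lambda>z. (0 :: real ^ 'n, C * (\<alpha> * snd z powr (\<alpha> - 1))))"
        by (rule test_function_time)
           (use alpha in \<open>auto intro!: continuous_intros continuous_on_powr' derivative_eq_intros\<close>)
    qed
    have \<psi>c: "continuous_on (space_time T) \<psi>" using tf by (simp add: test_function_def)
    have "\<exists>z\<in>space_time T. \<forall>w\<in>space_time T. u w - \<psi> w \<le> u z - \<psi> z"
    proof (rule usc_coercive_attains_sup[OF closed_space_time])
      show "(y, 0) \<in> space_time T" using t by simp
      show "seq_usc_on (space_time T) (\<lambda>w. u w - \<psi> w)" by (rule seq_usc_on_diff_continuous[OF usc \<psi>c])
      fix z assume z: "z \<in> space_time T" "u (y, 0) - \<psi> (y, 0) \<le> u z - \<psi> z"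
      have "L * norm (fst z - y) \<le> L * g (fst z)" using gge L by simp
      also have "\<dots> \<le> \<psi> z" using C by (simp add: \<psi>_def)
      also have "\<dots> \<le> M - (u (y, 0) - \<psi> (y, 0))"
        using z(2) bd[OF z(1)] by linarith
      finally have "norm (fst z - y) \<le> (M - (u (y, 0) - \<psi> (y, 0))) / L" using L by (simp add: field_simps)
      moreover have "norm (fst z) \<le> norm y + norm (fst z - y)" by (metis add.commute diff_add_cancel norm_triangle_ineq)
      moreover have "\<bar>snd z\<bar> \<le> T" using z(1) by (simp add: snd_space_time)
      moreover have "norm z \<le> norm (fst z) + norm (snd z)" by (metis norm_Pair_le prod.collapse)
      ultimately show "norm z \<le> norm y + (M - (u (y, 0) - \<psi> (y, 0))) / L + T" by simp
    qed
    then obtain x1 t1 where z: "(x1, t1) \<in> space_time T"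
      "\<And>w. w \<in> space_time T \<Longrightarrow> u w - \<psi> w \<le> u (x1, t1) - \<psi> (x1, t1)" by force
    have t1: "0 \<le> t1" "t1 \<le> T" using z(1) by auto
    have "t1 = 0"
    proof (rule ccontr)
      assume "t1 \<noteq> 0"
      then have t1p: "0 < t1" using t1 by simp
      have "J_op \<alpha> \<psi> x1 t1 + K_op \<alpha> 0 t1 \<psi> x1 t1 + F x1 (fst (G (x1, t1))) \<le> 0"
        using sub tf t1p t1 z(2) unfolding viscosity_subsolution_def by auto
      moreover have "J_op \<alpha> \<psi> x1 t1 = C / Gamma (1 - \<alpha>)"
        using t1p alpha by (simp add: J_op_def \<psi>_def)
      moreover have "K_op \<alpha> 0 t1 \<psi> x1 t1 \<ge> 0"
        unfolding K_op_def set_lebesgue_integral_def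
      proof (intro mult_nonneg_nonneg integral_nonneg_AE always_eventually allI)
        show "0 \<le> \<alpha> / Gamma (1 - \<alpha>)" using alpha by (simp add: Gamma_real_pos less_imp_le)
        fix \<tau> show "0 \<le> indicat_real {0<..<t1} \<tau> *\<^sub>R ((\<psi> (x1, t1) - \<psi> (x1, t1 - \<tau>)) / \<tau> powr (\<alpha> + 1))"
          using C alpha t1p by (auto simp: indicator_def \<psi>_def intro!: divide_nonneg_nonneg mult_left_mono powr_mono2)
      qed
      moreover have "norm (fst (G (x1, t1))) \<le> L"
      proof -
        have "fst (G (x1, t1)) = (L / g x1) *\<^sub>R (x1 - y)" by (simp add: G_def)
        then have "norm (fst (G (x1, t1))) = L * (norm (x1 - y) / g x1)" using gpos[of x1] L by simp
        also have "\<dots> \<le> L * 1" using gge[of x1] gpos[of x1] L by (intro mult_left_mono) auto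
        finally show ?thesis by simp
      qed
      then have "- (C / Gamma (1 - \<alpha>)) < F x1 (fst (G (x1, t1)))" by (rule F)
      ultimately show False by linarith
    qed
    have "u (x1, 0) \<le> u0 x1" using sub by (simp add: viscosity_subsolution_def)
    also have "\<dots> \<le> u0 y + L * norm (x1 - y)"
      using lipschitz_onD[OF L(2), of x1 y] by (simp add: dist_norm abs_le_iff)
    also have "\<dots> \<le> u0 y + L * g x1" using gge L by simp
    finally have "u (x1, t1) - \<psi> (x1, t1) \<le> u0 y" using \<open>t1 = 0\<close> alpha by (simp add: \<psi>_def)
    then have "u (y, t) - \<psi> (y, t) \<le> u0 y" using z(2)[of "(y, t)"] t by simp
    then show ?thesis by (simp add: \<psi>_def g_def)
  qed
  show ?thesis
  proof (rule field_le_epsilon)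
    fix e :: real assume e: "e > 0"
    have "L * sqrt ((e / L)\<^sup>2) = e" using e L by simp
    then show "u (y, t) \<le> u0 y + C * t powr \<alpha> + e" using main[of "(e / L)\<^sup>2"] e L by simp
  qed
qed

lemma supersolution_barrier:
  fixes u :: "(real ^ 'n) \<times> real \<Rightarrow> real"
  assumes alpha: "0 < \<alpha>" "\<alpha> < 1" and sup: "viscosity_supersolution T \<alpha> F u0 u"
    and bd: "\<And>z. z \<in> space_time T \<Longrightarrow> - M \<le> u z"
    and L: "0 < L" "L-lipschitz_on UNIV u0" and C: "0 \<le> C"
    and F: "\<And>x p. norm p \<le> L \<Longrightarrow> F x p < C / Gamma (1 - \<alpha>)"
    and t: "0 \<le> t" "t \<le> T"
  shows "u0 y - C * t powr \<alpha> \<le> u (y, t)"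
proof -
  have "- u (y, t) \<le> - u0 y + C * t powr \<alpha>"
  proof (rule subsolution_barrier[OF alpha supersolution_uminus[OF sup] _ L(1) _ C _ t])
    show "- u z \<le> M" if "z \<in> space_time T" for z using bd[OF that] by simp
    show "L-lipschitz_on UNIV (\<lambda>x. - u0 x)"
      using L(2) unfolding lipschitz_on_def by (simp add: dist_minus)
    show "- (C / Gamma (1 - \<alpha>)) < - F x (- p)" if "norm p \<le> L" for x p
      using F[of "- p" x] that by simp
  qed
  then show ?thesis by simp
qed

section \<open>Comparison for Hamiltonians independent of the position\<close>

text \<open>
  By homogeneity it suffices that \<open>x \<le> x powr \<alpha>\<close> on \<open>{0..1}\<close>, applied to \<open>a / (a + b)\<close> and \<open>b / (a + b)\<close>.
\<close>
lemma powr_subadditive: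
  fixes a b \<alpha> :: real
  assumes "0 \<le> a" "0 \<le> b" "0 < \<alpha>" "\<alpha> \<le> 1"
  shows "(a + b) powr \<alpha> \<le> a powr \<alpha> + b powr \<alpha>"
proof (cases "a + b = 0")
  case False
  then have s: "0 < a + b" using assms by simp
  have frac: "x / (a + b) * (a + b) powr \<alpha> \<le> x powr \<alpha>" if x: "0 \<le> x" "x \<le> a + b" for x
  proof (cases "x = 0")
    case False
    have "(x / (a + b)) powr 1 \<le> (x / (a + b)) powr \<alpha>"
      by (rule powr_mono') (use x s assms in auto)
    then have "x / (a + b) \<le> x powr \<alpha> / (a + b) powr \<alpha>"
      using x s False by (simp add: powr_divide)
    then show ?thesis using s by (simp add: field_simps)
  qed simp
  have "(a + b) powr \<alpha> = a / (a + b) * (a + b) powr \<alpha> + b / (a + b) * (a + b) powr \<alpha>"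
    using s by (simp flip: distrib_right add_divide_distrib)
  also have "\<dots> \<le> a powr \<alpha> + b powr \<alpha>" using assms by (intro add_mono frac) auto
  finally show ?thesis .
qed (use assms in auto)

text \<open>
  Going back in time moves the time difference of two points monotonically towards \<open>0\<close>, so a penalty
  on this difference cannot increase.
\<close>
lemma lag_diff:
  assumes "0 \<le> t" "0 \<le> s"
  shows "\<exists>\<mu>\<in>{0..1}. lag t \<tau> - lag s \<tau> = \<mu> * (t - s)"
proof (cases "t = s")
  case True
  then show ?thesis by (intro bexI[of _ 0]) auto
next
  case False
  define \<mu> where "\<mu> = (lag t \<tau> - lag s \<tau>) / (t - s)"
  have "0 \<le> \<mu> \<and> \<mu> \<le> 1"
  proof (cases "t < s")
    case True
    then show ?thesis using assms by (auto simp: \<mu>_def lag_def divide_le_eq zero_le_divide_iff)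
  next
    case f: False
    then show ?thesis using assms False by (auto simp: \<mu>_def lag_def divide_le_eq zero_le_divide_iff)
  qed
  moreover have "lag t \<tau> - lag s \<tau> = \<mu> * (t - s)" using False by (simp add: \<mu>_def)
  ultimately show ?thesis by auto
qed

lemma small_incr_min: "small_incr 1 (\<lambda>\<tau>. min \<tau> 1)"
  by (auto simp: small_incr_def)

text \<open>
  The core of comparison. At a maximum of the doubled function, the viscosity inequalities for \<open>u\<close> and
  \<open>v\<close> are subtracted. The increments of \<open>u\<close> minus those of \<open>v\<close> are nonnegative for every \<open>\<tau>\<close>, since
  \<open>lag t \<tau>\<close> and \<open>lag s \<tau>\<close> are competitors in the maximum, and for \<open>\<tau> \<ge> T\<close> they are at least the gain \<open>e\<close>
  over the initial values. For \<open>\<tau> \<le> \<rho>\<close> the increments are those of the quadratic penalties and cost only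
  \<open>2 * k * \<tau>\<^sup>2\<close>, whose integral vanishes with \<open>\<rho>\<close>. Integrating \<open>e\<close> over \<open>{T..}\<close> gives the left-hand side.

  The penalty allows shifts: \<open>z\<close> in space and \<open>l * m\<close> in time. The shift in time is maximised over
  \<open>l \<in> {0..1}\<close>, so that it can be shortened together with the time difference when going back.
\<close>
lemma doubled_maximum_inequality:
  fixes u v :: "(real ^ 'n) \<times> real \<Rightarrow> real" and F :: "real ^ 'n \<Rightarrow> real"
  assumes alpha: "0 < \<alpha>" "\<alpha> < 1" and T: "0 < T"
    and sub: "viscosity_subsolution T \<alpha> (\<lambda>x p. F p) u0 u"
    and sup: "viscosity_supersolution T \<alpha> (\<lambda>x p. F p) v0 v"
    and bu: "\<And>z. z \<in> space_time T \<Longrightarrow> \<bar>u z\<bar> \<le> M" and bv: "\<And>z. z \<in> space_time T \<Longrightarrow> \<bar>v z\<bar> \<le> M"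
    and t: "0 < t" "t \<le> T" and s: "0 < s" "s \<le> T" and k: "0 < k" and l: "l \<in> {0..1}" and e: "0 \<le> e"
    and mx: "\<And>x' t' y' s' l'. (x', t') \<in> space_time T \<Longrightarrow> (y', s') \<in> space_time T \<Longrightarrow> l' \<in> {0..1} \<Longrightarrow>
       u (x', t') - v (y', s') - k * ((norm (x' - y' - z))\<^sup>2 + (t' - s' - l' * m)\<^sup>2) - \<beta> * (norm x')\<^sup>2
       \<le> u (x, t) - v (y, s) - k * ((norm (x - y - z))\<^sup>2 + (t - s - l * m)\<^sup>2) - \<beta> * (norm x)\<^sup>2"
    and gap: "u (x, 0) - v (y, 0) + e \<le> u (x, t) - v (y, s)"
  shows "e / (Gamma (1 - \<alpha>) * T powr \<alpha>) \<le>
     F ((2 * k) *\<^sub>R (x - y - z)) - F ((2 * k) *\<^sub>R (x - y - z) + (2 * \<beta>) *\<^sub>R x)"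
proof -
  let ?c = "\<alpha> / Gamma (1 - \<alpha>)" and ?q = "x - y - z" and ?r = "t - s - l * m"
  define W where "W = marchaud \<alpha> (\<lambda>\<tau>. min \<tau> 1)"
  have c: "0 < ?c" using alpha by (simp add: Gamma_real_pos)
  define \<phi> where "\<phi> Z = k * (norm (fst Z - (y + z)))\<^sup>2 + k * (snd Z - (s + l * m))\<^sup>2 + \<beta> * (norm (fst Z - 0))\<^sup>2"
    for Z :: "(real ^ 'n) \<times> real"
  define G where "G Z = (k *\<^sub>R (2 *\<^sub>R (fst Z - (y + z)), 0) + k *\<^sub>R (0, 2 * (snd Z - (s + l * m)))) + \<beta> *\<^sub>R (2 *\<^sub>R (fst Z - 0), 0)"
    for Z :: "(real ^ 'n) \<times> real"
  define \<psi> where "\<psi> Z = k * (norm (fst Z - (x - z)))\<^sup>2 + k * (snd Z - (t - l * m))\<^sup>2"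
    for Z :: "(real ^ 'n) \<times> real"
  define G' where "G' Z = k *\<^sub>R (2 *\<^sub>R (fst Z - (x - z)), 0) + k *\<^sub>R (0, 2 * (snd Z - (t - l * m)))"
    for Z :: "(real ^ 'n) \<times> real"
  have tt: "test_function T (\<lambda>Z. (snd Z - a)\<^sup>2) (\<lambda>Z. (0 :: real ^ 'n, 2 * (snd Z - a)))" for a
    by (rule test_function_time) (auto intro!: continuous_intros derivative_eq_intros)
  have tf: "test_function T \<phi> G"
    unfolding \<phi>_def G_def
    by (intro test_function_add test_function_cmult test_function_space C1_square_distance tt)
  have tf': "test_function T \<psi> G'"
    unfolding \<psi>_def G'_def
    by (intro test_function_add test_function_cmult test_function_space C1_square_distance tt)
  have mu: "u Z - \<phi> Z \<le> u (x, t) - \<phi> (x, t)" if "Z \<in> space_time T" for Z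
  proof -
    have "fst Z - y - z = fst Z - (y + z)" "x - y - z = x - (y + z)" by (simp_all add: algebra_simps)
    then show ?thesis using mx[of "fst Z" "snd Z" y s l] that s l
      by (simp add: \<phi>_def algebra_simps)
  qed
  have mv: "- v Z - \<psi> Z \<le> - v (y, s) - \<psi> (y, s)" if "Z \<in> space_time T" for Z
  proof -
    have "x - fst Z - z = - (fst Z - (x - z))" "x - y - z = - (y - (x - z))" by simp_all
    then have "norm (x - fst Z - z) = norm (fst Z - (x - z))" "norm (x - y - z) = norm (y - (x - z))"
      by (simp_all only: norm_minus_cancel)
    moreover have "(t - snd Z - l * m)\<^sup>2 = (snd Z - (t - l * m))\<^sup>2" "(t - s - l * m)\<^sup>2 = (s - (t - l * m))\<^sup>2"
      by (simp_all add: power2_eq_square algebra_simps)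
    ultimately show ?thesis using mx[of x t "fst Z" "snd Z" l] that t l
      by (simp add: \<psi>_def algebra_simps)
  qed
  have bound: "?c * (e * (1 / (\<alpha> * T powr \<alpha>)) - 2 * k * \<rho> * W) \<le>
     F ((2 * k) *\<^sub>R ?q) - F ((2 * k) *\<^sub>R ?q + (2 * \<beta>) *\<^sub>R x)"
    if \<rho>: "0 < \<rho>" "\<rho> < t" "\<rho> < s" "\<rho> \<le> 1" for \<rho>
  proof -
    define d where "d \<tau> = (if \<bar>\<tau>\<bar> \<le> \<rho> then \<phi> (x, t) - \<phi> (x, lag t \<tau>) else u (x, t) - u (x, lag t \<tau>))" for \<tau>
    define d' where "d' \<tau> = (if \<bar>\<tau>\<bar> \<le> \<rho> then \<psi> (y, s) - \<psi> (y, lag s \<tau>) else - v (y, s) - (- v (y, lag s \<tau>)))" for \<tau>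
    from subsolution_with_history[OF alpha sub bu tf t mu \<rho>(1,2)]
    obtain B where B: "small_incr B d" and du: "?c * marchaud \<alpha> d + F (fst (G (x, t))) \<le> 0"
      unfolding d_def[abs_def] by blast
    have bv': "\<bar>- v Z\<bar> \<le> M" if "Z \<in> space_time T" for Z using bv[OF that] by simp
    from subsolution_with_history[OF alpha supersolution_uminus[OF sup] bv' tf' s mv \<rho>(1,3)]
    obtain B' where B': "small_incr B' d'" and dv: "?c * marchaud \<alpha> d' + - F (- fst (G' (y, s))) \<le> 0"
      unfolding d'_def[abs_def] by blast
    have G1: "fst (G (x, t)) = (2 * k) *\<^sub>R ?q + (2 * \<beta>) *\<^sub>R x"
      by (simp add: G_def algebra_simps)
    have G2: "- fst (G' (y, s)) = (2 * k) *\<^sub>R ?q"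
      by (simp add: G'_def algebra_simps)
    \<comment> \<open>On \<open>{0<..\<rho>}\<close> the cost \<open>2 * k * \<tau>\<^sup>2\<close> is at most \<open>2 * k * \<rho> * min \<tau> 1\<close>.\<close>
    define E where "E \<tau> = (- (2 * k * \<rho>)) * min \<tau> 1 + e * indicator {T..} \<tau>" for \<tau>
    note sE = small_incr_cmult[OF small_incr_min, of "- (2 * k * \<rho>)"] small_incr_cmult[OF small_incr_indicator_tail[OF T], of e]
    have low: "E \<tau> \<le> d \<tau> + d' \<tau>" if \<tau>: "\<tau> > 0" for \<tau>
    proof (cases "\<tau> \<le> \<rho>")
      case True
      then have lg: "lag t \<tau> = t - \<tau>" "lag s \<tau> = s - \<tau>" using \<tau> \<rho> by (auto simp: lag_def)
      have "d \<tau> + d' \<tau> = - (2 * k * \<tau> * \<tau>)"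
        using True \<tau> by (simp add: d_def d'_def lg \<phi>_def \<psi>_def power2_eq_square algebra_simps)
      moreover have "2 * k * \<tau> * \<tau> \<le> 2 * k * \<tau> * \<rho>" using True \<tau> k by (intro mult_left_mono) auto
      moreover have "E \<tau> = - (2 * k * \<tau> * \<rho>)" using True \<rho> t by (simp add: E_def)
      ultimately show ?thesis by simp
    next
      case False
      then have dd: "d \<tau> + d' \<tau> = (u (x, t) - v (y, s)) - (u (x, lag t \<tau>) - v (y, lag s \<tau>))"
        using \<tau> by (simp add: d_def d'_def)
      have kk: "0 \<le> 2 * k * \<rho> * min \<tau> 1" using k \<rho> \<tau> by simp
      show ?thesis
      proof (cases "T \<le> \<tau>")
        case True
        then have "lag t \<tau> = 0" "lag s \<tau> = 0" using t s \<tau> by (auto simp: lag_def)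
        then have "d \<tau> + d' \<tau> = (u (x, t) - v (y, s)) - (u (x, 0) - v (y, 0))" by (simp add: dd)
        moreover have "E \<tau> = e - 2 * k * \<rho> * min \<tau> 1" using True by (simp add: E_def)
        ultimately show ?thesis using gap kk by linarith
      next
        case far: False
        obtain \<mu> where \<mu>: "\<mu> \<in> {0..1}" "lag t \<tau> - lag s \<tau> = \<mu> * (t - s)"
          using lag_diff[of t s \<tau>] t s by auto
        \<comment> \<open>The shift of the competitor is scaled by the same factor \<open>\<mu>\<close> as the time difference.\<close>
        have ml: "\<mu> * l \<in> {0..1}" using \<mu>(1) l by (auto intro: mult_le_one)
        have "lag t \<tau> - lag s \<tau> - \<mu> * l * m = \<mu> * ?r" by (simp add: \<mu>(2) algebra_simps)
        then have "(lag t \<tau> - lag s \<tau> - \<mu> * l * m)\<^sup>2 = \<mu>\<^sup>2 * ?r\<^sup>2" by (simp add: power_mult_distrib)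
        also have "\<dots> \<le> 1 * ?r\<^sup>2" using \<mu>(1) by (intro mult_right_mono) (auto simp: power_le_one)
        finally have "k * (lag t \<tau> - lag s \<tau> - \<mu> * l * m)\<^sup>2 \<le> k * ?r\<^sup>2" using k by simp
        then have "u (x, lag t \<tau>) - v (y, lag s \<tau>) \<le> u (x, t) - v (y, s)"
          using mx[of x "lag t \<tau>" y "lag s \<tau>" "\<mu> * l"] ml lag_in[of t T \<tau>] lag_in[of s T \<tau>] t s
          by (simp add: distrib_left)
        moreover have "E \<tau> = - (2 * k * \<rho> * min \<tau> 1)" using far by (simp add: E_def)
        ultimately show ?thesis using dd kk by linarith
      qed
    qed
    have "- (2 * k * \<rho>) * W + e * (1 / (\<alpha> * T powr \<alpha>)) = marchaud \<alpha> E"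
      unfolding E_def W_def marchaud_add[OF alpha sE] marchaud_cmult
      using marchaud_indicator_tail[OF alpha(1) T] by simp
    also have "\<dots> \<le> marchaud \<alpha> (\<lambda>\<tau>. d \<tau> + d' \<tau>)"
    proof (rule marchaud_mono[OF alpha _ small_incr_add[OF B B'] low])
      show "small_incr (\<bar>- (2 * k * \<rho>)\<bar> * 1 + \<bar>e\<bar> * (1 + 1 / T)) E"
        using small_incr_add[OF sE] unfolding E_def[abs_def] .
    qed
    also have "\<dots> = marchaud \<alpha> d + marchaud \<alpha> d'" by (rule marchaud_add[OF alpha B B'])
    finally have "e * (1 / (\<alpha> * T powr \<alpha>)) - 2 * k * \<rho> * W \<le> marchaud \<alpha> d + marchaud \<alpha> d'" by simp
    then have "?c * (e * (1 / (\<alpha> * T powr \<alpha>)) - 2 * k * \<rho> * W) \<le> ?c * (marchaud \<alpha> d + marchaud \<alpha> d')"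
      using c by (intro mult_left_mono) auto
    then show ?thesis using du dv unfolding G1 G2 distrib_left by linarith
  qed
  have "((\<lambda>\<rho>. ?c * (e * (1 / (\<alpha> * T powr \<alpha>)) - 2 * k * \<rho> * W)) \<longlongrightarrow>
      ?c * (e * (1 / (\<alpha> * T powr \<alpha>)) - 2 * k * 0 * W)) (at_right 0)"
    by (intro tendsto_intros)
  moreover have "\<forall>\<^sub>F \<rho> in at_right 0. ?c * (e * (1 / (\<alpha> * T powr \<alpha>)) - 2 * k * \<rho> * W) \<le>
     F ((2 * k) *\<^sub>R ?q) - F ((2 * k) *\<^sub>R ?q + (2 * \<beta>) *\<^sub>R x)"
    using eventually_at_right_less[of "0::real"] eventually_at_right_real[of 0 "min (min t s) 1"]
    by (rule eventually_elim2) (use t s bound in auto)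
  ultimately have "?c * (e * (1 / (\<alpha> * T powr \<alpha>)) - 2 * k * 0 * W) \<le>
     F ((2 * k) *\<^sub>R ?q) - F ((2 * k) *\<^sub>R ?q + (2 * \<beta>) *\<^sub>R x)"
    by (rule tendsto_upperbound) simp
  then show ?thesis using alpha by simp
qed

text \<open>
  For \<open>x1 = y1\<close> and \<open>t1 = s1\<close> this is the comparison principle; for \<open>u = v\<close> it is a modulus of continuity,
  Lipschitz in space and of order \<open>\<alpha>\<close> in time. If the claim fails by \<open>8 * \<eta>\<close>, the doubled function with
  shifts \<open>x1 - y1\<close> and \<open>t1 - s1\<close> has a maximum whose value is too large for either point to lie at the
  initial time, so that the inequality of the preceding lemma applies. The gain over the initial values
  is at least \<open>6 * \<eta>\<close> independently of the confinement \<open>\<beta> * (norm x)\<^sup>2\<close>, whose effect on \<open>F\<close> vanishes with \<open>\<beta>\<close>.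
\<close>
lemma comparison_with_moduli:
  fixes u v :: "(real ^ 'n) \<times> real \<Rightarrow> real" and F :: "real ^ 'n \<Rightarrow> real"
  assumes alpha: "0 < \<alpha>" "\<alpha> < 1" and T: "0 < T" and Fc: "continuous_on UNIV F"
    and sub: "viscosity_subsolution T \<alpha> (\<lambda>x p. F p) u0 u"
    and sup: "viscosity_supersolution T \<alpha> (\<lambda>x p. F p) v0 v"
    and bu: "\<And>z. z \<in> space_time T \<Longrightarrow> \<bar>u z\<bar> \<le> M" and bv: "\<And>z. z \<in> space_time T \<Longrightarrow> \<bar>v z\<bar> \<le> M"
    and L: "L-lipschitz_on UNIV g" and C: "0 \<le> C"
    and up: "\<And>x t. (x, t) \<in> space_time T \<Longrightarrow> u (x, t) \<le> g x + C * t powr \<alpha>"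
    and lo: "\<And>x t. (x, t) \<in> space_time T \<Longrightarrow> g x - C * t powr \<alpha> \<le> v (x, t)"
    and p1: "(x1, t1) \<in> space_time T" and p2: "(y1, s1) \<in> space_time T"
  shows "u (x1, t1) - v (y1, s1) \<le> L * norm (x1 - y1) + C * \<bar>t1 - s1\<bar> powr \<alpha>"
proof (rule ccontr)
  assume neg: "\<not> ?thesis"
  define z where "z = x1 - y1"
  define m where "m = t1 - s1"
  define A where "A = L * norm z + C * \<bar>m\<bar> powr \<alpha>"
  define \<eta> where "\<eta> = (u (x1, t1) - v (y1, s1) - A) / 8"
  have \<eta>: "0 < \<eta>" using neg by (simp add: \<eta>_def A_def z_def m_def)
  have L0: "0 \<le> L" using L by (rule lipschitz_on_nonneg)
  have A0: "0 \<le> A" using L0 C by (simp add: A_def)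
  have M0: "0 \<le> M" using bu[OF p1] by simp
  \<comment> \<open>The penalty \<open>k\<close> is chosen so that shifted differences at the maximum are at most \<open>a\<close>, and \<open>a\<close> so
    that they change \<open>L * norm z\<close> and \<open>C * \<bar>m\<bar> powr \<alpha>\<close> by at most \<open>\<eta>\<close>.\<close>
  define a where "a = min (\<eta> / (L + 1)) ((\<eta> / (C + 1)) powr (1 / \<alpha>))"
  have a: "0 < a" using \<eta> L0 C by (simp add: a_def)
  have La: "L * a \<le> \<eta>"
  proof -
    have "L * a \<le> (L + 1) * (\<eta> / (L + 1))" using L0 a by (intro mult_mono) (auto simp: a_def)
    then show ?thesis using L0 by simp
  qed
  have Ca: "C * a powr \<alpha> \<le> \<eta>"
  proof -
    have "a powr \<alpha> \<le> ((\<eta> / (C + 1)) powr (1 / \<alpha>)) powr \<alpha>"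
      using a alpha by (intro powr_mono2) (auto simp: a_def)
    also have "\<dots> = \<eta> / (C + 1)" using alpha \<eta> C by (simp add: powr_powr)
    finally have "C * a powr \<alpha> \<le> (C + 1) * (\<eta> / (C + 1))" using C \<eta> by (intro mult_mono) auto
    then show ?thesis using C by simp
  qed
  define k where "k = (2 * M + 1) / a\<^sup>2"
  have k: "0 < k" using M0 a by (simp add: k_def)
  have ka: "b \<le> a" if "k * b\<^sup>2 \<le> 2 * M" for b
  proof -
    have "k * b\<^sup>2 \<le> k * a\<^sup>2" using that a by (simp add: k_def)
    then have "b\<^sup>2 \<le> a\<^sup>2" using k by simp
    then show ?thesis by (rule power2_le_imp_le) (use a in simp)
  qed
  define tol where "tol = \<eta> / (Gamma (1 - \<alpha>) * T powr \<alpha>)"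
  have tol: "0 < tol" using \<eta> alpha T by (simp add: tol_def Gamma_real_pos)
  have "uniformly_continuous_on (cball 0 (2 * k * a + 1)) F"
    by (rule compact_uniformly_continuous) (auto intro: continuous_on_subset[OF Fc])
  from uniformly_continuous_onE[OF this tol]
  obtain d where d: "0 < d" "\<And>p p'. p \<in> cball 0 (2 * k * a + 1) \<Longrightarrow> p' \<in> cball 0 (2 * k * a + 1) \<Longrightarrow>
     dist p' p < d \<Longrightarrow> dist (F p') (F p) < tol"
    by blast
  define dd where "dd = min d 1"
  have dd: "0 < dd" using d by (simp add: dd_def)
  \<comment> \<open>The first bound keeps the value at the starting points; the second makes the gradient
    \<open>(2 * \<beta>) *\<^sub>R x\<close> of the confinement shorter than \<open>dd\<close> wherever \<open>\<beta> * (norm x)\<^sup>2 \<le> 2 * M\<close>.\<close>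
  define \<beta> where "\<beta> = min (\<eta> / ((norm x1)\<^sup>2 + 1)) (dd\<^sup>2 / (8 * M + 1))"
  have \<beta>: "0 < \<beta>" using \<eta> dd M0 by (simp add: \<beta>_def add_nonneg_pos)
  have \<beta>1: "\<beta> * (norm x1)\<^sup>2 \<le> \<eta>"
  proof -
    have "\<beta> * (norm x1)\<^sup>2 \<le> \<eta> / ((norm x1)\<^sup>2 + 1) * ((norm x1)\<^sup>2 + 1)"
      using \<beta> by (intro mult_mono) (auto simp: \<beta>_def \<eta> less_imp_le)
    also have "\<dots> = \<eta>" by (simp add: add_nonneg_eq_0_iff)
    finally show ?thesis .
  qed
  have \<beta>2: "norm ((2 * \<beta>) *\<^sub>R x) < dd" if "\<beta> * (norm x)\<^sup>2 \<le> 2 * M" for x :: "real ^ 'n"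
  proof -
    have "(norm ((2 * \<beta>) *\<^sub>R x))\<^sup>2 = 4 * \<beta> * (\<beta> * (norm x)\<^sup>2)" using \<beta> by (simp add: power2_eq_square)
    also have "\<dots> \<le> 4 * \<beta> * (2 * M)" using that \<beta> by (intro mult_left_mono) auto
    also have "\<dots> < (8 * M + 1) * \<beta>" using \<beta> by (simp add: algebra_simps)
    also have "\<dots> \<le> (8 * M + 1) * (dd\<^sup>2 / (8 * M + 1))" using M0 by (intro mult_left_mono) (auto simp: \<beta>_def)
    also have "\<dots> = dd\<^sup>2" using M0 by simp
    finally show ?thesis by (rule power2_less_imp_less) (use dd in simp)
  qed
  define S :: "(((real ^ 'n) \<times> real) \<times> ((real ^ 'n) \<times> real) \<times> real) set"
    where "S = space_time T \<times> (space_time T \<times> {0..1})"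
  define P where "P Z = k * ((norm (fst (fst Z) - fst (fst (snd Z)) - z))\<^sup>2 +
      (snd (fst Z) - snd (fst (snd Z)) - snd (snd Z) * m)\<^sup>2) + \<beta> * (norm (fst (fst Z)))\<^sup>2"
    for Z :: "((real ^ 'n) \<times> real) \<times> ((real ^ 'n) \<times> real) \<times> real"
  define f where "f Z = u (fst Z) + (- v (fst (snd Z))) - P Z"
    for Z :: "((real ^ 'n) \<times> real) \<times> ((real ^ 'n) \<times> real) \<times> real"
  let ?Z0 = "((x1, t1), (y1, s1), 1 :: real)"
  have Z0: "?Z0 \<in> S" using p1 p2 by (simp add: S_def)
  have f0: "A + 7 * \<eta> \<le> f ?Z0"
  proof -
    have "f ?Z0 = u (x1, t1) - v (y1, s1) - \<beta> * (norm x1)\<^sup>2" by (simp add: f_def P_def z_def m_def)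
    moreover have "8 * \<eta> = u (x1, t1) - v (y1, s1) - A"
      unfolding \<eta>_def times_divide_eq_right by (rule nonzero_mult_div_cancel_left) simp
    ultimately show ?thesis using \<beta>1 by linarith
  qed
  have closedS: "closed S" unfolding S_def by (intro closed_Times closed_space_time closed_atLeastAtMost)
  have fusc: "seq_usc_on S f"
    unfolding f_def
  proof (intro seq_usc_on_diff_continuous seq_usc_on_add)
    show "seq_usc_on S (\<lambda>Z. u (fst Z))"
      by (rule seq_usc_on_compose[of "space_time T"])
         (use sub in \<open>auto simp: S_def viscosity_subsolution_def usc_on_imp_seq_usc_on intro!: continuous_intros\<close>)
    show "seq_usc_on S (\<lambda>Z. - v (fst (snd Z)))"
      by (rule seq_usc_on_compose[of "space_time T" "\<lambda>z. - v z"])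
         (use supersolution_uminus[OF sup] in \<open>auto simp: S_def viscosity_subsolution_def usc_on_imp_seq_usc_on intro!: continuous_intros\<close>)
    show "continuous_on S P" unfolding P_def by (intro continuous_intros)
  qed
  have pen: "P Z \<le> 2 * M" if "Z \<in> S" "f ?Z0 \<le> f Z" for Z
    using that f0 A0 \<eta> bu[of "fst Z"] bv[of "fst (snd Z)"] by (force simp: S_def f_def)
  have pen1: "\<beta> * (norm (fst (fst Z)))\<^sup>2 \<le> 2 * M"
    and pen2: "norm (fst (fst Z) - fst (fst (snd Z)) - z) \<le> a"
    and pen3: "\<bar>snd (fst Z) - snd (fst (snd Z)) - snd (snd Z) * m\<bar> \<le> a"
    if "Z \<in> S" "f ?Z0 \<le> f Z" for Z
  proof -
    have n: "0 \<le> k * (norm (fst (fst Z) - fst (fst (snd Z)) - z))\<^sup>2"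
      "0 \<le> k * (snd (fst Z) - snd (fst (snd Z)) - snd (snd Z) * m)\<^sup>2"
      "0 \<le> \<beta> * (norm (fst (fst Z)))\<^sup>2" using k \<beta> by simp_all
    have le: "k * (norm (fst (fst Z) - fst (fst (snd Z)) - z))\<^sup>2 +
      k * (snd (fst Z) - snd (fst (snd Z)) - snd (snd Z) * m)\<^sup>2 + \<beta> * (norm (fst (fst Z)))\<^sup>2 \<le> 2 * M"
      using pen[OF that] by (simp add: P_def distrib_left)
    show "\<beta> * (norm (fst (fst Z)))\<^sup>2 \<le> 2 * M" using n le by linarith
    show "norm (fst (fst Z) - fst (fst (snd Z)) - z) \<le> a" by (rule ka) (use n le in linarith)
    have "k * \<bar>snd (fst Z) - snd (fst (snd Z)) - snd (snd Z) * m\<bar>\<^sup>2 \<le> 2 * M"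
      unfolding power2_abs using n le by linarith
    then show "\<bar>snd (fst Z) - snd (fst (snd Z)) - snd (snd Z) * m\<bar> \<le> a" by (rule ka)
  qed
  have bdd: "norm Z \<le> 2 * (sqrt (2 * M / \<beta>) + T) + norm z + a + 1" if "Z \<in> S" "f ?Z0 \<le> f Z" for Z
  proof -
    obtain x t y s l where Z: "Z = ((x, t), (y, s), l)" by (metis surj_pair)
    have "(norm x)\<^sup>2 \<le> 2 * M / \<beta>" using pen1[OF that] \<beta> by (simp add: Z field_simps)
    then have nx: "norm x \<le> sqrt (2 * M / \<beta>)" by (rule real_le_rsqrt)
    have "norm (x - y - z) \<le> a" using pen2[OF that] by (simp add: Z)
    moreover have "norm y \<le> norm x + norm z + norm (x - y - z)"
    proof -
      have "y = x - z - (x - y - z)" by simp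
      then have "norm y \<le> norm (x - z) + norm (x - y - z)" by (metis norm_triangle_ineq4)
      then show ?thesis using norm_triangle_ineq4[of x z] by linarith
    qed
    moreover have "norm Z \<le> norm x + norm t + (norm y + norm s + norm l)"
      unfolding Z by (intro order_trans[OF norm_Pair_le] add_mono norm_Pair_le order_refl)
    moreover have "\<bar>t\<bar> \<le> T" "\<bar>s\<bar> \<le> T" "\<bar>l\<bar> \<le> 1" using that(1) by (auto simp: Z S_def)
    ultimately show ?thesis using nx by simp
  qed
  obtain Z where Z: "Z \<in> S" "\<And>w. w \<in> S \<Longrightarrow> f w \<le> f Z"
    using usc_coercive_attains_sup[OF closedS Z0 fusc bdd] by blast
  obtain x t y s l where Ze: "Z = ((x, t), (y, s), l)" by (metis surj_pair)
  have ts: "0 \<le> t" "t \<le> T" "0 \<le> s" "s \<le> T" and l: "l \<in> {0..1}" using Z(1) by (auto simp: Ze S_def)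
  note pZ = pen1[OF Z(1) Z(2)[OF Z0]] pen2[OF Z(1) Z(2)[OF Z0]] pen3[OF Z(1) Z(2)[OF Z0]]
  have q: "norm (x - y - z) \<le> a" and r: "\<bar>t - s - l * m\<bar> \<le> a" and bx: "\<beta> * (norm x)\<^sup>2 \<le> 2 * M"
    using pZ by (simp_all add: Ze)
  have "0 \<le> P Z" using k \<beta> by (simp add: P_def)
  then have big: "A + 7 * \<eta> \<le> u (x, t) - v (y, s)" using f0 Z(2)[OF Z0] by (simp add: f_def Ze)
  have gl: "g x - g y \<le> L * norm z + \<eta>"
  proof -
    have "g x - g y \<le> L * norm (x - y)" using lipschitz_onD[OF L, of x y] by (simp add: dist_norm abs_le_iff)
    also have "norm (x - y) \<le> norm z + a" using norm_triangle_ineq[of z "x - y - z"] q by simp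
    then have "L * norm (x - y) \<le> L * (norm z + a)" using L0 by (intro mult_left_mono)
    finally show ?thesis using La by (simp add: distrib_left)
  qed
  have tl: "C * \<bar>t - s\<bar> powr \<alpha> \<le> C * \<bar>m\<bar> powr \<alpha> + \<eta>"
  proof -
    have "\<bar>l * m\<bar> \<le> 1 * \<bar>m\<bar>" using l unfolding abs_mult by (intro mult_right_mono) auto
    then have "\<bar>t - s\<bar> \<le> \<bar>m\<bar> + a" using r by linarith
    then have "\<bar>t - s\<bar> powr \<alpha> \<le> (\<bar>m\<bar> + a) powr \<alpha>" using alpha by (intro powr_mono2) auto
    also have "\<dots> \<le> \<bar>m\<bar> powr \<alpha> + a powr \<alpha>" using a alpha by (intro powr_subadditive) auto
    finally have "C * \<bar>t - s\<bar> powr \<alpha> \<le> C * (\<bar>m\<bar> powr \<alpha> + a powr \<alpha>)" using C by (rule mult_left_mono)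
    then show ?thesis using Ca by (simp add: distrib_left)
  qed
  have bnd: "u (x, t) - v (y, s) \<le> L * norm z + \<eta> + C * t powr \<alpha> + C * s powr \<alpha>"
    using up[of x t] lo[of y s] ts gl by simp
  have tp: "0 < t"
  proof (rule ccontr)
    assume "\<not> 0 < t" then have "t = 0" using ts by simp
    then show False using bnd tl big ts \<eta> alpha by (simp add: A_def)
  qed
  have sp: "0 < s"
  proof (rule ccontr)
    assume "\<not> 0 < s" then have "s = 0" using ts by simp
    then show False using bnd tl big ts \<eta> alpha by (simp add: A_def)
  qed
  have gap: "u (x, 0) - v (y, 0) + 6 * \<eta> \<le> u (x, t) - v (y, s)"
  proof -
    have "u (x, 0) \<le> g x" "g y \<le> v (y, 0)" using up[of x 0] lo[of y 0] T alpha by simp_all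
    moreover have "0 \<le> C * \<bar>m\<bar> powr \<alpha>" using C by simp
    ultimately show ?thesis using gl big by (simp add: A_def)
  qed
  have mx: "u (x', t') - v (y', s') - k * ((norm (x' - y' - z))\<^sup>2 + (t' - s' - l' * m)\<^sup>2) - \<beta> * (norm x')\<^sup>2
       \<le> u (x, t) - v (y, s) - k * ((norm (x - y - z))\<^sup>2 + (t - s - l * m)\<^sup>2) - \<beta> * (norm x)\<^sup>2"
    if "(x', t') \<in> space_time T" "(y', s') \<in> space_time T" "l' \<in> {0..1}" for x' t' y' s' l'
    using Z(2)[of "((x', t'), (y', s'), l')"] that by (simp add: S_def f_def P_def Ze)
  have e0: "0 \<le> 6 * \<eta>" using \<eta> by simp
  let ?p = "(2 * k) *\<^sub>R (x - y - z)"
  have key: "6 * \<eta> / (Gamma (1 - \<alpha>) * T powr \<alpha>) \<le> F ?p - F (?p + (2 * \<beta>) *\<^sub>R x)"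
    by (rule doubled_maximum_inequality[OF alpha T sub sup bu bv tp ts(2) sp ts(4) k l e0 mx gap])
  have np: "norm ?p \<le> 2 * k * a" using q k by simp
  have nw: "norm ((2 * \<beta>) *\<^sub>R x) < dd" by (rule \<beta>2[OF bx])
  have "norm (?p + (2 * \<beta>) *\<^sub>R x) \<le> 2 * k * a + 1"
    using norm_triangle_ineq[of ?p "(2 * \<beta>) *\<^sub>R x"] np nw dd_def by linarith
  then have "?p + (2 * \<beta>) *\<^sub>R x \<in> cball 0 (2 * k * a + 1)" "?p \<in> cball 0 (2 * k * a + 1)"
    using np by (simp_all only: mem_cball_0)
  moreover have "dist ?p (?p + (2 * \<beta>) *\<^sub>R x) < d" using nw by (simp add: dist_norm dd_def)
  ultimately have "dist (F ?p) (F (?p + (2 * \<beta>) *\<^sub>R x)) < tol" by (rule d(2))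
  then have "F ?p - F (?p + (2 * \<beta>) *\<^sub>R x) < tol" by (simp add: dist_real_def abs_less_iff)
  moreover have "6 * \<eta> / (Gamma (1 - \<alpha>) * T powr \<alpha>) = 6 * tol" by (simp add: tol_def)
  ultimately show False using key tol by linarith
qed

section \<open>Continuity of the effective Hamiltonian\<close>

lemma exists_integer_translate:
  fixes x :: "real ^ 'n"
  shows "\<exists>k. (\<forall>i. k $ i \<in> \<int>) \<and> norm (x + k) \<le> real CARD('n)"
proof -
  define k :: "real ^ 'n" where "k = (\<chi> i. - of_int \<lfloor>x $ i\<rfloor>)"
  have "\<bar>(x + k) $ i\<bar> \<le> 1" for i unfolding k_def by simp linarith
  then have "(\<Sum>i\<in>UNIV. \<bar>(x + k) $ i\<bar>) \<le> (\<Sum>i\<in>(UNIV :: 'n set). 1)" by (intro sum_mono)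
  then have "norm (x + k) \<le> real CARD('n)" using norm_le_l1_cart[of "x + k"] by simp
  then show ?thesis by (intro exI[of _ k]) (auto simp: k_def)
qed

lemma integer_periodicD:
  assumes "integer_periodic f" "\<forall>i. k $ i \<in> \<int>"
  shows "f (y + k) = f y"
  using assms by (simp add: integer_periodic_def)

lemma periodic_continuous_bounded:
  fixes v :: "real ^ 'n \<Rightarrow> real"
  assumes "continuous_on UNIV v" "integer_periodic v"
  shows "\<exists>V. \<forall>y. \<bar>v y\<bar> \<le> V"
proof -
  have "bounded (v ` cball 0 (real CARD('n)))"
    by (intro compact_imp_bounded compact_continuous_image continuous_on_subset[OF assms(1)]) auto
  then obtain V where V: "\<And>y. y \<in> cball 0 (real CARD('n)) \<Longrightarrow> \<bar>v y\<bar> \<le> V" unfolding bounded_iff by (auto simp del: mem_cball mem_cball_0)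
  have "\<bar>v y\<bar> \<le> V" for y
  proof -
    obtain k where k: "\<forall>i. k $ i \<in> \<int>" "norm (y + k) \<le> real CARD('n)" using exists_integer_translate by blast
    then have "\<bar>v (y + k)\<bar> \<le> V" by (intro V) (simp only: mem_cball_0)
    then show ?thesis using integer_periodicD[OF assms(2) k(1)] by simp
  qed
  then show ?thesis by blast
qed

abbreviation uniform_modulus ::
  "(real ^ 'n \<Rightarrow> real ^ 'n \<Rightarrow> real) \<Rightarrow> real \<Rightarrow> real \<Rightarrow> real \<Rightarrow> bool" where
  "uniform_modulus H R d e \<equiv> \<forall>x y P Q. norm P \<le> R \<longrightarrow> norm Q \<le> R \<longrightarrow> norm (x - y) < d \<longrightarrow> norm (P - Q) < d
     \<longrightarrow> \<bar>H x P - H y Q\<bar> < e"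

lemma periodic_uniform_continuity:
  fixes H :: "real ^ 'n \<Rightarrow> real ^ 'n \<Rightarrow> real"
  assumes Hc: "continuous_on UNIV (\<lambda>(y, p). H y p)" and per: "\<And>p. integer_periodic (\<lambda>y. H y p)"
    and e: "0 < e"
  shows "\<exists>d>0. uniform_modulus H R d e"
proof -
  let ?K = "cball (0 :: real ^ 'n) (real CARD('n) + 1) \<times> cball (0 :: real ^ 'n) R"
  have "uniformly_continuous_on ?K (\<lambda>(y, p). H y p)"
    by (rule compact_uniformly_continuous) (auto intro: continuous_on_subset[OF Hc] compact_Times)
  from uniformly_continuous_onE[OF this e] obtain d where d: "0 < d"
    "\<And>z z'. z \<in> ?K \<Longrightarrow> z' \<in> ?K \<Longrightarrow> dist z' z < d \<Longrightarrow> dist ((\<lambda>(y, p). H y p) z') ((\<lambda>(y, p). H y p) z) < e"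
    by blast
  have "\<bar>H x P - H y Q\<bar> < e"
    if P: "norm P \<le> R" "norm Q \<le> R" and xy: "norm (x - y) < min (d / 2) 1" and PQ: "norm (P - Q) < min (d / 2) 1" for x y P Q
  proof -
    obtain k where k: "\<forall>i. k $ i \<in> \<int>" "norm (x + k) \<le> real CARD('n)" using exists_integer_translate by blast
    have "norm (y + k) \<le> norm (x + k) + norm (x - y)"
      using norm_triangle_ineq4[of "x + k" "x - y"] by (simp add: add.commute)
    then have yk: "norm (y + k) \<le> real CARD('n) + 1" using k(2) xy by simp
    have "dist (x + k, P) (y + k, Q) \<le> dist (x + k) (y + k) + dist P Q"
      unfolding dist_Pair_Pair by (rule sqrt_sum_squares_le_sum) auto
    also have "\<dots> < d" using xy PQ by (simp add: dist_norm)
    finally have "dist (x + k, P) (y + k, Q) < d" .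
    moreover have "(x + k, P) \<in> ?K" "(y + k, Q) \<in> ?K"
      unfolding mem_Times_iff fst_conv snd_conv mem_cball_0 using k(2) yk P by simp_all
    ultimately have "dist (H (x + k) P) (H (y + k) Q) < e" using d(2)[of "(y + k, Q)" "(x + k, P)"] by simp
    then show ?thesis
      using integer_periodicD[where f = "\<lambda>y. H y P", OF per k(1), of x] integer_periodicD[where f = "\<lambda>y. H y Q", OF per k(1), of y] by (simp add: dist_real_def)
  qed
  then show ?thesis using d(1) by (intro exI[of _ "min (d / 2) 1"]) auto
qed

text \<open>
  Doubling a periodic subsolution \<open>v\<close> and a periodic supersolution \<open>w\<close> of two cell problems gives one
  vector \<open>P\<close> with \<open>H x (p + P) \<le> a\<close> and \<open>b \<le> H y (q + P)\<close>, where \<open>x\<close> and \<open>y\<close> are close. Coercivity bounds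
  \<open>p + P\<close>, so that uniform continuity of \<open>H\<close> applies. By periodicity \<open>x\<close> can be confined to a ball by
  translating \<open>x\<close> and \<open>y\<close> together.
\<close>
lemma corrector_comparison:
  fixes v w :: "real ^ 'n \<Rightarrow> real" and H :: "real ^ 'n \<Rightarrow> real ^ 'n \<Rightarrow> real"
  assumes vc: "continuous_on UNIV v" "integer_periodic v" and wc: "continuous_on UNIV w" "integer_periodic w"
    and sub: "\<And>\<phi> G y. has_C1_gradient_on \<phi> G UNIV \<Longrightarrow> (\<And>z. v z - \<phi> z \<le> v y - \<phi> y) \<Longrightarrow> H y (p + G y) \<le> a"
    and sup: "\<And>\<phi> G y. has_C1_gradient_on \<phi> G UNIV \<Longrightarrow> (\<And>z. w z - \<phi> z \<ge> w y - \<phi> y) \<Longrightarrow> b \<le> H y (q + G y)"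
    and R: "\<And>y P. H y P \<le> a \<Longrightarrow> norm P \<le> R"
    and d: "0 < d" "\<And>x y P Q. norm P \<le> R + 1 \<Longrightarrow> norm Q \<le> R + 1 \<Longrightarrow> norm (x - y) < d \<Longrightarrow> norm (P - Q) < d \<Longrightarrow>
      \<bar>H x P - H y Q\<bar> < e"
    and pq: "norm (p - q) < min d 1"
  shows "b \<le> a + e"
proof -
  obtain V1 where V1: "\<And>y. \<bar>v y\<bar> \<le> V1" using periodic_continuous_bounded[OF vc] by blast
  obtain V2 where V2: "\<And>y. \<bar>w y\<bar> \<le> V2" using periodic_continuous_bounded[OF wc] by blast
  have V0: "0 \<le> V1" "0 \<le> V2" using V1[of 0] V2[of 0] by auto
  define k where "k = (2 * V2 + 1) / d\<^sup>2"
  have k: "0 < k" using V0 d by (simp add: k_def)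
  define f where "f z = v (fst z) - w (snd z) - k * (norm (fst z - snd z))\<^sup>2" for z :: "(real ^ 'n) \<times> (real ^ 'n)"
  let ?B = "real CARD('n)"
  let ?S = "cball (0 :: real ^ 'n) ?B \<times> (UNIV :: (real ^ 'n) set)"
  have fc: "continuous_on UNIV f"
    unfolding f_def
    by (intro continuous_intros continuous_on_compose2[OF vc(1)] continuous_on_compose2[OF wc(1)]) auto
  have "\<exists>z\<in>?S. \<forall>z'\<in>?S. f z' \<le> f z"
  proof (rule usc_coercive_attains_sup)
    show "closed ?S" by (intro closed_Times closed_cball closed_UNIV)
    show "(0, 0) \<in> ?S" by simp
    show "seq_usc_on ?S f" by (rule continuous_on_imp_seq_usc_on[OF continuous_on_subset[OF fc]]) simp
    fix z assume z: "z \<in> ?S" "f (0, 0) \<le> f z"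
    have "k * (norm (fst z - snd z))\<^sup>2 \<le> 2 * V1 + 2 * V2"
      using z(2) V1[of 0] V1[of "fst z"] V2[of 0] V2[of "snd z"] by (simp add: f_def abs_le_iff)
    then have "(norm (fst z - snd z))\<^sup>2 \<le> (2 * V1 + 2 * V2) / k" using k by (simp add: field_simps)
    then have 1: "norm (fst z - snd z) \<le> sqrt ((2 * V1 + 2 * V2) / k)" by (rule real_le_rsqrt)
    have 2: "norm (fst z) \<le> ?B" using z(1) unfolding mem_Times_iff mem_cball_0 by simp
    have "norm z \<le> norm (fst z) + norm (snd z)" by (metis norm_Pair_le prod.collapse)
    moreover have "norm (snd z) \<le> norm (fst z) + norm (fst z - snd z)"
      using norm_triangle_ineq4[of "fst z" "fst z - snd z"] by simp
    ultimately show "norm z \<le> 2 * ?B + sqrt ((2 * V1 + 2 * V2) / k)" using 1 2 by linarith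
  qed
  then obtain x y where xy: "\<And>z'. z' \<in> ?S \<Longrightarrow> f z' \<le> f (x, y)" by fastforce
  have mx: "v x' - w y' - k * (norm (x' - y'))\<^sup>2 \<le> v x - w y - k * (norm (x - y))\<^sup>2" for x' y'
  proof -
    obtain k' where k': "\<forall>i. k' $ i \<in> \<int>" "norm (x' + k') \<le> ?B" using exists_integer_translate by blast
    then have "f (x' + k', y' + k') \<le> f (x, y)"
      by (intro xy) (simp only: mem_Times_iff fst_conv snd_conv mem_cball_0 UNIV_I)
    then show ?thesis
      using integer_periodicD[OF vc(2) k'(1)] integer_periodicD[OF wc(2) k'(1)] by (simp add: f_def)
  qed
  define P where "P = (2 * k) *\<^sub>R (x - y)"
  have 1: "H x (p + k *\<^sub>R (2 *\<^sub>R (x - y))) \<le> a"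
    by (rule sub[OF has_C1_gradient_on_cmult[OF C1_square_distance]]) (use mx[of _ y] in \<open>simp add: algebra_simps\<close>)
  have 2: "b \<le> H y (q + (- k) *\<^sub>R (2 *\<^sub>R (y - x)))"
  proof (rule sup[OF has_C1_gradient_on_cmult[OF C1_square_distance]])
    fix z show "w y - - k * (norm (y - x))\<^sup>2 \<le> w z - - k * (norm (z - x))\<^sup>2"
      using mx[of x z] by (simp add: norm_minus_commute)
  qed
  have "k * (norm (x - y))\<^sup>2 \<le> 2 * V2" using mx[of x x] V2[of x] V2[of y] by (simp add: abs_le_iff)
  also have "\<dots> < k * d\<^sup>2" using d(1) by (simp add: k_def)
  finally have "(norm (x - y))\<^sup>2 < d\<^sup>2" using k by simp
  then have xyd: "norm (x - y) < d" by (rule power2_less_imp_less) (use d in simp)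
  have 1: "H x (p + P) \<le> a" using 1 by (simp add: P_def mult.commute)
  have 2: "b \<le> H y (q + P)" using 2 by (simp add: P_def algebra_simps)
  have n1: "norm (p + P) \<le> R" using R[OF 1] .
  have e: "(p + P) - (q + P) = p - q" by simp
  have "norm (q + P) \<le> norm (p + P) + norm (p - q)" using norm_triangle_ineq4[of "p + P" "p - q"] by (simp add: add.commute[of q P])
  then have "\<bar>H x (p + P) - H y (q + P)\<bar> < e"
    using n1 pq xyd by (intro d(2)) (auto simp: e)
  then show ?thesis using 1 2 by linarith
qed

lemma cell_solution_sub:
  assumes "cell_solution H p c v" "has_C1_gradient_on \<phi> G UNIV" "\<And>z. v z - \<phi> z \<le> v y - \<phi> y"
  shows "H y (p + G y) \<le> c"
  using assms unfolding cell_solution_def by (blast intro: always_eventually)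

lemma cell_solution_super:
  assumes "cell_solution H p c v" "has_C1_gradient_on \<phi> G UNIV" "\<And>z. v z - \<phi> z \<ge> v y - \<phi> y"
  shows "c \<le> H y (p + G y)"
  using assms unfolding cell_solution_def by (blast intro: always_eventually)

text \<open>
  Comparison of correctors bounds \<open>Hbar q\<close> in terms of \<open>Hbar p\<close> with a modulus that depends on an upper
  bound of \<open>Hbar p\<close> only. Starting from \<open>p0\<close> it gives a local upper bound of \<open>Hbar\<close>, which makes the modulus
  uniform for the reverse estimate.
\<close>
lemma effective_Hamiltonian_continuous:
  fixes H :: "real ^ 'n \<Rightarrow> real ^ 'n \<Rightarrow> real"
  assumes Hc: "continuous_on UNIV (\<lambda>(y, p). H y p)" and per: "\<And>p. integer_periodic (\<lambda>y. H y p)"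
    and coer: "\<And>c. \<exists>R. \<forall>y p. H y p \<le> c \<longrightarrow> norm p \<le> R"
    and cell: "\<And>p. \<exists>v. cell_solution H p (Hbar p) v"
  shows "continuous_on UNIV Hbar"
  unfolding continuous_on_iff
proof (intro ballI allI impI)
  fix p0 :: "real ^ 'n" and e :: real assume e: "0 < e"
  define e' where "e' = min e 1 / 2"
  have e': "0 < e'" "e' < e" "e' < 1" using e by (auto simp: e'_def)
  have step: "Hbar q \<le> Hbar p + e'"
    if "\<And>y P. H y P \<le> Hbar p \<Longrightarrow> norm P \<le> R" "0 < d"
      "uniform_modulus H (R + 1) d e'"
      "norm (p - q) < min d 1" for p q R d
  proof -
    obtain v where v: "cell_solution H p (Hbar p) v" using cell by blast
    obtain w where w: "cell_solution H q (Hbar q) w" using cell by blast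
    show ?thesis
    proof (rule corrector_comparison[of v w H p "Hbar p" "Hbar q" q R d e'])
      show "continuous_on UNIV v" "integer_periodic v" "continuous_on UNIV w" "integer_periodic w"
        using v w by (simp_all add: cell_solution_def)
    qed (use that cell_solution_sub[OF v] cell_solution_super[OF w] in auto)
  qed
  obtain R1 where R1: "\<And>y p. H y p \<le> Hbar p0 \<Longrightarrow> norm p \<le> R1" using coer by meson
  obtain R2 where R2: "\<And>y p. H y p \<le> Hbar p0 + 1 \<Longrightarrow> norm p \<le> R2" using coer by meson
  obtain d1 where d1: "0 < d1" "uniform_modulus H (R1 + 1) d1 e'"
    using periodic_uniform_continuity[OF Hc per e'(1)] by meson
  obtain d2 where d2: "0 < d2" "uniform_modulus H (R2 + 1) d2 e'"
    using periodic_uniform_continuity[OF Hc per e'(1)] by meson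
  have "dist (Hbar q) (Hbar p0) < e" if "dist q p0 < min (min d1 d2) 1" for q
  proof -
    have n: "norm (p0 - q) < min d1 1" "norm (q - p0) < min d2 1" using that by (auto simp: dist_norm norm_minus_commute)
    have 1: "Hbar q \<le> Hbar p0 + e'" by (rule step[OF R1 d1 n(1)])
    then have "norm P \<le> R2" if "H y P \<le> Hbar q" for y P using R2[of y P] that e' by linarith
    from step[OF this d2 n(2)] have "Hbar p0 \<le> Hbar q + e'" .
    with 1 e' show ?thesis by (simp add: dist_real_def abs_less_iff)
  qed
  then show "\<exists>d>0. \<forall>x'\<in>UNIV. dist x' p0 < d \<longrightarrow> dist (Hbar x') (Hbar p0) < e"
    using d1 d2 by (intro exI[of _ "min (min d1 d2) 1"]) auto
qed

section \<open>Relaxed limits\<close>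

abbreviation bounded_near ::
  "'a::metric_space set \<Rightarrow> (real \<Rightarrow> 'a \<Rightarrow> real) \<Rightarrow> 'a \<Rightarrow> real \<Rightarrow> real \<Rightarrow> bool" where
  "bounded_near S u z d c \<equiv>
     \<forall>\<epsilon> w. 0 < \<epsilon> \<and> \<epsilon> < d \<and> w \<in> S \<and> dist w z < d \<longrightarrow> u \<epsilon> w \<le> c"

text \<open>
  The upper half-relaxed limit \<open>limsup\<^sup>* u\<close> of Barles and Perthame, as \<open>\<epsilon> \<rightarrow> 0\<close> from above and \<open>w \<rightarrow> z\<close>.
  The lower one is \<open>- relaxed_limsup S (\<lambda>\<epsilon> w. - u \<epsilon> w)\<close>.
\<close>
definition relaxed_limsup :: "'a::metric_space set \<Rightarrow> (real \<Rightarrow> 'a \<Rightarrow> real) \<Rightarrow> 'a \<Rightarrow> real" where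
  "relaxed_limsup S u z =
     Inf {c. \<exists>d>0. bounded_near S u z d c}"

context
  fixes S :: "'a::metric_space set" and u :: "real \<Rightarrow> 'a \<Rightarrow> real" and M :: real
  assumes bd: "\<And>\<epsilon> z. 0 < \<epsilon> \<Longrightarrow> z \<in> S \<Longrightarrow> \<bar>u \<epsilon> z\<bar> \<le> M"
begin

lemma relaxed_limsup_bounds:
  assumes "z \<in> S"
  defines "A \<equiv> {c. \<exists>d>0. bounded_near S u z d c}"
  shows "M \<in> A" "\<And>c. c \<in> A \<Longrightarrow> - M \<le> c" "bdd_below A"
proof -
  show "M \<in> A" unfolding A_def using bd by (auto simp: abs_le_iff intro!: exI[of _ 1])
  show l: "- M \<le> c" if cA: "c \<in> A" for c
  proof -
    obtain d where d: "d > 0" "bounded_near S u z d c"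
      using cA unfolding A_def by blast
    then have "u (d / 2) z \<le> c" using assms(1) by simp
    then show ?thesis using bd[of "d / 2" z] d(1) assms(1) by simp
  qed
  then show "bdd_below A" by (rule bdd_belowI)
qed

lemma relaxed_limsup_upper:
  assumes "z \<in> S" "relaxed_limsup S u z < c"
  shows "\<exists>d>0. bounded_near S u z d c"
proof -
  let ?A = "{c. \<exists>d>0. bounded_near S u z d c}"
  note b = relaxed_limsup_bounds[OF assms(1)]
  have "Inf ?A < c" using assms(2) unfolding relaxed_limsup_def .
  moreover have "?A \<noteq> {}" using b(1) by (rule ex_in_conv[THEN iffD1, OF exI])
  ultimately obtain c' where "c' \<in> ?A" "c' < c" using cInf_less_iff[OF _ b(3)] by meson
  then obtain d where "d > 0" "bounded_near S u z d c'" "c' < c"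
    unfolding mem_Collect_eq by (elim exE conjE) (rule that)
  then show ?thesis
    by (intro exI[of _ d] conjI allI impI) (assumption, rule order_trans[OF _ less_imp_le], auto)
qed

lemma relaxed_limsup_le:
  assumes "z \<in> S" "0 < d" "\<And>\<epsilon> w. 0 < \<epsilon> \<Longrightarrow> \<epsilon> < d \<Longrightarrow> w \<in> S \<Longrightarrow> dist w z < d \<Longrightarrow> u \<epsilon> w \<le> c"
  shows "relaxed_limsup S u z \<le> c"
  unfolding relaxed_limsup_def
  by (rule cInf_lower[OF _ relaxed_limsup_bounds(3)[OF assms(1)]]) (use assms(2,3) in blast)

lemma relaxed_limsup_abs_le:
  assumes "z \<in> S"
  shows "\<bar>relaxed_limsup S u z\<bar> \<le> M"
proof -
  note b = relaxed_limsup_bounds[OF assms]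
  have "relaxed_limsup S u z \<le> M" unfolding relaxed_limsup_def by (rule cInf_lower[OF b(1,3)])
  moreover have "- M \<le> relaxed_limsup S u z"
    unfolding relaxed_limsup_def
    by (rule cInf_greatest, rule ex_in_conv[THEN iffD1, OF exI, OF b(1)], rule b(2))
  ultimately show ?thesis by linarith
qed

lemma relaxed_limsup_usc: "usc_on S (relaxed_limsup S u)"
  unfolding usc_on_def
proof
  fix c
  show "openin (top_of_set S) {z \<in> S. relaxed_limsup S u z < c}"
    unfolding openin_euclidean_subtopology_iff
  proof (intro conjI ballI)
    fix z assume "z \<in> {z \<in> S. relaxed_limsup S u z < c}"
    then have z: "z \<in> S" "relaxed_limsup S u z < c" by auto
    obtain c' where c': "relaxed_limsup S u z < c'" "c' < c" using dense[OF z(2)] by blast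
    obtain d where d: "d > 0" "bounded_near S u z d c'"
      using relaxed_limsup_upper[OF z(1) c'(1)] by blast
    have "relaxed_limsup S u y < c" if y: "y \<in> S" "dist y z < d / 2" for y
    proof -
      have "relaxed_limsup S u y \<le> c'"
      proof (rule relaxed_limsup_le[OF y(1), of "d / 2"])
        fix \<epsilon> w assume w: "0 < \<epsilon>" "\<epsilon> < d / 2" "w \<in> S" "dist w y < d / 2"
        have "dist w z < d" using dist_triangle[of w z y] w(4) y(2) by simp
        then show "u \<epsilon> w \<le> c'" using d w by simp
      qed (use d in simp)
      then show ?thesis using c' by simp
    qed
    then show "\<exists>e>0. \<forall>y\<in>S. dist y z < e \<longrightarrow> y \<in> {z \<in> S. relaxed_limsup S u z < c}"
      using d(1) by (intro exI[of _ "d / 2"]) auto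
  qed auto
qed

lemma relaxed_limsup_sequence:
  assumes "z \<in> S"
  shows "\<exists>E X. \<forall>n. 0 < E n \<and> E n < 1 / real (Suc n) \<and> X n \<in> S \<and> dist (X n) z < 1 / real (Suc n)
     \<and> relaxed_limsup S u z - 1 / real (Suc n) < u (E n) (X n)"
proof -
  have "\<exists>(\<epsilon>::real) w. 0 < \<epsilon> \<and> \<epsilon> < 1 / real (Suc n) \<and> w \<in> S \<and> dist w z < 1 / real (Suc n)
     \<and> relaxed_limsup S u z - 1 / real (Suc n) < u \<epsilon> w" for n
  proof (rule ccontr)
    assume n: "\<not> ?thesis"
    have p: "0 < 1 / real (Suc n)" by simp
    have "relaxed_limsup S u z \<le> relaxed_limsup S u z - 1 / real (Suc n)"
      by (rule relaxed_limsup_le[OF assms p]) (use n in \<open>meson not_le\<close>)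
    then show False using p by linarith
  qed
  then show ?thesis by metis
qed

lemma relaxed_limsup_le_continuous:
  assumes z: "z \<in> S" and g: "continuous_on S g" and le: "\<And>(\<epsilon>::real) w. 0 < \<epsilon> \<Longrightarrow> w \<in> S \<Longrightarrow> u \<epsilon> w \<le> g w"
  shows "relaxed_limsup S u z \<le> g z"
proof (rule field_le_epsilon)
  fix e :: real assume e: "0 < e"
  obtain d where d: "0 < d" "\<And>w. w \<in> S \<Longrightarrow> dist w z < d \<Longrightarrow> dist (g w) (g z) < e"
    using g z e unfolding continuous_on_iff by meson
  show "relaxed_limsup S u z \<le> g z + e"
  proof (rule relaxed_limsup_le[OF z d(1)])
    fix \<epsilon> :: real and w assume "0 < \<epsilon>" "w \<in> S" "dist w z < d"
    then show "u \<epsilon> w \<le> g z + e" using le[of \<epsilon> w] d(2)[of w] by (simp add: dist_real_def abs_less_iff)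
  qed
qed

end

lemma relaxed_limsup_uminus:
  fixes u :: "real \<Rightarrow> 'a::metric_space \<Rightarrow> real"
  assumes bd: "\<And>\<epsilon> z. 0 < \<epsilon> \<Longrightarrow> z \<in> S \<Longrightarrow> \<bar>u \<epsilon> z\<bar> \<le> M" and z: "z \<in> S"
  shows "0 \<le> relaxed_limsup S u z + relaxed_limsup S (\<lambda>\<epsilon> w. - u \<epsilon> w) z"
proof (rule ccontr)
  assume neg: "\<not> ?thesis"
  define e where "e = - (relaxed_limsup S u z + relaxed_limsup S (\<lambda>\<epsilon> w. - u \<epsilon> w) z) / 3"
  have e: "0 < e" using neg by (simp add: e_def)
  have bd': "\<bar>- u \<epsilon> z\<bar> \<le> M" if "0 < \<epsilon>" "z \<in> S" for \<epsilon> z using bd[OF that] by simp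
  obtain d where d: "d > 0" "bounded_near S u z d (relaxed_limsup S u z + e)"
    using relaxed_limsup_upper[where u = u and S = S and M = M, OF bd z, where c = "relaxed_limsup S u z + e"] e by auto
  obtain d' where d': "d' > 0" "bounded_near S (\<lambda>\<epsilon> w. - u \<epsilon> w) z d' (relaxed_limsup S (\<lambda>\<epsilon> w. - u \<epsilon> w) z + e)"
    using relaxed_limsup_upper[where u = "\<lambda>\<epsilon> w. - u \<epsilon> w" and S = S and M = M, OF bd' z, where c = "relaxed_limsup S (\<lambda>\<epsilon> w. - u \<epsilon> w) z + e"] e by auto
  define \<epsilon> where "\<epsilon> = min d d' / 2"
  have "0 < \<epsilon>" "\<epsilon> < d" "\<epsilon> < d'" using d d' by (auto simp: \<epsilon>_def)
  then have "u \<epsilon> z \<le> relaxed_limsup S u z + e" "- u \<epsilon> z \<le> relaxed_limsup S (\<lambda>\<epsilon> w. - u \<epsilon> w) z + e"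
    using d d' z by auto
  then show False using e unfolding e_def by (simp add: field_simps)
qed

section \<open>Perturbed test functions\<close>

abbreviation coercive :: "('a \<Rightarrow> 'b::real_normed_vector \<Rightarrow> real) \<Rightarrow> bool" where
  "coercive H \<equiv> \<forall>c. \<exists>R. \<forall>y p. H y p \<le> c \<longrightarrow> norm p \<le> R"

abbreviation anticoercive :: "('a \<Rightarrow> 'b::real_normed_vector \<Rightarrow> real) \<Rightarrow> bool" where
  "anticoercive H \<equiv> \<forall>c. \<exists>R. \<forall>y p. c \<le> H y p \<longrightarrow> norm p \<le> R"

lemma marchaud_test_tendsto:
  fixes \<phi> :: "(real ^ 'n) \<times> real \<Rightarrow> real"
  assumes alpha: "0 < \<alpha>" "\<alpha> < 1" and tf: "test_function T \<phi> G" and t0: "0 < t0" "t0 \<le> T"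
    and X: "\<And>n. X n \<in> space_time T" "X \<longlonglongrightarrow> (x0, t0)"
  shows "(\<lambda>n. marchaud \<alpha> (\<lambda>\<tau>. \<phi> (X n) - \<phi> (fst (X n), lag (snd (X n)) \<tau>)))
     \<longlonglongrightarrow> marchaud \<alpha> (incr \<phi> x0 t0)"
proof -
  have \<phi>c: "continuous_on (space_time T) \<phi>" using tf by (simp add: test_function_def)
  obtain B r where r: "0 < r" "\<And>x t. dist x x0 \<le> r \<Longrightarrow> \<bar>t - t0\<bar> \<le> r \<Longrightarrow> t \<le> T \<Longrightarrow>
     small_incr B (incr \<phi> x t)"
    using test_function_small_incr[OF tf t0, of x0] by blast
  have fX: "(\<lambda>n. fst (X n)) \<longlonglongrightarrow> x0" using tendsto_fst[OF X(2)] by simp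
  have sX: "(\<lambda>n. snd (X n)) \<longlonglongrightarrow> t0" using tendsto_snd[OF X(2)] by simp
  have "\<forall>\<^sub>F n in sequentially. dist (fst (X n)) x0 < r \<and> dist (snd (X n)) t0 < r"
    using tendstoD[OF fX r(1)] tendstoD[OF sX r(1)] by eventually_elim simp
  then obtain N where N: "\<And>n. n \<ge> N \<Longrightarrow> dist (fst (X n)) x0 < r \<and> dist (snd (X n)) t0 < r"
    by (auto simp: eventually_sequentially)
  have Xin: "0 \<le> snd (X n)" "snd (X n) \<le> T" for n using X(1)[of n] by (simp_all add: snd_space_time)
  have "(\<lambda>n. marchaud \<alpha> (\<lambda>\<tau>. \<phi> (X (n + N)) - \<phi> (fst (X (n + N)), lag (snd (X (n + N))) \<tau>)))
     \<longlonglongrightarrow> marchaud \<alpha> (incr \<phi> x0 t0)"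
  proof (rule marchaud_tendsto(2)[OF alpha])
    show "small_incr B (\<lambda>\<tau>. \<phi> (X (n + N)) - \<phi> (fst (X (n + N)), lag (snd (X (n + N))) \<tau>))" for n
      using r(2)[of "fst (X (n + N))" "snd (X (n + N))"] N[of "n + N"] Xin[of "n + N"] by (simp add: dist_real_def)
    fix \<tau>
    have X': "(\<lambda>n. X (n + N)) \<longlonglongrightarrow> (x0, t0)" using X(2) by (rule LIMSEQ_ignore_initial_segment)
    have l: "(\<lambda>n. lag (snd (X (n + N))) \<tau>) \<longlonglongrightarrow> lag t0 \<tau>"
      unfolding lag_def using LIMSEQ_ignore_initial_segment[OF sX, of N] by (intro tendsto_intros)
    have "(\<lambda>n. \<phi> (X (n + N))) \<longlonglongrightarrow> \<phi> (x0, t0)"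
      by (rule continuous_on_tendsto_compose[OF \<phi>c X']) (use t0 X(1) in auto)
    moreover have "(\<lambda>n. \<phi> (fst (X (n + N)), lag (snd (X (n + N))) \<tau>)) \<longlonglongrightarrow> \<phi> (x0, lag t0 \<tau>)"
      by (rule continuous_on_tendsto_compose[OF \<phi>c tendsto_Pair[OF LIMSEQ_ignore_initial_segment[OF fX] l]])
         (use t0 Xin lag_in[of t0 T \<tau>] lag_in[OF Xin] in auto)
    ultimately show "(\<lambda>n. \<phi> (X (n + N)) - \<phi> (fst (X (n + N)), lag (snd (X (n + N))) \<tau>))
        \<longlonglongrightarrow> \<phi> (x0, t0) - \<phi> (x0, lag t0 \<tau>)" by (rule tendsto_diff)
  qed
  then show ?thesis by (rule LIMSEQ_offset)
qed

text \<open>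
  The function \<open>u (x, t) - \<phi> (x, t) - \<epsilon> * v (y /\<^sub>R \<epsilon>)\<close> minus \<open>(norm (x - y))\<^sup>2 / \<epsilon> ^ 3\<close> is maximised. In
  \<open>(x, t)\<close> this tests the subsolution \<open>u\<close>, in \<open>y\<close> it tests the corrector, and both see the same vector
  \<open>q\<close> from the penalty. The power \<open>\<epsilon> ^ 3\<close> makes \<open>norm (x - y)\<close> of order \<open>\<epsilon>\<^sup>2\<close>, hence the fast variables
  \<open>x /\<^sub>R \<epsilon>\<close> and \<open>y /\<^sub>R \<epsilon>\<close> differ by order \<open>\<epsilon>\<close> only.
\<close>
lemma doubled_corrector_maximum:
  fixes H :: "real ^ 'n \<Rightarrow> real ^ 'n \<Rightarrow> real" and u \<phi> :: "(real ^ 'n) \<times> real \<Rightarrow> real" and v :: "real ^ 'n \<Rightarrow> real"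
  assumes alpha: "0 < \<alpha>" "\<alpha> < 1" and T: "0 < T" and eps: "0 < \<epsilon>"
    and sub: "viscosity_subsolution T \<alpha> (\<lambda>x p. H (x /\<^sub>R \<epsilon>) p) u0 u"
    and bd: "\<And>z. z \<in> space_time T \<Longrightarrow> \<bar>u z\<bar> \<le> M"
    and tf: "test_function T \<phi> G" and \<kappa>: "0 < \<kappa>"
    and grow: "\<And>z. z \<in> space_time T \<Longrightarrow> \<kappa> * (norm (fst z - x0))\<^sup>2 - B \<le> \<phi> z"
    and vc: "continuous_on UNIV v" and V: "\<And>y. \<bar>v y\<bar> \<le> V"
    and sup: "\<And>\<psi> D y. has_C1_gradient_on \<psi> D UNIV \<Longrightarrow> (\<And>z. v z - \<psi> z \<ge> v y - \<psi> y) \<Longrightarrow> c \<le> H y (p0 + D y)"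
  shows "\<exists>x t y q. (x, t) \<in> space_time T
    \<and> (\<forall>z\<in>space_time T. u z - \<phi> z - 2 * \<epsilon> * V \<le> u (x, t) - \<phi> (x, t))
    \<and> norm (x /\<^sub>R \<epsilon> - y /\<^sub>R \<epsilon>) \<le> sqrt (2 * V) * \<epsilon>
    \<and> (0 < t \<longrightarrow> \<alpha> / Gamma (1 - \<alpha>) * marchaud \<alpha> (incr \<phi> x t)
         + H (x /\<^sub>R \<epsilon>) (fst (G (x, t)) + q) \<le> 0)
    \<and> c \<le> H (y /\<^sub>R \<epsilon>) (p0 + q)"
proof -
  define k where "k = 1 / \<epsilon> ^ 3"
  have k: "0 < k" using eps by (simp add: k_def)
  have V0: "0 \<le> V" using V[of 0] by simp
  have usc: "seq_usc_on (space_time T) u"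
    using sub by (simp add: viscosity_subsolution_def usc_on_imp_seq_usc_on)
  have \<phi>c: "continuous_on (space_time T) \<phi>" using tf by (simp add: test_function_def)
  let ?S = "space_time T \<times> (UNIV :: (real ^ 'n) set)"
  define P where "P w = \<phi> (fst w) + \<epsilon> * v (snd w /\<^sub>R \<epsilon>) + k * (norm (fst (fst w) - snd w))\<^sup>2"
    for w :: "((real ^ 'n) \<times> real) \<times> (real ^ 'n)"
  have Pc: "continuous_on ?S P"
    unfolding P_def
    by (intro continuous_intros continuous_on_compose2[OF \<phi>c] continuous_on_compose2[OF vc]) auto
  define b where "b = u (x0, 0) - P ((x0, 0), x0)"
  define D where "D = M + B + \<epsilon> * V - b"
  define r where "r = sqrt (D / \<kappa>)"
  define r' where "r' = sqrt (D / k)"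
  have "\<exists>w\<in>?S. \<forall>w'\<in>?S. u (fst w') - P w' \<le> u (fst w) - P w"
  proof (rule usc_coercive_attains_sup)
    show "closed ?S" by (intro closed_Times closed_space_time closed_UNIV)
    show "((x0, 0), x0) \<in> ?S" using T by simp
    show "seq_usc_on ?S (\<lambda>w. u (fst w) - P w)"
      by (intro seq_usc_on_diff_continuous[OF seq_usc_on_compose[OF usc]] Pc continuous_intros) auto
    fix w assume w: "w \<in> ?S" "u (fst ((x0, 0), x0)) - P ((x0, 0), x0) \<le> u (fst w) - P w"
    have fw: "fst w \<in> space_time T" using w(1) by auto
    have ev: "- (\<epsilon> * V) \<le> \<epsilon> * v (snd w /\<^sub>R \<epsilon>)"
      using mult_left_mono[of "- V" "v (snd w /\<^sub>R \<epsilon>)" \<epsilon>] V[of "snd w /\<^sub>R \<epsilon>"] eps by (simp add: abs_le_iff)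
    have D: "\<kappa> * (norm (fst (fst w) - x0))\<^sup>2 + k * (norm (fst (fst w) - snd w))\<^sup>2 \<le> D"
      using w(2) bd[OF fw] grow[OF fw] ev by (simp add: P_def b_def D_def abs_le_iff)
    have n: "0 \<le> \<kappa> * (norm (fst (fst w) - x0))\<^sup>2" "0 \<le> k * (norm (fst (fst w) - snd w))\<^sup>2" using \<kappa> k by simp_all
    have "\<kappa> * (norm (fst (fst w) - x0))\<^sup>2 \<le> D" using D n by linarith
    then have "(norm (fst (fst w) - x0))\<^sup>2 \<le> D / \<kappa>" using \<kappa> by (simp add: field_simps)
    then have n1: "norm (fst (fst w) - x0) \<le> r" unfolding r_def by (rule real_le_rsqrt)
    have "k * (norm (fst (fst w) - snd w))\<^sup>2 \<le> D" using D n by linarith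
    then have "(norm (fst (fst w) - snd w))\<^sup>2 \<le> D / k" using k by (simp add: field_simps)
    then have n2: "norm (fst (fst w) - snd w) \<le> r'" unfolding r'_def by (rule real_le_rsqrt)
    have "norm w \<le> norm (fst w) + norm (snd w)" by (metis norm_Pair_le prod.collapse)
    moreover have "norm (fst w) \<le> norm (fst (fst w)) + norm (snd (fst w))" by (metis norm_Pair_le prod.collapse)
    moreover have "norm (snd (fst w)) \<le> T" using fw by (simp add: snd_space_time)
    ultimately have s1: "norm w \<le> norm (fst (fst w)) + T + norm (snd w)" by linarith
    have s2: "norm (fst (fst w)) \<le> norm x0 + norm (fst (fst w) - x0)"
      using norm_triangle_ineq[of x0 "fst (fst w) - x0"] by simp
    have s3: "norm (snd w) \<le> norm (fst (fst w)) + norm (fst (fst w) - snd w)"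
      using norm_triangle_ineq4[of "fst (fst w)" "fst (fst w) - snd w"] by simp
    have "a \<le> 2 * (x + r) + T + r'" if "a \<le> c + T + d" "c \<le> x + e" "d \<le> c + f" "e \<le> r" "f \<le> r'"
      for a c d e f x :: real using that by argo
    from this[OF s1 s2 s3 n1 n2] show "norm w \<le> 2 * (norm x0 + r) + T + r'" .
  qed
  then obtain w where w: "w \<in> ?S" "\<And>w'. w' \<in> ?S \<Longrightarrow> u (fst w') - P w' \<le> u (fst w) - P w" by blast
  obtain x t y where we: "w = ((x, t), y)" by (metis surj_pair)
  have xt: "(x, t) \<in> space_time T" using w(1) by (simp add: we)
  have mx: "u z - \<phi> z - \<epsilon> * v (y' /\<^sub>R \<epsilon>) - k * (norm (fst z - y'))\<^sup>2
      \<le> u (x, t) - \<phi> (x, t) - \<epsilon> * v (y /\<^sub>R \<epsilon>) - k * (norm (x - y))\<^sup>2" if "z \<in> space_time T" for z y'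
    using w(2)[of "(z, y')"] that by (simp add: P_def we diff_diff_eq add.assoc)
  define q where "q = (2 * k) *\<^sub>R (x - y)"
  have eV: "\<bar>\<epsilon> * v a\<bar> \<le> \<epsilon> * V" for a using V[of a] eps by (simp add: abs_mult)
  have i: "u z - \<phi> z - 2 * \<epsilon> * V \<le> u (x, t) - \<phi> (x, t)" if "z \<in> space_time T" for z
  proof -
    have "0 \<le> k * (norm (x - y))\<^sup>2" using k by simp
    then show ?thesis using mx[OF that, of "fst z"] eV[of "fst z /\<^sub>R \<epsilon>"] eV[of "y /\<^sub>R \<epsilon>"]
      unfolding diff_self norm_zero by simp
  qed
  have ii: "norm (x /\<^sub>R \<epsilon> - y /\<^sub>R \<epsilon>) \<le> sqrt (2 * V) * \<epsilon>"
  proof -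
    have "k * (norm (x - y))\<^sup>2 \<le> 2 * (\<epsilon> * V)"
      using mx[OF xt, of x] eV[of "x /\<^sub>R \<epsilon>"] eV[of "y /\<^sub>R \<epsilon>"] by simp
    then have "(norm (x - y))\<^sup>2 \<le> 2 * (\<epsilon> * V) * \<epsilon> ^ 3" using eps by (simp add: k_def field_simps)
    also have "\<dots> = (sqrt (2 * V) * \<epsilon>\<^sup>2)\<^sup>2" using V0 by (simp add: power_mult_distrib eval_nat_numeral)
    finally have "norm (x - y) \<le> sqrt (2 * V) * \<epsilon>\<^sup>2" by (rule power2_le_imp_le) (use V0 in simp)
    moreover have "norm (x /\<^sub>R \<epsilon> - y /\<^sub>R \<epsilon>) = norm (x - y) / \<epsilon>"
      using eps by (simp flip: scaleR_diff_right add: divide_inverse_commute)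
    ultimately show ?thesis using eps by (simp add: divide_le_eq power2_eq_square mult.assoc)
  qed
  have iii: "\<alpha> / Gamma (1 - \<alpha>) * marchaud \<alpha> (incr \<phi> x t)
         + H (x /\<^sub>R \<epsilon>) (fst (G (x, t)) + q) \<le> 0" if t: "0 < t"
  proof -
    have tT: "t \<le> T" using xt by simp
    have tf2: "test_function T (\<lambda>z. \<phi> z + k * (norm (fst z - y))\<^sup>2) (\<lambda>z. G z + k *\<^sub>R (2 *\<^sub>R (fst z - y), 0))"
      by (intro test_function_add tf test_function_cmult test_function_space C1_square_distance)
    have m: "u z - (\<phi> z + k * (norm (fst z - y))\<^sup>2) \<le> u (x, t) - (\<phi> (x, t) + k * (norm (fst (x, t) - y))\<^sup>2)"
      if "z \<in> space_time T" for z using mx[OF that, of y] by simp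
    from subsolution_test[OF alpha sub tf2 t tT m] show ?thesis by (simp add: q_def mult.commute)
  qed
  have iv: "c \<le> H (y /\<^sub>R \<epsilon>) (p0 + q)"
  proof -
    define k' where "k' = - (k * \<epsilon>)"
    have "c \<le> H (y /\<^sub>R \<epsilon>) (p0 + k' *\<^sub>R (2 *\<^sub>R (y /\<^sub>R \<epsilon> - x /\<^sub>R \<epsilon>)))"
    proof (rule sup[OF has_C1_gradient_on_cmult[OF C1_square_distance]])
      fix z
      have e1: "k * (norm (x - \<epsilon> *\<^sub>R a))\<^sup>2 = \<epsilon> * (- k' * (norm (a - x /\<^sub>R \<epsilon>))\<^sup>2)" for a
      proof -
        have "x - \<epsilon> *\<^sub>R a = - (\<epsilon> *\<^sub>R (a - x /\<^sub>R \<epsilon>))" using eps by (simp add: scaleR_diff_right)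
        then have "norm (x - \<epsilon> *\<^sub>R a) = \<epsilon> * norm (a - x /\<^sub>R \<epsilon>)" using eps by (simp only: norm_minus_cancel norm_scaleR abs_of_pos)
        then show ?thesis by (simp add: k'_def power2_eq_square)
      qed
      have "\<epsilon> * v (y /\<^sub>R \<epsilon>) + k * (norm (x - y))\<^sup>2 \<le> \<epsilon> * v z + k * (norm (x - \<epsilon> *\<^sub>R z))\<^sup>2"
        using mx[OF xt, of "\<epsilon> *\<^sub>R z"] eps by simp
      moreover have "k * (norm (x - y))\<^sup>2 = \<epsilon> * (- k' * (norm (y /\<^sub>R \<epsilon> - x /\<^sub>R \<epsilon>))\<^sup>2)"
        using e1[of "y /\<^sub>R \<epsilon>"] eps by simp
      ultimately have "\<epsilon> * (v (y /\<^sub>R \<epsilon>) - k' * (norm (y /\<^sub>R \<epsilon> - x /\<^sub>R \<epsilon>))\<^sup>2)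
          \<le> \<epsilon> * (v z - k' * (norm (z - x /\<^sub>R \<epsilon>))\<^sup>2)"
        using e1[of z] by (simp add: right_diff_distrib)
      then show "v (y /\<^sub>R \<epsilon>) - k' * (norm (y /\<^sub>R \<epsilon> - x /\<^sub>R \<epsilon>))\<^sup>2 \<le> v z - k' * (norm (z - x /\<^sub>R \<epsilon>))\<^sup>2"
        using eps by simp
    qed
    moreover have "k' *\<^sub>R (2 *\<^sub>R (y /\<^sub>R \<epsilon> - x /\<^sub>R \<epsilon>)) = q"
    proof -
      have "y /\<^sub>R \<epsilon> - x /\<^sub>R \<epsilon> = inverse \<epsilon> *\<^sub>R (y - x)" by (simp add: scaleR_diff_right)
      then have "k' *\<^sub>R (2 *\<^sub>R (y /\<^sub>R \<epsilon> - x /\<^sub>R \<epsilon>)) = (k' * 2 * inverse \<epsilon>) *\<^sub>R (y - x)"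
        by (simp only: scaleR_scaleR mult.assoc)
      also have "k' * 2 * inverse \<epsilon> = - (2 * k)" using eps by (simp add: k'_def)
      also have "(- (2 * k)) *\<^sub>R (y - x) = q" by (simp add: q_def scaleR_diff_right)
      finally show ?thesis .
    qed
    ultimately show ?thesis by simp
  qed
  show ?thesis using xt i ii iii iv by blast
qed

text \<open>
  The maximum is first made strict by adding \<open>\<kappa> * (norm (z - (x0, t0)))\<^sup>2\<close> to \<open>\<phi>\<close>; the Marchaud
  derivative is linear, so \<open>\<kappa>\<close> is removed at the end. Along a sequence realising the relaxed limit, the
  maxima of the doubled functions converge to \<open>(x0, t0)\<close>. The vectors \<open>q\<close> remain bounded: if \<open>H\<close> tends to
  \<open>\<infinity>\<close>, by the inequality for \<open>u\<close>, and if \<open>H\<close> tends to \<open>-\<infinity>\<close>, by that for the corrector. The second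
  alternative arises for supersolutions after the change of sign. Uniform continuity of \<open>H\<close> then lets
  the two inequalities be combined in the limit.
\<close>
lemma perturbed_test_function:
  fixes H :: "real ^ 'n \<Rightarrow> real ^ 'n \<Rightarrow> real" and u :: "real \<Rightarrow> (real ^ 'n) \<times> real \<Rightarrow> real"
    and \<phi> :: "(real ^ 'n) \<times> real \<Rightarrow> real" and v :: "real ^ 'n \<Rightarrow> real"
  assumes alpha: "0 < \<alpha>" "\<alpha> < 1" and T: "0 < T"
    and Hc: "continuous_on UNIV (\<lambda>(y, p). H y p)" and per: "\<And>p. integer_periodic (\<lambda>y. H y p)"
    and coer: "coercive H \<or> anticoercive H"
    and sub: "\<And>\<epsilon>. 0 < \<epsilon> \<Longrightarrow> viscosity_subsolution T \<alpha> (\<lambda>x p. H (x /\<^sub>R \<epsilon>) p) u0 (u \<epsilon>)"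
    and bd: "\<And>\<epsilon> z. 0 < \<epsilon> \<Longrightarrow> z \<in> space_time T \<Longrightarrow> \<bar>u \<epsilon> z\<bar> \<le> M"
    and tf: "test_function T \<phi> G" and t0: "0 < t0" "t0 \<le> T"
    and mx: "\<And>z. z \<in> space_time T \<Longrightarrow> relaxed_limsup (space_time T) u z - \<phi> z
       \<le> relaxed_limsup (space_time T) u (x0, t0) - \<phi> (x0, t0)"
    and vc: "continuous_on UNIV v" "integer_periodic v"
    and sup: "\<And>\<psi> D y. has_C1_gradient_on \<psi> D UNIV \<Longrightarrow> (\<And>z. v z - \<psi> z \<ge> v y - \<psi> y) \<Longrightarrow>
       c \<le> H y (fst (G (x0, t0)) + D y)"
  shows "\<alpha> / Gamma (1 - \<alpha>) * marchaud \<alpha> (incr \<phi> x0 t0) + c \<le> 0"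
proof -
  let ?c = "\<alpha> / Gamma (1 - \<alpha>)" and ?z0 = "(x0, t0)" and ?p0 = "fst (G (x0, t0))"
  define us where "us = relaxed_limsup (space_time T) u"
  define c0 where "c0 = us ?z0 - \<phi> ?z0"
  have z0: "?z0 \<in> space_time T" using t0 by simp
  have usM: "\<bar>us z\<bar> \<le> M" if "z \<in> space_time T" for z
    unfolding us_def by (rule relaxed_limsup_abs_le[where u = u and S = "space_time T" and M = M, OF bd that])
  have mx': "us z - \<phi> z \<le> c0" if "z \<in> space_time T" for z using mx[OF that] by (simp add: us_def c0_def)
  obtain V where V: "\<And>y. \<bar>v y\<bar> \<le> V" using periodic_continuous_bounded[OF vc] by blast
  have V0: "0 \<le> V" using V[of 0] by simp
  define sq where "sq z = (norm (fst z - x0))\<^sup>2 + (snd z - t0)\<^sup>2" for z :: "(real ^ 'n) \<times> real"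
  define Gsq where "Gsq z = (2 *\<^sub>R (fst z - x0), 0) + (0 :: real ^ 'n, 2 * (snd z - t0))" for z
  have tsq: "test_function T sq Gsq"
    unfolding sq_def Gsq_def
    by (intro test_function_add test_function_space C1_square_distance test_function_time)
       (auto intro!: continuous_intros derivative_eq_intros)
  have sqn: "sq z = (norm (z - ?z0))\<^sup>2" for z by (simp add: sq_def norm_prod_def minus_prod_def)
  have step: "?c * marchaud \<alpha> (incr \<phi> x0 t0) + \<kappa> * (?c * marchaud \<alpha> (incr sq x0 t0)) + c \<le> 0"
    if \<kappa>: "0 < \<kappa>" for \<kappa>
  proof -
    define \<eta> where "\<eta> z = \<phi> z + \<kappa> * sq z" for z
    define G' where "G' z = G z + \<kappa> *\<^sub>R Gsq z" for z
    have t\<eta>: "test_function T \<eta> G'" unfolding \<eta>_def G'_def by (intro test_function_add tf test_function_cmult tsq)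
    have \<eta>c: "continuous_on (space_time T) \<eta>" using t\<eta> by (simp add: test_function_def)
    have grow: "\<kappa> * (norm (fst z - x0))\<^sup>2 - (M + c0) \<le> \<eta> z" if "z \<in> space_time T" for z
    proof -
      have "0 \<le> \<kappa> * (snd z - t0)\<^sup>2" using \<kappa> by simp
      then show ?thesis using mx'[OF that] usM[OF that] by (simp add: \<eta>_def sq_def distrib_left)
    qed
    obtain E X where EX: "\<And>n. 0 < E n" "\<And>n. E n < 1 / real (Suc n)" "\<And>n. X n \<in> space_time T"
      "\<And>n. dist (X n) ?z0 < 1 / real (Suc n)" "\<And>n. us ?z0 - 1 / real (Suc n) < u (E n) (X n)"
      using relaxed_limsup_sequence[where u = u and S = "space_time T" and M = M, OF bd z0] unfolding us_def by blast
    have inv0: "(\<lambda>n. 1 / real (Suc n)) \<longlonglongrightarrow> 0" using LIMSEQ_inverse_real_of_nat by (simp add: inverse_eq_divide)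
    have E0: "E \<longlonglongrightarrow> 0"
      by (rule tendsto_sandwich[OF _ _ tendsto_const inv0])
         (use EX(1,2) in \<open>auto intro!: always_eventually less_imp_le simp del: of_nat_Suc\<close>)
    have X0: "X \<longlonglongrightarrow> ?z0"
    proof (rule metric_tendsto_imp_tendsto[OF inv0])
      show "\<forall>\<^sub>F n in sequentially. dist (X n) ?z0 \<le> dist (1 / real (Suc n)) 0"
        using EX(4) by (intro always_eventually allI) (simp add: less_imp_le dist_real_def del: of_nat_Suc)
    qed
    have "\<exists>x t y q. (x, t) \<in> space_time T
      \<and> (\<forall>z\<in>space_time T. u (E n) z - \<eta> z - 2 * E n * V \<le> u (E n) (x, t) - \<eta> (x, t))
      \<and> norm (x /\<^sub>R E n - y /\<^sub>R E n) \<le> sqrt (2 * V) * E n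
      \<and> (0 < t \<longrightarrow> ?c * marchaud \<alpha> (incr \<eta> x t) + H (x /\<^sub>R E n) (fst (G' (x, t)) + q) \<le> 0)
      \<and> c \<le> H (y /\<^sub>R E n) (?p0 + q)" for n
      by (rule doubled_corrector_maximum[where H = H and u = "u (E n)" and \<epsilon> = "E n",
          OF alpha T EX(1) sub[OF EX(1)] bd[OF EX(1)] t\<eta> \<kappa> grow vc(1) V])
         (assumption, assumption, erule sup, blast)
    then obtain x t y q where xt: "\<And>n. (x n, t n) \<in> space_time T"
      and m: "\<And>n z. z \<in> space_time T \<Longrightarrow> u (E n) z - \<eta> z - 2 * E n * V \<le> u (E n) (x n, t n) - \<eta> (x n, t n)"
      and xy: "\<And>n. norm (x n /\<^sub>R E n - y n /\<^sub>R E n) \<le> sqrt (2 * V) * E n"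
      and eq: "\<And>n. 0 < t n \<Longrightarrow> ?c * marchaud \<alpha> (incr \<eta> (x n) (t n)) + H (x n /\<^sub>R E n) (fst (G' (x n, t n)) + q n) \<le> 0"
      and cq: "\<And>n. c \<le> H (y n /\<^sub>R E n) (?p0 + q n)" by metis
    define b where "b n = us ?z0 - 1 / real (Suc n) - \<eta> (X n) - 2 * E n * V" for n
    have bm: "b n \<le> u (E n) (x n, t n) - \<eta> (x n, t n)" for n
      using m[OF EX(3), of n n] EX(5)[of n] by (simp add: b_def)
    have "(\<lambda>n. \<eta> (X n)) \<longlonglongrightarrow> \<eta> ?z0"
      by (rule continuous_on_tendsto_compose[OF \<eta>c X0 z0]) (use EX(3) in auto)
    then have "b \<longlonglongrightarrow> us ?z0 - 0 - \<eta> ?z0 - 2 * 0 * V"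
      unfolding b_def by (intro tendsto_intros inv0 E0)
    then have bl: "b \<longlonglongrightarrow> c0" by (simp add: c0_def \<eta>_def sq_def)
    then have "Bseq b" by (rule convergent_imp_Bseq[OF convergentI])
    then obtain K where K: "\<And>n. \<bar>b n\<bar> \<le> K" unfolding Bseq_def by auto
    have nK: "norm ((x n, t n) - ?z0) \<le> sqrt ((2 * M + c0 + K) / \<kappa>)" for n
    proof (rule real_le_rsqrt)
      have "\<kappa> * sq (x n, t n) \<le> 2 * M + c0 + K"
        using bm[of n] K[of n] mx'[OF xt] usM[OF xt] bd[OF EX(1) xt, of n n] 
        by (simp add: \<eta>_def abs_le_iff) (smt (verit))
      then show "(norm ((x n, t n) - ?z0))\<^sup>2 \<le> (2 * M + c0 + K) / \<kappa>"
        using \<kappa> unfolding sqn[symmetric] by (simp add: field_simps)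
    qed
    have inK: "(x n, t n) \<in> space_time T \<inter> cball ?z0 (sqrt ((2 * M + c0 + K) / \<kappa>))" for n
      unfolding Int_iff mem_cball dist_norm norm_minus_commute[of ?z0] by (intro conjI xt nK)
    have "compact (space_time T \<inter> cball ?z0 (sqrt ((2 * M + c0 + K) / \<kappa>)) :: ((real ^ 'n) \<times> real) set)"
      by (intro closed_Int_compact closed_space_time compact_cball)
    from this[unfolded compact_def, rule_format, of "\<lambda>n. (x n, t n)"] inK
    obtain z r where z: "z \<in> space_time T" and r: "strict_mono (r :: nat \<Rightarrow> nat)"
      and lim: "((\<lambda>n. (x n, t n)) \<circ> r) \<longlonglongrightarrow> z" by blast
    have lim: "(\<lambda>n. (x (r n), t (r n))) \<longlonglongrightarrow> z" using lim by (simp add: o_def)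
    have Er: "(\<lambda>n. E (r n)) \<longlonglongrightarrow> 0" using LIMSEQ_subseq_LIMSEQ[OF E0 r] by (simp add: o_def)
    have br: "(\<lambda>n. b (r n)) \<longlonglongrightarrow> c0" using LIMSEQ_subseq_LIMSEQ[OF bl r] by (simp add: o_def)
    have \<eta>r: "(\<lambda>n. \<eta> (x (r n), t (r n))) \<longlonglongrightarrow> \<eta> z"
      by (rule continuous_on_tendsto_compose[OF \<eta>c lim z]) (use xt in auto)
    \<comment> \<open>The cluster point \<open>z\<close> is a maximum point of \<open>us - \<eta>\<close>, hence equal to \<open>?z0\<close> by strictness.\<close>
    have "c0 + \<eta> z \<le> us z"
    proof (rule dense_ge)
      fix a assume "us z < a"
      then obtain d where d: "d > 0" "bounded_near (space_time T) u z d a"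
        using relaxed_limsup_upper[where u = u and S = "space_time T" and M = M, OF bd z] unfolding us_def by blast
      have "\<forall>\<^sub>F n in sequentially. b (r n) + \<eta> (x (r n), t (r n)) \<le> a"
        using order_tendstoD(2)[OF Er d(1)] tendstoD[OF lim d(1)]
      proof eventually_elim
        case (elim n)
        have "u (E (r n)) (x (r n), t (r n)) \<le> a" using elim d(2) EX(1) xt by blast
        then show ?case using bm[of "r n"] by simp
      qed
      then show "c0 + \<eta> z \<le> a" by (rule tendsto_upperbound[OF tendsto_add[OF br \<eta>r]]) simp
    qed
    then have "\<kappa> * sq z \<le> 0" using mx'[OF z] by (simp add: \<eta>_def)
    then have "sq z \<le> 0" using \<kappa> by (simp add: mult_le_0_iff)
    then have "z = ?z0" unfolding sqn by simp
    then have lim0: "(\<lambda>n. (x (r n), t (r n))) \<longlonglongrightarrow> ?z0" using lim by simp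
    have "(\<lambda>n. t (r n)) \<longlonglongrightarrow> t0" using tendsto_snd[OF lim0] by simp
    from order_tendstoD(1)[OF this t0(1)] obtain N where N: "\<And>n. N \<le> n \<Longrightarrow> 0 < t (r n)"
      by (auto simp: eventually_sequentially)
    define s where "s n = r (n + N)" for n
    have ts: "0 < t (s n)" for n using N by (simp add: s_def)
    have lims: "(\<lambda>n. (x (s n), t (s n))) \<longlonglongrightarrow> ?z0"
      unfolding s_def using lim0 by (rule LIMSEQ_ignore_initial_segment)
    have Es: "(\<lambda>n. E (s n)) \<longlonglongrightarrow> 0" unfolding s_def using Er by (rule LIMSEQ_ignore_initial_segment)
    define I where "I n = marchaud \<alpha> (incr \<eta> (x (s n)) (t (s n)))" for n
    define I0 where "I0 = marchaud \<alpha> (incr \<eta> x0 t0)"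
    have Il: "I \<longlonglongrightarrow> I0"
      unfolding I_def I0_def
      using marchaud_test_tendsto[OF alpha t\<eta> t0 _ lims] xt by simp
    have G'c: "continuous_on (UNIV \<times> {0<..T}) G'"
      using t\<eta> by (simp add: test_function_def has_C1_gradient_on_def)
    have "(\<lambda>n. G' (x (s n), t (s n))) \<longlonglongrightarrow> G' ?z0"
    proof (rule continuous_on_tendsto_compose[OF G'c lims])
      have "(x (s n), t (s n)) \<in> UNIV \<times> {0<..T}" for n using ts[of n] xt[of "s n"] by simp
      then show "\<forall>\<^sub>F n in sequentially. (x (s n), t (s n)) \<in> UNIV \<times> {0<..T}" by simp
    qed (use t0 in simp)
    moreover have "fst (G' ?z0) = ?p0" by (simp add: G'_def Gsq_def)
    ultimately have Gl: "(\<lambda>n. fst (G' (x (s n), t (s n)))) \<longlonglongrightarrow> ?p0"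
      using tendsto_fst[of "\<lambda>n. G' (x (s n), t (s n))" "G' ?z0"] by simp
    define g where "g n = fst (G' (x (s n), t (s n)))" for n
    have gl: "g \<longlonglongrightarrow> ?p0" using Gl by (simp add: g_def[abs_def])
    have eqs: "?c * I n + H (x (s n) /\<^sub>R E (s n)) (g n + q (s n)) \<le> 0" for n
      unfolding I_def g_def by (rule eq[OF ts])
    have "Bseq (\<lambda>n. g n - ?p0)" by (rule convergent_imp_Bseq[OF convergentI[OF tendsto_diff[OF gl tendsto_const]]])
    then obtain Kg where Kg: "\<And>n. norm (g n - ?p0) \<le> Kg" unfolding Bseq_def by auto
    have "\<exists>R. \<forall>n. norm (g n + q (s n)) \<le> R \<and> norm (?p0 + q (s n)) \<le> R"
    proof -
      have tri: "norm (g n + q (s n)) \<le> norm (?p0 + q (s n)) + Kg" "norm (?p0 + q (s n)) \<le> norm (g n + q (s n)) + Kg" for n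
        using norm_triangle_ineq[of "?p0 + q (s n)" "g n - ?p0"] norm_triangle_ineq4[of "g n + q (s n)" "g n - ?p0"] Kg[of n]
        by (simp_all add: algebra_simps)
      have Kg0: "0 \<le> Kg" using Kg[of 0] norm_ge_zero order_trans by blast
      from coer show ?thesis
      proof
        assume co: "coercive H"
        have "Bseq (\<lambda>n. ?c * I n)" by (rule convergent_imp_Bseq[OF convergentI[OF tendsto_mult[OF tendsto_const Il]]])
        then obtain KI where KI: "\<And>n. \<bar>?c * I n\<bar> \<le> KI" unfolding Bseq_def real_norm_def by blast
        obtain R where R: "\<And>y p. H y p \<le> KI \<Longrightarrow> norm p \<le> R" using co by meson
        have "norm (g n + q (s n)) \<le> R" for n
          by (rule R[of "x (s n) /\<^sub>R E (s n)"]) (use eqs[of n] KI[of n] in linarith)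
        then have "norm (g n + q (s n)) \<le> R + Kg \<and> norm (?p0 + q (s n)) \<le> R + Kg" for n
          using tri[of n] Kg0 by (smt (verit))
        then show ?thesis by blast
      next
        assume co: "anticoercive H"
        obtain R where R: "\<And>y p. c \<le> H y p \<Longrightarrow> norm p \<le> R" using co by meson
        have "norm (?p0 + q (s n)) \<le> R" for n by (rule R[OF cq])
        then have "norm (g n + q (s n)) \<le> R + Kg \<and> norm (?p0 + q (s n)) \<le> R + Kg" for n
          using tri[of n] Kg0 by (smt (verit))
        then show ?thesis by blast
      qed
    qed
    then obtain R where R: "\<And>n. norm (g n + q (s n)) \<le> R" "\<And>n. norm (?p0 + q (s n)) \<le> R" by blast
    have "?c * I0 + c \<le> 0"
    proof (rule field_le_epsilon)
      fix e :: real assume e: "0 < e"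
      obtain d where d: "0 < d" "\<And>x y P Q. norm P \<le> R \<Longrightarrow> norm Q \<le> R \<Longrightarrow> norm (x - y) < d \<Longrightarrow> norm (P - Q) < d \<Longrightarrow>
          \<bar>H x P - H y Q\<bar> < e" using periodic_uniform_continuity[OF Hc per e, of R] by blast
      have "(\<lambda>n. sqrt (2 * V) * E (s n)) \<longlonglongrightarrow> sqrt (2 * V) * 0" by (intro tendsto_intros Es)
      then have "\<forall>\<^sub>F n in sequentially. sqrt (2 * V) * E (s n) < d" using d(1) by (intro order_tendstoD) simp_all
      then have "\<forall>\<^sub>F n in sequentially. ?c * I n + c \<le> e"
        using tendstoD[OF gl d(1)]
      proof eventually_elim
        case (elim n)
        have "norm (x (s n) /\<^sub>R E (s n) - y (s n) /\<^sub>R E (s n)) < d" using xy[of "s n"] elim(1) by linarith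
        moreover have "norm ((g n + q (s n)) - (?p0 + q (s n))) < d" using elim(2) by (simp add: dist_norm)
        ultimately have "\<bar>H (x (s n) /\<^sub>R E (s n)) (g n + q (s n)) - H (y (s n) /\<^sub>R E (s n)) (?p0 + q (s n))\<bar> < e"
          by (intro d(2) R)
        then show ?case using eqs[of n] cq[of "s n"] by linarith
      qed
      then have "?c * I0 + c \<le> e"
        by (rule tendsto_upperbound[OF tendsto_add[OF tendsto_mult[OF tendsto_const Il] tendsto_const]]) simp
      then show "?c * I0 + c \<le> 0 + e" by simp
    qed
    moreover have "I0 = marchaud \<alpha> (incr \<phi> x0 t0) + \<kappa> * marchaud \<alpha> (incr sq x0 t0)"
    proof -
      obtain B1 where B1: "small_incr B1 (incr \<phi> x0 t0)"
        using test_function_small_incr[OF tf t0, of x0] t0 by (metis abs_zero diff_self dist_self less_imp_le)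
      obtain B2 where B2: "small_incr B2 (incr sq x0 t0)"
        using test_function_small_incr[OF tsq t0, of x0] t0 by (metis abs_zero diff_self dist_self less_imp_le)
      have "I0 = marchaud \<alpha> (\<lambda>\<tau>. (\<phi> (x0, t0) - \<phi> (x0, lag t0 \<tau>)) + \<kappa> * (sq (x0, t0) - sq (x0, lag t0 \<tau>)))"
        unfolding I0_def \<eta>_def by (rule marchaud_cong) (simp add: algebra_simps)
      then show ?thesis
        unfolding marchaud_add[OF alpha B1 small_incr_cmult[OF B2]] marchaud_cmult .
    qed
    ultimately show ?thesis by (simp add: algebra_simps)
  qed
  let ?A = "?c * marchaud \<alpha> (incr \<phi> x0 t0)"
    and ?B = "?c * marchaud \<alpha> (incr sq x0 t0)"
  have "((\<lambda>\<kappa>. ?A + \<kappa> * ?B + c) \<longlongrightarrow> ?A + 0 * ?B + c) (at_right 0)"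
    by (intro tendsto_intros)
  then have "?A + 0 * ?B + c \<le> 0"
    by (rule tendsto_upperbound) (use step in \<open>auto simp: eventually_at_right_less eventually_at_filter\<close>)
  then show ?thesis by simp
qed

section \<open>Homogenization\<close>

lemma coercive_Hamiltonian:
  fixes H :: "'a \<Rightarrow> 'b::real_normed_vector \<Rightarrow> real"
  assumes "((\<lambda>r. INF (y, p) \<in> UNIV \<times> {p. norm p \<ge> r}. ereal (H y p)) \<longlongrightarrow> \<infinity>) at_top"
  shows "\<exists>R. \<forall>y p. H y p \<le> c \<longrightarrow> norm p \<le> R"
proof -
  have "\<forall>\<^sub>F r in at_top. ereal c < (INF (y, p) \<in> UNIV \<times> {p. norm p \<ge> r}. ereal (H y p))"
    using assms unfolding tendsto_PInfty by blast
  then obtain r where r: "ereal c < (INF (y, p) \<in> UNIV \<times> {p. norm p \<ge> r}. ereal (H y p))"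
    by (auto simp: eventually_at_top_linorder)
  have "norm p \<le> r" if "H y p \<le> c" for y p
  proof (rule ccontr)
    assume "\<not> norm p \<le> r"
    then have "(INF (y, p) \<in> UNIV \<times> {p. norm p \<ge> r}. ereal (H y p)) \<le> ereal (H y p)"
      by (intro INF_lower2[of "(y, p)"]) auto
    then have "ereal c < ereal (H y p)" using r by (rule less_le_trans[rotated])
    then show False using that by simp
  qed
  then show ?thesis by blast
qed

lemma periodic_Hamiltonian_bounded:
  fixes H :: "real ^ 'n \<Rightarrow> real ^ 'n \<Rightarrow> real"
  assumes Hc: "continuous_on UNIV (\<lambda>(y, p). H y p)" and per: "\<And>p. integer_periodic (\<lambda>y. H y p)"
  shows "\<exists>B. \<forall>y p. norm p \<le> L \<longrightarrow> \<bar>H y p\<bar> \<le> B"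
proof -
  let ?K = "cball (0 :: real ^ 'n) (real CARD('n)) \<times> cball (0 :: real ^ 'n) L"
  have "bounded ((\<lambda>(y, p). H y p) ` ?K)"
    by (intro compact_imp_bounded compact_continuous_image continuous_on_subset[OF Hc] compact_Times) auto
  then obtain B where B: "\<And>z. z \<in> ?K \<Longrightarrow> \<bar>(\<lambda>(y, p). H y p) z\<bar> \<le> B" unfolding bounded_iff real_norm_def by blast
  have "\<bar>H y p\<bar> \<le> B" if p: "norm p \<le> L" for y p
  proof -
    obtain k where k: "\<forall>i. k $ i \<in> \<int>" "norm (y + k) \<le> real CARD('n)" using exists_integer_translate by blast
    have "(y + k, p) \<in> ?K" unfolding mem_Times_iff fst_conv snd_conv mem_cball_0 using k(2) p by simp
    from B[OF this] show ?thesis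
      using integer_periodicD[where f = "\<lambda>y. H y p", OF per k(1), of y] by simp
  qed
  then show ?thesis by blast
qed

lemma supersolution_cong:
  assumes "viscosity_supersolution T \<alpha> F u0 u" "0 \<le> T" and eq: "\<And>z. z \<in> space_time T \<Longrightarrow> u z = w z"
  shows "viscosity_supersolution T \<alpha> F u0 w"
  unfolding viscosity_supersolution_def
proof (intro conjI allI impI)
  have "{z \<in> space_time T. c < w z} = {z \<in> space_time T. c < u z}" for c using eq by auto
  then show "lsc_on (space_time T) w"
    using assms(1) by (simp add: viscosity_supersolution_def lsc_on_def)
  show "u0 x \<le> w (x, 0)" for x
    using assms(1,2) eq[of "(x, 0)"] unfolding viscosity_supersolution_def by (metis mem_space_time order_refl)
  fix \<phi> G x t
  assume a: "test_function T \<phi> G \<and> t \<in> {0<..T} \<and> (\<forall>z\<in>space_time T. w (x, t) - \<phi> (x, t) \<le> w z - \<phi> z)"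
  then have "u (x, t) = w (x, t)" by (intro eq) simp
  then have "\<forall>z\<in>space_time T. u (x, t) - \<phi> (x, t) \<le> u z - \<phi> z" using a eq by simp
  then show "0 \<le> J_op \<alpha> \<phi> x t + K_op \<alpha> 0 t \<phi> x t + F x (fst (G (x, t)))"
    using assms(1) a unfolding viscosity_supersolution_def by blast
qed

text \<open>
  The perturbed test function argument gives the viscosity inequality; the barriers are continuous and
  uniform in \<open>\<epsilon>\<close>, so they survive the relaxed limit and yield the initial condition.
\<close>
lemma relaxed_limsup_subsolution:
  fixes H :: "real ^ 'n \<Rightarrow> real ^ 'n \<Rightarrow> real" and u :: "real \<Rightarrow> (real ^ 'n) \<times> real \<Rightarrow> real"
  assumes alpha: "0 < \<alpha>" "\<alpha> < 1" and T: "0 < T"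
    and Hc: "continuous_on UNIV (\<lambda>(y, p). H y p)" and per: "\<And>p. integer_periodic (\<lambda>y. H y p)"
    and coer: "coercive H \<or> anticoercive H"
    and sub: "\<And>\<epsilon>. 0 < \<epsilon> \<Longrightarrow> viscosity_subsolution T \<alpha> (\<lambda>x p. H (x /\<^sub>R \<epsilon>) p) u0 (u \<epsilon>)"
    and bd: "\<And>\<epsilon> z. 0 < \<epsilon> \<Longrightarrow> z \<in> space_time T \<Longrightarrow> \<bar>u \<epsilon> z\<bar> \<le> M"
    and u0: "continuous_on UNIV u0"
    and barrier: "\<And>\<epsilon> x t. 0 < \<epsilon> \<Longrightarrow> (x, t) \<in> space_time T \<Longrightarrow> u \<epsilon> (x, t) \<le> u0 x + C * t powr \<alpha>"
    and cell: "\<And>p. \<exists>v. continuous_on UNIV v \<and> integer_periodic v \<and>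
      (\<forall>\<psi> D y. has_C1_gradient_on \<psi> D UNIV \<longrightarrow> (\<forall>z. v z - \<psi> z \<ge> v y - \<psi> y) \<longrightarrow> Hb p \<le> H y (p + D y))"
  shows "viscosity_subsolution T \<alpha> (\<lambda>x p. Hb p) u0 (relaxed_limsup (space_time T) u)"
    and "\<And>x t. (x, t) \<in> space_time T \<Longrightarrow> relaxed_limsup (space_time T) u (x, t) \<le> u0 x + C * t powr \<alpha>"
proof -
  show b: "relaxed_limsup (space_time T) u (x, t) \<le> u0 x + C * t powr \<alpha>" if xt: "(x, t) \<in> space_time T" for x t
  proof -
    have "relaxed_limsup (space_time T) u (x, t) \<le> (\<lambda>z. u0 (fst z) + C * snd z powr \<alpha>) (x, t)"
    proof (rule relaxed_limsup_le_continuous[where M = M, OF bd xt])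
      show "continuous_on (space_time T) (\<lambda>z. u0 (fst z) + C * snd z powr \<alpha>)"
        using alpha by (intro continuous_intros continuous_on_compose2[OF u0] continuous_on_powr')
          (auto simp: snd_space_time)
      show "u \<epsilon> w \<le> u0 (fst w) + C * snd w powr \<alpha>" if "0 < \<epsilon>" "w \<in> space_time T" for \<epsilon> w
        using barrier[OF that(1), of "fst w" "snd w"] that(2) by simp
    qed
    then show ?thesis by simp
  qed
  show "viscosity_subsolution T \<alpha> (\<lambda>x p. Hb p) u0 (relaxed_limsup (space_time T) u)"
    unfolding viscosity_subsolution_def
  proof (intro conjI allI impI)
    show "usc_on (space_time T) (relaxed_limsup (space_time T) u)"
      by (rule relaxed_limsup_usc[where M = M, OF bd])
    show "relaxed_limsup (space_time T) u (x, 0) \<le> u0 x" for x using b[of x 0] T alpha by simp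
    fix \<phi> G x t
    assume a: "test_function T \<phi> G \<and> t \<in> {0<..T} \<and> (\<forall>z\<in>space_time T.
      relaxed_limsup (space_time T) u z - \<phi> z \<le> relaxed_limsup (space_time T) u (x, t) - \<phi> (x, t))"
    then have tf: "test_function T \<phi> G" and t: "0 < t" "t \<le> T" by auto
    obtain v where v: "continuous_on UNIV v" "integer_periodic v"
      "\<And>\<psi> D y. has_C1_gradient_on \<psi> D UNIV \<Longrightarrow> (\<And>z. v z - \<psi> z \<ge> v y - \<psi> y) \<Longrightarrow>
         Hb (fst (G (x, t))) \<le> H y (fst (G (x, t)) + D y)"
      using cell[of "fst (G (x, t))"] by blast
    have "\<alpha> / Gamma (1 - \<alpha>) * marchaud \<alpha> (incr \<phi> x t) + Hb (fst (G (x, t))) \<le> 0"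
      by (rule perturbed_test_function[where H = H and u = u, OF alpha T Hc per coer sub bd tf t _ v(1,2)])
         (assumption, assumption, assumption, use a in blast, erule v(3), blast)
    then show "J_op \<alpha> \<phi> x t + K_op \<alpha> 0 t \<phi> x t + Hb (fst (G (x, t))) \<le> 0"
      by (simp only: caputo_test_function[OF alpha tf t])
  qed
qed

text \<open>
  Equality of the two relaxed limits means that \<open>u \<epsilon> w\<close> is close to \<open>ub z\<close> for small \<open>\<epsilon>\<close> and \<open>w\<close> near
  \<open>z\<close>. Finitely many such neighbourhoods cover a compact set.
\<close>
lemma uniform_limit_on_compact:
  fixes u :: "real \<Rightarrow> 'a::metric_space \<Rightarrow> real"
  assumes C: "compact C" "C \<subseteq> S" and ub: "continuous_on S ub"
    and loc: "\<And>z e. z \<in> S \<Longrightarrow> 0 < e \<Longrightarrow> \<exists>d>0. \<forall>\<epsilon> w. 0 < \<epsilon> \<and> \<epsilon> < d \<and> w \<in> S \<and> dist w z < d \<longrightarrow> \<bar>u \<epsilon> w - ub z\<bar> \<le> e"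
  shows "uniform_limit C u ub (at_right 0)"
  unfolding uniform_limit_iff
proof (intro allI impI)
  fix e :: real assume e: "0 < e"
  have "\<exists>d>0. \<forall>\<epsilon> w. 0 < \<epsilon> \<and> \<epsilon> < d \<and> w \<in> S \<and> dist w z < d \<longrightarrow> dist (u \<epsilon> w) (ub w) < e" if z: "z \<in> S" for z
  proof -
    have e3: "0 < e / 3" using e by simp
    from loc[OF z e3] obtain d where d: "0 < d" "\<And>\<epsilon> w. 0 < \<epsilon> \<Longrightarrow> \<epsilon> < d \<Longrightarrow> w \<in> S \<Longrightarrow> dist w z < d \<Longrightarrow> \<bar>u \<epsilon> w - ub z\<bar> \<le> e / 3"
      by blast
    obtain d' where d': "0 < d'" "\<And>w. w \<in> S \<Longrightarrow> dist w z < d' \<Longrightarrow> dist (ub w) (ub z) < e / 3"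
      using ub z e3 unfolding continuous_on_iff by meson
    have "dist (u \<epsilon> w) (ub w) < e" if "0 < \<epsilon>" "\<epsilon> < min d d'" "w \<in> S" "dist w z < min d d'" for \<epsilon> w
    proof -
      have "\<bar>u \<epsilon> w - ub z\<bar> \<le> e / 3" "\<bar>ub w - ub z\<bar> < e / 3"
        using d(2)[of \<epsilon> w] d'(2)[of w] that by (simp_all add: dist_real_def)
      then show ?thesis using e unfolding dist_real_def by linarith
    qed
    then show ?thesis using d(1) d'(1) by (intro exI[of _ "min d d'"]) auto
  qed
  then obtain \<delta> where \<delta>: "\<And>z. z \<in> S \<Longrightarrow> 0 < \<delta> z"
    "\<And>z \<epsilon> w. z \<in> S \<Longrightarrow> 0 < \<epsilon> \<Longrightarrow> \<epsilon> < \<delta> z \<Longrightarrow> w \<in> S \<Longrightarrow> dist w z < \<delta> z \<Longrightarrow> dist (u \<epsilon> w) (ub w) < e"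
    by metis
  obtain D where D: "D \<subseteq> C" "finite D" "C \<subseteq> (\<Union>z\<in>D. ball z (\<delta> z))"
  proof (rule compactE_image[OF C(1), of C "\<lambda>z. ball z (\<delta> z)"])
    show "C \<subseteq> (\<Union>z\<in>C. ball z (\<delta> z))" using \<delta>(1) C(2) by fastforce
  qed auto
  have "\<forall>\<^sub>F \<epsilon> in at_right 0. \<epsilon> < \<delta> z" if "z \<in> D" for z
  proof -
    have "0 < \<delta> z" using \<delta>(1) that D(1) C(2) by blast
    from eventually_at_right_real[OF this] show ?thesis by (rule eventually_mono) simp
  qed
  then have "\<forall>\<^sub>F \<epsilon> in at_right 0. \<forall>z\<in>D. \<epsilon> < \<delta> z" using D(2) by (simp add: eventually_ball_finite)
  then show "\<forall>\<^sub>F \<epsilon> in at_right 0. \<forall>w\<in>C. dist (u \<epsilon> w) (ub w) < e"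
    using eventually_at_right_less[of "0::real"]
  proof eventually_elim
    case (elim \<epsilon>)
    show ?case
    proof
      fix w assume w: "w \<in> C"
      then obtain z where z: "z \<in> D" "dist z w < \<delta> z" using D(3) by auto
      then show "dist (u \<epsilon> w) (ub w) < e"
        using elim w D(1) C(2) by (intro \<delta>(2)[of z]) (auto simp: dist_commute)
    qed
  qed
qed

lemma BUC_on_from_modulus:
  fixes f :: "(real ^ 'n) \<times> real \<Rightarrow> real"
  assumes alpha: "0 < \<alpha>" and L: "0 \<le> L" and C: "0 \<le> C"
    and bd: "\<And>z. z \<in> S \<Longrightarrow> \<bar>f z\<bar> \<le> M"
    and mod: "\<And>x t y s. (x, t) \<in> S \<Longrightarrow> (y, s) \<in> S \<Longrightarrow> f (x, t) - f (y, s) \<le> L * norm (x - y) + C * \<bar>t - s\<bar> powr \<alpha>"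
  shows "BUC_on S f"
  unfolding BUC_on_def uniformly_continuous_on_def
proof (intro conjI allI impI)
  show "bounded (f ` S)" unfolding bounded_iff real_norm_def using bd by blast
  fix e :: real assume e: "0 < e"
  have "continuous_on {0..} (\<lambda>r. L * r + C * r powr \<alpha>)"
    using alpha by (intro continuous_intros continuous_on_powr') auto
  then obtain d where d: "0 < d" "\<And>r. 0 \<le> r \<Longrightarrow> r < d \<Longrightarrow> L * r + C * r powr \<alpha> < e"
    unfolding continuous_on_iff using e alpha
    by (elim ballE[where x = 0] allE[where x = e]) (auto simp: dist_real_def abs_less_iff)
  have key: "f z - f w < e" if zw: "z \<in> S" "w \<in> S" "dist z w < d" for z w
  proof -
    have n: "norm (fst z - fst w) \<le> dist z w" "\<bar>snd z - snd w\<bar> \<le> dist z w"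
      using dist_fst_le[of z w] dist_snd_le[of z w] by (auto simp: dist_norm)
    have "f z - f w \<le> L * norm (fst z - fst w) + C * \<bar>snd z - snd w\<bar> powr \<alpha>"
      using mod[of "fst z" "snd z" "fst w" "snd w"] zw by simp
    also have "\<dots> \<le> L * dist z w + C * dist z w powr \<alpha>"
      using n L C alpha by (intro add_mono mult_left_mono powr_mono2) auto
    also have "\<dots> < e" using d(2) zw(3) by simp
    finally show ?thesis .
  qed
  have "dist (f w) (f z) < e" if "z \<in> S" "w \<in> S" "dist w z < d" for z w
    using key[of z w] key[of w z] that by (simp add: dist_real_def abs_less_iff dist_commute)
  then show "\<exists>d>0. \<forall>x\<in>S. \<forall>x'\<in>S. dist x' x < d \<longrightarrow> dist (f x') (f x) < e" using d(1) by blast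
qed

theorem theorem1p1:
  fixes H :: "real ^ 'n \<Rightarrow> real ^ 'n \<Rightarrow> real"
    and u0 :: "real ^ 'n \<Rightarrow> real"
    and Hbar :: "real ^ 'n \<Rightarrow> real"
    and T \<alpha> :: real
    and u :: "real \<Rightarrow> (real ^ 'n) \<times> real \<Rightarrow> real"
  assumes T: "0 < T" and alpha: "0 < \<alpha>" "\<alpha> < 1"
    and H_cont: "continuous_on UNIV (\<lambda>(y, p). H y p)"
    and A1: "((\<lambda>r. INF (y, p) \<in> UNIV \<times> {p. norm p \<ge> r}. ereal (H y p)) \<longlongrightarrow> \<infinity>) at_top"
    and A2: "\<And>p. integer_periodic (\<lambda>y. H y p)"
    and A3: "\<exists>L. L-lipschitz_on UNIV u0" "BUC_on UNIV u0"
    and Hbar: "effective_Hamiltonian H Hbar"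
    and u_sol: "\<And>\<epsilon>. \<epsilon> > 0 \<Longrightarrow>
        BUC_on (space_time T) (u \<epsilon>) \<and>
        viscosity_solution T \<alpha> (\<lambda>x p. H (x /\<^sub>R \<epsilon>) p) u0 (u \<epsilon>)"
  shows "\<exists>ubar.
      BUC_on (space_time T) ubar \<and>
      viscosity_solution T \<alpha> (\<lambda>x p. Hbar p) u0 ubar \<and>
      (\<forall>w. BUC_on (space_time T) w \<and> viscosity_solution T \<alpha> (\<lambda>x p. Hbar p) u0 w \<longrightarrow>
        (\<forall>z\<in>space_time T. w z = ubar z)) \<and>
      (\<forall>C. compact C \<and> C \<subseteq> space_time T \<longrightarrow> uniform_limit C u ubar (at_right 0))"
proof -
  let ?S = "space_time T :: ((real ^ 'n) \<times> real) set"
  have coer: "\<exists>R. \<forall>y p. H y p \<le> c \<longrightarrow> norm p \<le> R" for c by (rule coercive_Hamiltonian[OF A1])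
  have cell: "\<exists>v. cell_solution H p (Hbar p) v" for p using Hbar by (auto simp: effective_Hamiltonian_def)
  have Hbc: "continuous_on UNIV Hbar" by (rule effective_Hamiltonian_continuous[OF H_cont A2 coer cell])
  obtain L where L: "0 < L" "L-lipschitz_on UNIV u0"
  proof -
    obtain L0 where "L0-lipschitz_on UNIV u0" using A3(1) by blast
    then have "(L0 + 1)-lipschitz_on UNIV u0" "0 < L0 + 1"
      using lipschitz_on_le[of L0 UNIV u0 "L0 + 1"] lipschitz_on_nonneg[of L0 UNIV u0] by auto
    then show ?thesis using that by blast
  qed
  obtain B1 where B1: "\<And>y p. norm p \<le> L \<Longrightarrow> \<bar>H y p\<bar> \<le> B1"
    using periodic_Hamiltonian_bounded[OF H_cont A2] by blast
  have "bounded (Hbar ` cball 0 L)"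
    by (intro compact_imp_bounded compact_continuous_image continuous_on_subset[OF Hbc]) auto
  then obtain B2 where B2: "\<And>p. norm p \<le> L \<Longrightarrow> \<bar>Hbar p\<bar> \<le> B2"
    unfolding bounded_iff real_norm_def by (auto simp flip: mem_cball_0 simp del: mem_cball)
  \<comment> \<open>One constant serves the barriers for all \<open>u \<epsilon>\<close> and for solutions of the effective problem.\<close>
  define C where "C = (max B1 B2 + 1) * Gamma (1 - \<alpha>)"
  have G: "0 < Gamma (1 - \<alpha>)" using alpha by (simp add: Gamma_real_pos)
  have B0: "0 \<le> B1" using B1[of 0 0] L by simp
  have C0: "0 \<le> C" using B0 G by (simp add: C_def)
  have CG: "C / Gamma (1 - \<alpha>) = max B1 B2 + 1" using G by (simp add: C_def)
  have H1: "- (C / Gamma (1 - \<alpha>)) < H y p" "H y p < C / Gamma (1 - \<alpha>)" if "norm p \<le> L" for y p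
    using B1[OF that, of y] unfolding CG by auto
  have H2: "- (C / Gamma (1 - \<alpha>)) < Hbar p" "Hbar p < C / Gamma (1 - \<alpha>)" if "norm p \<le> L" for p
    using B2[OF that] unfolding CG by auto
  have bounded_of: "\<exists>M. \<forall>z\<in>?S. \<bar>w z\<bar> \<le> M" if "BUC_on ?S w" for w
    using that by (auto simp: BUC_on_def bounded_iff)
  have barrier: "w (x, t) \<le> u0 x + C * t powr \<alpha>" "u0 x - C * t powr \<alpha> \<le> w (x, t)"
    if w: "BUC_on ?S w" "viscosity_solution T \<alpha> F u0 w" and xt: "(x, t) \<in> ?S"
      and F: "\<And>x p. norm p \<le> L \<Longrightarrow> - (C / Gamma (1 - \<alpha>)) < F x p" "\<And>x p. norm p \<le> L \<Longrightarrow> F x p < C / Gamma (1 - \<alpha>)"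
    for w F x t
  proof -
    obtain M where M: "\<And>z. z \<in> ?S \<Longrightarrow> \<bar>w z\<bar> \<le> M" using bounded_of[OF w(1)] by blast
    have M1: "w z \<le> M" and M2: "- M \<le> w z" if "z \<in> ?S" for z using M[OF that] by auto
    have sol: "viscosity_subsolution T \<alpha> F u0 w" "viscosity_supersolution T \<alpha> F u0 w"
      using w(2) by (simp_all add: viscosity_solution_def)
    have t: "0 \<le> t" "t \<le> T" using xt by auto
    show "w (x, t) \<le> u0 x + C * t powr \<alpha>"
      by (rule subsolution_barrier[OF alpha sol(1) M1 L C0 F(1) t])
    show "u0 x - C * t powr \<alpha> \<le> w (x, t)"
      by (rule supersolution_barrier[OF alpha sol(2) M2 L C0 F(2) t])
  qed
  obtain M0 where M0: "\<And>x. \<bar>u0 x\<bar> \<le> M0" using A3(2) by (auto simp: BUC_on_def bounded_iff)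
  define M where "M = M0 + C * T powr \<alpha>"
  have ub: "u \<epsilon> (x, t) \<le> u0 x + C * t powr \<alpha>" "u0 x - C * t powr \<alpha> \<le> u \<epsilon> (x, t)"
    if "0 < \<epsilon>" "(x, t) \<in> ?S" for \<epsilon> x t
    using barrier[OF conjunct1[OF u_sol] conjunct2[OF u_sol], OF that(1) that(1) that(2)] H1 by auto
  have uM: "\<bar>u \<epsilon> z\<bar> \<le> M" if "0 < \<epsilon>" "z \<in> ?S" for \<epsilon> z
  proof -
    obtain x t where z: "z = (x, t)" by (cases z)
    have t: "0 \<le> t" "t \<le> T" using that(2) by (auto simp: z)
    have "C * t powr \<alpha> \<le> C * T powr \<alpha>" using t alpha C0 by (intro mult_left_mono powr_mono2) auto
    then show ?thesis using ub[of \<epsilon> x t] that M0[of x] by (auto simp: z M_def abs_le_iff)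
  qed
  have u0c: "continuous_on UNIV u0" using A3(2) by (simp add: BUC_on_def uniformly_continuous_imp_continuous)
  define us where "us = relaxed_limsup ?S u"
  define us' where "us' = relaxed_limsup ?S (\<lambda>\<epsilon> z. - u \<epsilon> z)"
  have uM': "\<bar>- u \<epsilon> z\<bar> \<le> M" if "0 < \<epsilon>" "z \<in> ?S" for \<epsilon> z using uM[OF that] by simp
  have subs: "viscosity_subsolution T \<alpha> (\<lambda>x p. Hbar p) u0 us"
    and us_up: "\<And>x t. (x, t) \<in> ?S \<Longrightarrow> us (x, t) \<le> u0 x + C * t powr \<alpha>"
  proof -
    have cl: "\<exists>v. continuous_on UNIV v \<and> integer_periodic v \<and>
      (\<forall>\<psi> D y. has_C1_gradient_on \<psi> D UNIV \<longrightarrow> (\<forall>z. v z - \<psi> z \<ge> v y - \<psi> y) \<longrightarrow> Hbar p \<le> H y (p + D y))" for p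
    proof -
      obtain v where v: "cell_solution H p (Hbar p) v" using cell by blast
      then have "continuous_on UNIV v" "integer_periodic v" by (simp_all add: cell_solution_def)
      then show ?thesis using cell_solution_super[OF v] by blast
    qed
    have sb: "viscosity_subsolution T \<alpha> (\<lambda>x p. H (x /\<^sub>R \<epsilon>) p) u0 (u \<epsilon>)" if "0 < \<epsilon>" for \<epsilon>
      using u_sol[OF that] by (simp add: viscosity_solution_def)
    have co: "coercive H \<or> anticoercive H"
      using coer by blast
    note * = relaxed_limsup_subsolution[where H = H and u = u, OF alpha T H_cont A2 co sb uM u0c ub(1) cl]
    show "viscosity_subsolution T \<alpha> (\<lambda>x p. Hbar p) u0 us" unfolding us_def by (rule *(1))
    show "us (x, t) \<le> u0 x + C * t powr \<alpha>" if "(x, t) \<in> ?S" for x t unfolding us_def by (rule *(2)) (use that in auto)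
  qed
  have sups: "viscosity_supersolution T \<alpha> (\<lambda>x p. Hbar p) u0 (\<lambda>z. - us' z)"
    and us_lo: "\<And>x t. (x, t) \<in> ?S \<Longrightarrow> u0 x - C * t powr \<alpha> \<le> - us' (x, t)"
  proof -
    \<comment> \<open>The functions \<open>- u \<epsilon>\<close> are subsolutions for \<open>?H\<close>, whose correctors are the negated correctors
      of \<open>H\<close> for the opposite gradient.\<close>
    let ?H = "\<lambda>y p. - H y (- p)"
    have Hc': "continuous_on UNIV (\<lambda>(y, p). ?H y p)"
    proof -
      have "continuous_on UNIV (\<lambda>z. - (\<lambda>(y, p). H y p) (fst z, - snd z))"
        by (intro continuous_intros continuous_on_compose2[OF H_cont]) auto
      then show ?thesis by (simp add: case_prod_beta)
    qed
    have per': "integer_periodic (\<lambda>y. ?H y p)" for p using A2[of "- p"] by (simp add: integer_periodic_def)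
    have co: "coercive ?H \<or> anticoercive ?H"
    proof (rule disjI2, rule allI)
      fix c
      obtain R where R: "\<And>y p. H y p \<le> - c \<Longrightarrow> norm p \<le> R" using coer by meson
      have "norm p \<le> R" if "c \<le> ?H y p" for y p using R[of y "- p"] that by simp
      then show "\<exists>R. \<forall>y p. c \<le> ?H y p \<longrightarrow> norm p \<le> R" by blast
    qed
    have sb: "viscosity_subsolution T \<alpha> (\<lambda>x p. ?H (x /\<^sub>R \<epsilon>) p) (\<lambda>x. - u0 x) (\<lambda>z. - u \<epsilon> z)" if "0 < \<epsilon>" for \<epsilon>
      using supersolution_uminus u_sol[OF that] by (auto simp: viscosity_solution_def)
    have br: "- u \<epsilon> (x, t) \<le> - u0 x + C * t powr \<alpha>" if "0 < \<epsilon>" "(x, t) \<in> ?S" for \<epsilon> x t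
      using ub(2)[OF that] by simp
    have cl: "\<exists>v. continuous_on UNIV v \<and> integer_periodic v \<and>
      (\<forall>\<psi> D y. has_C1_gradient_on \<psi> D UNIV \<longrightarrow> (\<forall>z. v z - \<psi> z \<ge> v y - \<psi> y) \<longrightarrow> - Hbar (- p) \<le> ?H y (p + D y))" for p
    proof -
      obtain v where v: "cell_solution H (- p) (Hbar (- p)) v" using cell by blast
      have "continuous_on UNIV (\<lambda>y. - v y)" "integer_periodic (\<lambda>y. - v y)"
        using v by (auto simp: cell_solution_def integer_periodic_def intro: continuous_on_minus)
      moreover have "- Hbar (- p) \<le> ?H y (p + D y)"
        if g: "has_C1_gradient_on \<psi> D UNIV" and m: "\<forall>z. - v z - \<psi> z \<ge> - v y - \<psi> y" for \<psi> D y
      proof -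
        have "H y (- p + (- 1) *\<^sub>R D y) \<le> Hbar (- p)"
        proof (rule cell_solution_sub[OF v has_C1_gradient_on_cmult[OF g, of "- 1"]])
          fix z show "v z - - 1 * \<psi> z \<le> v y - - 1 * \<psi> y" using m[rule_format, of z] by simp
        qed
        then show ?thesis by simp
      qed
      ultimately show ?thesis by (intro exI[of _ "\<lambda>y. - v y"]) blast
    qed
    have u0c': "continuous_on UNIV (\<lambda>x. - u0 x)" using u0c by (rule continuous_on_minus)
    note * = relaxed_limsup_subsolution[where H = ?H and u = "\<lambda>\<epsilon> z. - u \<epsilon> z" and Hb = "\<lambda>p. - Hbar (- p)",
        OF alpha T Hc' per' co sb uM' u0c' br cl]
    have "viscosity_subsolution T \<alpha> (\<lambda>x p. - Hbar (- p)) (\<lambda>x. - u0 x) us'" unfolding us'_def by (rule *(1))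
    from subsolution_uminus[OF this] show "viscosity_supersolution T \<alpha> (\<lambda>x p. Hbar p) u0 (\<lambda>z. - us' z)" by simp
    show "u0 x - C * t powr \<alpha> \<le> - us' (x, t)" if "(x, t) \<in> ?S" for x t
    proof -
      have "us' (x, t) \<le> - u0 x + C * t powr \<alpha>" unfolding us'_def by (rule *(2)) (use that in auto)
      then show ?thesis by simp
    qed
  qed
  have usM: "\<bar>us z\<bar> \<le> M" if "z \<in> ?S" for z
    unfolding us_def by (rule relaxed_limsup_abs_le[where u = u and S = ?S, OF uM that])
  have usM': "\<bar>- us' z\<bar> \<le> M" if "z \<in> ?S" for z
    using relaxed_limsup_abs_le[where u = "\<lambda>\<epsilon> z. - u \<epsilon> z" and S = ?S, OF uM' that] by (simp add: us'_def)
  have cmp: "us (x, t) - (- us' (y, s)) \<le> L * norm (x - y) + C * \<bar>t - s\<bar> powr \<alpha>"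
    if "(x, t) \<in> ?S" "(y, s) \<in> ?S" for x t y s
    by (rule comparison_with_moduli[OF alpha T Hbc subs sups usM usM' L(2) C0 us_up us_lo that])
  have eq: "us z = - us' z" if z: "z \<in> ?S" for z
  proof -
    have "us z \<le> - us' z" using cmp[of "fst z" "snd z" "fst z" "snd z"] z alpha by simp
    moreover have "0 \<le> us z + us' z"
      unfolding us_def us'_def by (rule relaxed_limsup_uminus[OF uM z])
    ultimately show ?thesis by simp
  qed
  have buc: "BUC_on ?S us"
    by (rule BUC_on_from_modulus[OF alpha(1) less_imp_le[OF L(1)] C0 usM]) (use cmp eq in auto)
  then have usc: "continuous_on ?S us" by (simp add: BUC_on_def uniformly_continuous_imp_continuous)
  have sups': "viscosity_supersolution T \<alpha> (\<lambda>x p. Hbar p) u0 us"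
    by (rule supersolution_cong[OF sups]) (use T eq in auto)
  have sol: "viscosity_solution T \<alpha> (\<lambda>x p. Hbar p) u0 us"
    using usc subs sups' by (simp add: viscosity_solution_def)
  have le: "w z \<le> w' z"
    if w: "BUC_on ?S w" "viscosity_solution T \<alpha> (\<lambda>x p. Hbar p) u0 w"
      and w': "BUC_on ?S w'" "viscosity_solution T \<alpha> (\<lambda>x p. Hbar p) u0 w'" and z: "z \<in> ?S" for w w' z
  proof -
    obtain M1 where M1: "\<And>z. z \<in> ?S \<Longrightarrow> \<bar>w z\<bar> \<le> M1" using bounded_of[OF w(1)] by blast
    obtain M2 where M2: "\<And>z. z \<in> ?S \<Longrightarrow> \<bar>w' z\<bar> \<le> M2" using bounded_of[OF w'(1)] by blast
    have "w (fst z, snd z) - w' (fst z, snd z) \<le> L * norm (fst z - fst z) + C * \<bar>snd z - snd z\<bar> powr \<alpha>"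
    proof (rule comparison_with_moduli[OF alpha T Hbc _ _ _ _ L(2) C0, where M = "max M1 M2"])
      show "viscosity_subsolution T \<alpha> (\<lambda>x p. Hbar p) u0 w" using w(2) by (simp add: viscosity_solution_def)
      show "viscosity_supersolution T \<alpha> (\<lambda>x p. Hbar p) u0 w'" using w'(2) by (simp add: viscosity_solution_def)
      show "\<bar>w z\<bar> \<le> max M1 M2" "\<bar>w' z\<bar> \<le> max M1 M2" if "z \<in> ?S" for z using M1[OF that] M2[OF that] by auto
      show "w (x, t) \<le> u0 x + C * t powr \<alpha>" if "(x, t) \<in> ?S" for x t by (rule barrier(1)[OF w that H2])
      show "u0 x - C * t powr \<alpha> \<le> w' (x, t)" if "(x, t) \<in> ?S" for x t by (rule barrier(2)[OF w' that H2])
    qed (use z in auto)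
    then show ?thesis using alpha by simp
  qed
  have uniq: "w z = us z" if "BUC_on ?S w" "viscosity_solution T \<alpha> (\<lambda>x p. Hbar p) u0 w" "z \<in> ?S" for w z
    using le[OF that(1,2) buc sol that(3)] le[OF buc sol that] by simp
  have conv: "uniform_limit K u us (at_right 0)" if K: "compact K" "K \<subseteq> ?S" for K
  proof (rule uniform_limit_on_compact[OF K usc])
    fix z and e :: real assume z: "z \<in> ?S" and e: "0 < e"
    obtain d where d: "d > 0" "bounded_near ?S u z d (us z + e)"
      using relaxed_limsup_upper[where u = u and S = ?S, OF uM z, of "us z + e"] e by (auto simp: us_def)
    obtain d' where d': "d' > 0" "bounded_near ?S (\<lambda>\<epsilon> w. - u \<epsilon> w) z d' (us' z + e)"
      using relaxed_limsup_upper[where u = "\<lambda>\<epsilon> z. - u \<epsilon> z" and S = ?S, OF uM' z, of "us' z + e"] e by (auto simp: us'_def)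
    have "\<bar>u \<epsilon> w - us z\<bar> \<le> e" if "0 < \<epsilon>" "\<epsilon> < min d d'" "w \<in> ?S" "dist w z < min d d'" for \<epsilon> w
    proof -
      have "u \<epsilon> w \<le> us z + e" "- u \<epsilon> w \<le> us' z + e"
        using that d(2)[rule_format, of \<epsilon> w] d'(2)[rule_format, of \<epsilon> w] by simp_all
      then show ?thesis using eq[OF z] by (simp add: abs_le_iff)
    qed
    then show "\<exists>d>0. \<forall>\<epsilon> w. 0 < \<epsilon> \<and> \<epsilon> < d \<and> w \<in> ?S \<and> dist w z < d \<longrightarrow> \<bar>u \<epsilon> w - us z\<bar> \<le> e"
      using d(1) d'(1) by (intro exI[of _ "min d d'"]) auto
  qed
  show ?thesis using buc sol uniq conv by blast
qed

end
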